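(* Let $h>0$ and $\beta>0$, and let $q=q(\beta,h)$, the Gaussian matrices $\mathbf g$ and the iterates $\mathbf m^{(k)}\in\mathbb R^N$ be as defined in the context. Assume that $$\beta^2\,E\cosh^{-4}\left(h+\beta\sqrt q\,Z\right)\le 1, \qquad (\ast)$$ where $Z$ is a standard Gaussian random variable. Then $$\lim_{k,k'\to\infty}\ \limsup_{N\to\infty}\ \mathbb E\left\|\mathbf m^{(k)}-\mathbf m^{(k')}\right\|^2=0 .$$ If there is strict inequality in $(\ast)$, then there exist $0<\lambda(\beta,h)<1$ and $C>0$ such that for all $k$ $$\limsup_{N\to\infty}\ \mathbb E\left\|\mathbf m^{(k+1)}-\mathbf m^{(k)}\right\|^2\le C\lambda^k .$$
   Context: For $h>0$, $\beta>0$, $q=q(\beta,h)>0$ denotes the unique solution of $q=E\tanh^2(h+\beta\sqrt q\,Z)$, $Z$ standard Gaussian. Write $\mathrm{Th}(x)=\tanh(h+\beta x)$; a function $\mathbb R\to\mathbb R$ applied to a vector is applied coordinatewise. For each $N\in\mathbb N$, $\mathbf g=(g_{ij})_{1\le i,j\le N}$ is a random matrix on a probability space $(\Omega,\mathcal F,\mathbb P)$ (expectation $\mathbb E$): the $g_{ij}$, $i<j$, are independent centered Gaussians with variance $1/N$, $g_{ij}=g_{ji}$, $g_{ii}=0$. The dependence on $N$ is suppressed in the notation. For $\mathbf x,\mathbf y\in\mathbb R^N$: $\langle\mathbf x,\mathbf y\rangle=\frac1N\sum_{i=1}^N x_iy_i$ and $\|\mathbf x\|=\sqrt{\langle\mathbf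 x,\mathbf x\rangle}$. The iterates are the random vectors in $\mathbb R^N$ defined by $\mathbf m^{(0)}=0$, $\mathbf m^{(1)}=\sqrt q\,\mathbf 1$ ($\mathbf 1$ the all-ones vector), and $$\mathbf m^{(k+1)}=\mathrm{Th}\left(\mathbf g\,\mathbf m^{(k)}-\beta(1-q)\,\mathbf m^{(k-1)}\right),\quad k\ge1 .$$ *)

theory Defs
  imports "HOL-Probability.Probability"
begin

text \<open>
  As the dimension \<open>N\<close> tends to infinity inside the statement, a vector of \<open>\<real>\<^sup>N\<close> is a function
  \<open>nat \<Rightarrow> real\<close> of which only the coordinates in \<open>{1..N}\<close> are ever used, and likewise an
  \<open>N \<times> N\<close> matrix is a function \<open>nat \<Rightarrow> nat \<Rightarrow> real\<close>.
\<close>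

definition nip :: "nat \<Rightarrow> (nat \<Rightarrow> real) \<Rightarrow> (nat \<Rightarrow> real) \<Rightarrow> real" where
  "nip N x y = (1 / real N) * (\<Sum>i = 1..N. x i * y i)"

definition nnorm :: "nat \<Rightarrow> (nat \<Rightarrow> real) \<Rightarrow> real" where
  "nnorm N x = sqrt (nip N x x)"

definition matvec :: "nat \<Rightarrow> (nat \<Rightarrow> nat \<Rightarrow> real) \<Rightarrow> (nat \<Rightarrow> real) \<Rightarrow> (nat \<Rightarrow> real)" where
  "matvec N A x = (\<lambda>i. \<Sum>j = 1..N. A i j * x j)"

definition Th :: "real \<Rightarrow> real \<Rightarrow> real \<Rightarrow> real" where
  "Th h \<beta> x = tanh (h + \<beta> * x)"

fun tap_iter :: "real \<Rightarrow> real \<Rightarrow> real \<Rightarrow> nat \<Rightarrow> (nat \<Rightarrow> nat \<Rightarrow> real) \<Rightarrow> nat \<Rightarrow> (nat \<Rightarrow> real)" where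
  "tap_iter h \<beta> q N A 0 = (\<lambda>i. 0)"
| "tap_iter h \<beta> q N A (Suc 0) = (\<lambda>i. sqrt q)"
| "tap_iter h \<beta> q N A (Suc (Suc k)) =
     (\<lambda>i. Th h \<beta> (matvec N A (tap_iter h \<beta> q N A (Suc k)) i
                   - \<beta> * (1 - q) * tap_iter h \<beta> q N A k i))"

text \<open>
  The second parameter of \<^const>\<open>normal_density\<close> is the standard deviation, so
  \<open>1 / sqrt N\<close> gives variance \<open>1 / N\<close>.
\<close>

definition sk_matrix :: "'a measure \<Rightarrow> nat \<Rightarrow> (nat \<Rightarrow> nat \<Rightarrow> 'a \<Rightarrow> real) \<Rightarrow> bool" where
  "sk_matrix M N g \<longleftrightarrow>
     prob_space M \<and>
     prob_space.indep_vars M (\<lambda>_. borel) (\<lambda>(i, j). g i j) {(i, j). 1 \<le> i \<and> i < j \<and> j \<le> N} \<and>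
     (\<forall>i j. 1 \<le> i \<and> i < j \<and> j \<le> N \<longrightarrow>
        distributed M lborel (g i j) (normal_density 0 (1 / sqrt (real N)))) \<and>
     (\<forall>i\<in>{1..N}. \<forall>j\<in>{1..N}. \<forall>\<omega>\<in>space M. g i j \<omega> = g j i \<omega>) \<and>
     (\<forall>i\<in>{1..N}. \<forall>\<omega>\<in>space M. g i i \<omega> = 0)"

definition iter_msd ::
    "real \<Rightarrow> real \<Rightarrow> real \<Rightarrow> 'a measure \<Rightarrow> nat \<Rightarrow> (nat \<Rightarrow> nat \<Rightarrow> 'a \<Rightarrow> real) \<Rightarrow> nat \<Rightarrow> nat \<Rightarrow> real" where
  "iter_msd h \<beta> q M N g k k' =
     (\<integral>\<omega>. (nnorm N (\<lambda>i. tap_iter h \<beta> q N (\<lambda>i j. g i j \<omega>) k i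
                        - tap_iter h \<beta> q N (\<lambda>i j. g i j \<omega>) k' i))\<^sup>2 \<partial>M)"

end

theory Submission
  imports Defs
begin

text \<open>
  The Gaussian matrix is rebuilt one direction at a time, as in Bolthausen's conditioning argument.
  If \<open>u\<close> is a unit vector and \<open>P = 1 - u u\<^sup>T\<close>, then replacing the row and column of a GOE matrix \<open>S\<close> in
  direction \<open>u\<close> by a fresh Gaussian vector \<open>z\<close> does not change its law, even if \<open>u\<close> depends on
  data independent of \<open>S\<close> and \<open>z\<close>. Taking for \<open>u\<close> successively the Gram--Schmidt directions of the iterates
  turns the iterates into explicit functions of independent Gaussian vectors. There the Onsager term cancels
  the correlation created by the reuse of the matrix, and the weak law of large numbers gives
  \<open>\<langle>m\<^sup>j, m\<^sup>k\<rangle> \<rightarrow> \<rho>\<^sub>j\<close> for \<open>j < k\<close> and \<open>\<langle>m\<^sup>k, m\<^sup>k\<rangle> \<rightarrow> q\<close>. The GOE diagonal is removed by an operator norm bound.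
  The overlaps satisfy \<open>\<rho>\<^sub>k\<^sub>+\<^sub>1 = \<psi> \<rho>\<^sub>k\<close>, and \<open>q - \<psi> t\<close> is a mean conditional variance, so the strict Gaussian
  Poincare inequality bounds it by \<open>\<beta>\<^sup>2 E cosh\<^sup>-\<^sup>4 (q - t)\<close>; hence \<open>\<rho>\<^sub>k\<close> increases to \<open>q\<close>, geometrically if the
  inequality in the hypothesis is strict.
\<close>

section \<open>Uniqueness of characteristic functions on product spaces\<close>

text \<open>No conditional expectation appears. The direction of each resampling step is random, but
  it is a function of rows of a Gaussian array that were drawn earlier. With those rows frozen, the
  law identity concerns a deterministic direction, and Fubini puts the randomness back. The identity
  itself is an equality of covariances. These are degenerate (symmetric matrices, zero padding), so
  Gaussian families are described by characteristic functions and not by densities, which is why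
  uniqueness on product spaces comes at the start. The zero-diagonal matrix is not rotation
  invariant, whereas the GOE with its diagonal of doubled variance is; hence the detour through the
  full matrix and the comparison at the end. One array \<open>\<zeta>\<close> serves all dimensions:
  row \<open>l\<close> is the fresh vector of step \<open>l\<close>, column \<open>i\<close> belongs
  to site \<open>i\<close>. Independent rows separate the steps, i.i.d. columns give the law of
  large numbers. That the Gram-Schmidt scheme stays nondegenerate in the limit rests on the strict
  bound \<open>rho k < q\<close>.\<close>

lemma weighted_char_unique:
  fixes p X :: "'a \<Rightarrow> real" and r Y :: "'b \<Rightarrow> real"
  assumes P: "finite_measure P" and Q: "finite_measure Q"
    and p[measurable]: "p \<in> borel_measurable P" and r[measurable]: "r \<in> borel_measurable Q"
    and X[measurable]: "X \<in> borel_measurable P" and Y[measurable]: "Y \<in> borel_measurable Q"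
    and pb: "\<And>x. 0 \<le> p x" "\<And>x. p x \<le> B" and rb: "\<And>x. 0 \<le> r x" "\<And>x. r x \<le> B"
    and eq: "\<And>s. (CLINT x|P. p x *\<^sub>R iexp (s * X x)) = (CLINT x|Q. r x *\<^sub>R iexp (s * Y x))"
    and A[measurable]: "A \<in> sets borel"
  shows "(LINT x|P. p x * indicator A (X x)) = (LINT x|Q. r x * indicator A (Y x))"
proof -
  interpret P: finite_measure P by fact
  interpret Q: finite_measure Q by fact
  have pint: "integrable P p" by (rule P.integrable_const_bound[where B=B]) (use pb in auto)
  have rint: "integrable Q r" by (rule Q.integrable_const_bound[where B=B]) (use rb in auto)
  \<comment> \<open>The case \<open>s = 0\<close> of \<open>eq\<close> gives both weights the same
    total mass. If it is positive, division by it makes the weights probability densities, and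
    Levy's uniqueness theorem applies to the laws of \<open>X\<close> and \<open>Y\<close> under
    them.\<close>
  define a where "a = (LINT x|P. p x)"
  have "complex_of_real (LINT x|P. p x) = complex_of_real (LINT x|Q. r x)"
    using eq[of 0] by (simp add: scaleR_conv_of_real)
  then have a': "a = (LINT x|Q. r x)" by (simp add: a_def)
  have a0: "a \<ge> 0" unfolding a_def using pb by simp
  show ?thesis
  proof (cases "a = 0")
    case True
    have "AE x in P. p x = 0" using integral_nonneg_eq_0_iff_AE[OF pint] pb True a_def by auto
    then have "(LINT x|P. p x * indicator A (X x)) = (LINT x|P. 0)"
      by (intro integral_cong_AE) auto
    moreover have "AE x in Q. r x = 0" using integral_nonneg_eq_0_iff_AE[OF rint] rb True a' by auto
    then have "(LINT x|Q. r x * indicator A (Y x)) = (LINT x|Q. 0)"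
      by (intro integral_cong_AE) auto
    ultimately show ?thesis by simp
  next
    case False
    then have apos: "a > 0" using a0 by simp
    have *: "real_distribution (distr (density M (\<lambda>x. ennreal (w x / a))) borel Z)
       \<and> char (distr (density M (\<lambda>x. ennreal (w x / a))) borel Z) = (\<lambda>s. (CLINT x|M. w x *\<^sub>R iexp (s * Z x)) / a)
       \<and> measure (distr (density M (\<lambda>x. ennreal (w x / a))) borel Z) A = (LINT x|M. w x * indicator A (Z x)) / a"
      if M: "finite_measure M" and w[measurable]: "w \<in> borel_measurable M" and Z[measurable]: "Z \<in> borel_measurable M"
        and wb: "\<And>x. 0 \<le> w x" "\<And>x. w x \<le> B" and aa: "a = (LINT x|M. w x)"
      for M :: "'c measure" and w Z
    proof (intro conjI)
      interpret M: finite_measure M by fact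
      let ?D = "density M (\<lambda>x. ennreal (w x / a))"
      have wint: "integrable M w" by (rule M.integrable_const_bound[where B=B]) (use wb in auto)
      have "emeasure ?D (space ?D) = (\<integral>\<^sup>+x. ennreal (w x / a) \<partial>M)"
        by (simp add: emeasure_density cong: nn_integral_cong)
      also have "\<dots> = ennreal (LINT x|M. w x / a)"
        by (rule nn_integral_eq_integral) (use wint wb apos in auto)
      also have "\<dots> = 1" using aa apos by simp
      finally have "prob_space ?D" by (rule prob_spaceI)
      then interpret D: prob_space ?D .
      show "real_distribution (distr ?D borel Z)"
        by (rule D.real_distribution_distr) simp
      show "char (distr ?D borel Z) = (\<lambda>s. (CLINT x|M. w x *\<^sub>R iexp (s * Z x)) / a)"
      proof
        fix s
        have "char (distr ?D borel Z) s = (CLINT x|?D. iexp (s * Z x))"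
          unfolding char_def by (rule integral_distr) auto
        also have "\<dots> = (CLINT x|M. (w x / a) *\<^sub>R iexp (s * Z x))"
          by (rule integral_density) (use wb apos in auto)
        also have "\<dots> = (CLINT x|M. (w x *\<^sub>R iexp (s * Z x)) / a)"
          by (rule Bochner_Integration.integral_cong) (auto simp: scaleR_conv_of_real)
        finally show "char (distr ?D borel Z) s = (CLINT x|M. w x *\<^sub>R iexp (s * Z x)) / a" by simp
      qed
      have "measure (distr ?D borel Z) A = (LINT x|distr ?D borel Z. indicator A x)" by simp
      also have "\<dots> = (LINT x|?D. indicator A (Z x))" by (rule integral_distr) auto
      also have "\<dots> = (LINT x|M. (w x / a) *\<^sub>R indicator A (Z x))"
        by (rule integral_density) (use wb apos in auto)
      finally show "measure (distr ?D borel Z) A = (LINT x|M. w x * indicator A (Z x)) / a" by simp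
    qed
    note 1 = *[OF P p X pb a_def] and 2 = *[OF Q r Y rb a']
    have "distr (density P (\<lambda>x. ennreal (p x / a))) borel X = distr (density Q (\<lambda>x. ennreal (r x / a))) borel Y"
      by (rule Levy_uniqueness) (use 1 2 eq in auto)
    then show ?thesis using 1 2 apos by auto
  qed
qed

text \<open>A weight \<open>2 + cos\<close> is positive and at most 3, hence usable as a density,
  and Euler's formula turns it back into exponentials, whose integrals are controlled by the
  hypothesis on characteristic functions.\<close>

lemma cos_mult_iexp:
  "(w * (2 + cos (a + c))) *\<^sub>R iexp b
     = 2 * (w *\<^sub>R iexp (b + 0)) + iexp c / 2 * (w *\<^sub>R iexp (b + a)) + iexp (- c) / 2 * (w *\<^sub>R iexp (b + - a))"
proof -
  define d where "d = a + c"
  have "iexp c * iexp (b + a) = cis (b + d)" "iexp (- c) * iexp (b + - a) = cis (b - d)" "iexp b = cis b"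
    by (simp_all add: cis_conv_exp exp_add[symmetric] d_def algebra_simps)
  moreover have "(w * (2 + cos d)) *\<^sub>R cis b = 2 * (w *\<^sub>R cis b) + (w / 2) *\<^sub>R cis (b + d) + (w / 2) *\<^sub>R cis (b - d)"
    by (simp add: complex_eq_iff cos_add sin_add cos_diff sin_diff algebra_simps)
  moreover have "iexp c / 2 * (w *\<^sub>R iexp (b + a)) = (w / 2) *\<^sub>R (iexp c * iexp (b + a))"
    "iexp (- c) / 2 * (w *\<^sub>R iexp (b + - a)) = (w / 2) *\<^sub>R (iexp (- c) * iexp (b + - a))"
    by (simp_all add: scaleR_conv_of_real)
  ultimately show ?thesis by (simp add: d_def)
qed

text \<open>The induction moves one coordinate at a time from the exponential into an indicator.
  Levy's theorem needs a nonnegative weight, while the exponential of the remaining coordinates is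
  complex; the weight \<open>2 + cos\<close> with a free phase stands in for it.\<close>

lemma char_box_eq:
  fixes P Q :: "('i \<Rightarrow> real) measure" and A :: "'i \<Rightarrow> real set"
  assumes P: "finite_measure P" "sets P = sets (PiM UNIV (\<lambda>_. borel))"
    and Q: "finite_measure Q" "sets Q = sets (PiM UNIV (\<lambda>_. borel))"
    and eq: "\<And>J t. finite J \<Longrightarrow> (CLINT \<omega>|P. iexp (\<Sum>j\<in>J. t j * \<omega> j)) = (CLINT \<omega>|Q. iexp (\<Sum>j\<in>J. t j * \<omega> j))"
    and A: "\<And>j. A j \<in> sets borel" and "finite J" "finite K" "J \<inter> K = {}"
  shows "(CLINT \<omega>|P. (\<Prod>j\<in>J. indicator (A j) (\<omega> j)) *\<^sub>R iexp (\<Sum>k\<in>K. t k * \<omega> k))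
       = (CLINT \<omega>|Q. (\<Prod>j\<in>J. indicator (A j) (\<omega> j)) *\<^sub>R iexp (\<Sum>k\<in>K. t k * \<omega> k))"
  using \<open>finite J\<close> \<open>finite K\<close> \<open>J \<inter> K = {}\<close>
proof (induction J arbitrary: K t rule: finite_induct)
  case empty
  then show ?case using eq[of K t] by simp
next
  case (insert x J)
  interpret P: finite_measure P by fact
  interpret Q: finite_measure Q by fact
  define w :: "('i \<Rightarrow> real) \<Rightarrow> real" where "w \<omega> = (\<Prod>j\<in>J. indicator (A j) (\<omega> j))" for \<omega>
  define th where "th u \<omega> = (\<Sum>k\<in>K. u k * \<omega> k)" for u \<omega> :: "'i \<Rightarrow> real"
  have xK: "x \<notin> K" "finite (Set.insert x K)" "J \<inter> Set.insert x K = {}" using insert by auto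
  have comp: "(\<lambda>\<omega>. \<omega> i) \<in> borel_measurable M" if "sets M = sets (PiM UNIV (\<lambda>_. borel))" for i and M :: "('i \<Rightarrow> real) measure"
    by (subst measurable_cong_sets[OF that refl]) simp
  have cM[measurable]: "(\<lambda>\<omega>. \<omega> i) \<in> borel_measurable P" "(\<lambda>\<omega>. \<omega> i) \<in> borel_measurable Q" for i
    using comp P Q by auto
  have ms: "A j \<in> sets borel" for j using A .
  have iM: "(\<lambda>\<omega>. indicator (A j) (\<omega> j) :: real) \<in> borel_measurable M"
     if [measurable]: "(\<lambda>\<omega>. \<omega> j) \<in> borel_measurable M" for j and M :: "('i \<Rightarrow> real) measure"
    using ms[of j] by measurable
  have wM[measurable]: "w \<in> borel_measurable P" "w \<in> borel_measurable Q"
    unfolding w_def by (intro borel_measurable_prod iM; measurable)+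
  have thM[measurable]: "th u \<in> borel_measurable P" "th u \<in> borel_measurable Q" for u
    unfolding th_def by measurable
  have w01: "0 \<le> w \<omega>" "w \<omega> \<le> 1" for \<omega>
    unfolding w_def by (auto intro!: prod_nonneg prod_le_1)
  have IH: "(CLINT \<omega>|P. w \<omega> *\<^sub>R iexp (s * \<omega> x + th u \<omega>)) = (CLINT \<omega>|Q. w \<omega> *\<^sub>R iexp (s * \<omega> x + th u \<omega>))" for s u
  proof -
    have "(\<Sum>k\<in>Set.insert x K. (u(x:=s)) k * \<omega> k) = s * \<omega> x + th u \<omega>" for \<omega>
      using xK insert.prems unfolding th_def by (simp) (rule sum.cong, auto)
    then show ?thesis using insert.IH[OF xK(2,3), of "u(x:=s)"] unfolding w_def by simp
  qed
  have inti: "integrable M (\<lambda>\<omega>. v \<omega> *\<^sub>R iexp (g \<omega>))"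
    if "finite_measure M" and [measurable]: "v \<in> borel_measurable M" "g \<in> borel_measurable M" and "\<And>\<omega>. \<bar>v \<omega>\<bar> \<le> 3"
    for M :: "('i \<Rightarrow> real) measure" and v g
  proof -
    interpret finite_measure M by fact
    show ?thesis by (rule integrable_const_bound[where B=3]) (use that in auto)
  qed
  have main: "(CLINT \<omega>|M. (w \<omega> * (2 + cos (th u \<omega> + c))) *\<^sub>R iexp (s * \<omega> x))
      = 2 * (CLINT \<omega>|M. w \<omega> *\<^sub>R iexp (s * \<omega> x + th (\<lambda>_. 0) \<omega>))
       + iexp c / 2 * (CLINT \<omega>|M. w \<omega> *\<^sub>R iexp (s * \<omega> x + th u \<omega>))
       + iexp (-c) / 2 * (CLINT \<omega>|M. w \<omega> *\<^sub>R iexp (s * \<omega> x + th (\<lambda>k. - u k) \<omega>))"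
    if M: "finite_measure M" and [measurable]: "w \<in> borel_measurable M" "\<And>u. th u \<in> borel_measurable M"
       "(\<lambda>\<omega>. \<omega> x) \<in> borel_measurable M" for u c s and M :: "('i \<Rightarrow> real) measure"
  proof -
    have i: "integrable M (\<lambda>\<omega>. w \<omega> *\<^sub>R iexp (s * \<omega> x + th u \<omega>))" for u
    proof (rule inti[OF M])
      show "\<bar>w \<omega>\<bar> \<le> 3" for \<omega> using w01[of \<omega>] by auto
    qed measurable
    have "(w \<omega> * (2 + cos (th u \<omega> + c))) *\<^sub>R iexp (s * \<omega> x) =
        2 * (w \<omega> *\<^sub>R iexp (s * \<omega> x + th (\<lambda>_. 0) \<omega>))
       + iexp c / 2 * (w \<omega> *\<^sub>R iexp (s * \<omega> x + th u \<omega>))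
       + iexp (-c) / 2 * (w \<omega> *\<^sub>R iexp (s * \<omega> x + th (\<lambda>k. - u k) \<omega>))" for \<omega>
    proof -
      have 0: "th (\<lambda>_. 0) \<omega> = 0" "th (\<lambda>k. - u k) \<omega> = - th u \<omega>" unfolding th_def by (auto simp: sum_negf)
      show ?thesis unfolding 0 by (rule cos_mult_iexp)
    qed
    moreover have gen: "(CLINT \<omega>|M. 2 * f \<omega> + k1 * g \<omega> + k2 * h \<omega>) = 2 * (CLINT \<omega>|M. f \<omega>) + k1 * (CLINT \<omega>|M. g \<omega>) + k2 * (CLINT \<omega>|M. h \<omega>)"
      if "integrable M f" "integrable M g" "integrable M h" for f g h k1 k2
      using that by simp
    ultimately show ?thesis using gen[OF i i i] by (simp only:)
  qed
  have D: "(LINT \<omega>|P. (w \<omega> * (2 + cos (th u \<omega> + c))) * indicator (A x) (\<omega> x))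
     = (LINT \<omega>|Q. (w \<omega> * (2 + cos (th u \<omega> + c))) * indicator (A x) (\<omega> x))" for u c
  proof (rule weighted_char_unique[where B=3, OF P(1) Q(1)])
    have b: "- 1 \<le> cos (th u \<omega> + c) \<and> cos (th u \<omega> + c) \<le> 1" for \<omega> by simp
    show 0: "0 \<le> w \<omega> * (2 + cos (th u \<omega> + c))" for \<omega>
      using b[of \<omega>] w01[of \<omega>] by (intro mult_nonneg_nonneg) linarith+
    show 1: "w \<omega> * (2 + cos (th u \<omega> + c)) \<le> 3" for \<omega>
      using mult_mono[of "w \<omega>" 1 "2 + cos (th u \<omega> + c)" 3] w01[of \<omega>] b[of \<omega>] by auto
    from 0 1 show "0 \<le> w \<omega> * (2 + cos (th u \<omega> + c))" "w \<omega> * (2 + cos (th u \<omega> + c)) \<le> 3" for \<omega> by auto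
    show "(CLINT \<omega>|P. (w \<omega> * (2 + cos (th u \<omega> + c))) *\<^sub>R iexp (s * \<omega> x)) = (CLINT \<omega>|Q. (w \<omega> * (2 + cos (th u \<omega> + c))) *\<^sub>R iexp (s * \<omega> x))" for s
      unfolding main[OF P(1) wM(1) thM(1) cM(1)] main[OF Q(1) wM(2) thM(2) cM(2)] IH ..
  qed (use ms in measurable)
  let ?wi = "\<lambda>\<omega>. w \<omega> * indicator (A x) (\<omega> x)"
  have wiM[measurable]: "?wi \<in> borel_measurable P" "?wi \<in> borel_measurable Q"
    by (intro borel_measurable_times wM iM; measurable)+
  have wi1: "\<bar>?wi \<omega>\<bar> \<le> 1" for \<omega> using w01[of \<omega>] by (auto simp: indicator_def)
  have wc: "\<bar>?wi \<omega> * cos y\<bar> \<le> 1" for \<omega> y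
    by (subst abs_mult) (rule mult_le_one[OF wi1], auto)
  have E: "(LINT \<omega>|P. ?wi \<omega> * cos (th u \<omega> + c)) = (LINT \<omega>|Q. ?wi \<omega> * cos (th u \<omega> + c))" for u c
  proof -
    have *: "(LINT \<omega>|M. (w \<omega> * (2 + cos (th u \<omega> + c))) * indicator (A x) (\<omega> x))
        = 2 * (LINT \<omega>|M. ?wi \<omega>) + (LINT \<omega>|M. ?wi \<omega> * cos (th u \<omega> + c))"
      if M: "finite_measure M" and [measurable]: "?wi \<in> borel_measurable M" "\<And>u. th u \<in> borel_measurable M"
      for u c and M :: "('i \<Rightarrow> real) measure"
    proof -
      interpret finite_measure M by fact
      have 1: "integrable M ?wi" by (rule integrable_const_bound[where B=1]) (use wi1 in auto)
      have 2: "integrable M (\<lambda>\<omega>. ?wi \<omega> * cos (th u \<omega> + c))"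
      proof (rule integrable_const_bound[where B=1])
        show "AE \<omega> in M. norm (?wi \<omega> * cos (th u \<omega> + c)) \<le> 1"
          unfolding real_norm_def by (rule AE_I2) (rule wc)
      qed measurable
      have "(LINT \<omega>|M. (w \<omega> * (2 + cos (th u \<omega> + c))) * indicator (A x) (\<omega> x)) = (LINT \<omega>|M. 2 * ?wi \<omega> + ?wi \<omega> * cos (th u \<omega> + c))"
        by (rule Bochner_Integration.integral_cong) (auto simp: algebra_simps)
      then show ?thesis using 1 2 by simp
    qed
    \<comment> \<open>With zero frequency and zero phase the cosine weight is the constant 3, so
      \<open>D\<close> gives equality of the plain integrals of \<open>?wi\<close>. Subtracting
      twice these from \<open>D\<close> leaves the cosine part.\<close>
    have 3: "3 * (LINT \<omega>|M. ?wi \<omega>) = (LINT \<omega>|M. (w \<omega> * (2 + cos (th (\<lambda>_. 0) \<omega> + 0))) * indicator (A x) (\<omega> x))" for M :: "('i \<Rightarrow> real) measure"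
    proof -
      have "(\<lambda>\<omega>. (w \<omega> * (2 + cos (th (\<lambda>_. 0) \<omega> + 0))) * indicator (A x) (\<omega> x)) = (\<lambda>\<omega>. 3 * ?wi \<omega>)"
        unfolding th_def by (auto simp: fun_eq_iff)
      then show ?thesis by (simp only:) simp
    qed
    have "(LINT \<omega>|P. ?wi \<omega>) = (LINT \<omega>|Q. ?wi \<omega>)" using 3[of P] 3[of Q] D[of "\<lambda>_. 0" 0] by simp
    then show ?thesis using D[of u c] *[OF P(1) wiM(1) thM(1), of u c] *[OF Q(1) wiM(2) thM(2), of u c] by simp
  qed
  \<comment> \<open>The phases \<open>0\<close> and \<open>-pi/2\<close> recover the real and the
    imaginary part of the exponential.\<close>
  have F: "(CLINT \<omega>|M. ?wi \<omega> *\<^sub>R iexp (th t \<omega>))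
     = of_real (LINT \<omega>|M. ?wi \<omega> * cos (th t \<omega> + 0)) + \<i> * of_real (LINT \<omega>|M. ?wi \<omega> * cos (th t \<omega> + (-pi/2)))"
    if M: "finite_measure M" and [measurable]: "?wi \<in> borel_measurable M" "\<And>u. th u \<in> borel_measurable M"
      for M :: "('i \<Rightarrow> real) measure"
  proof -
    interpret finite_measure M by fact
    have 2: "integrable M (\<lambda>\<omega>. ?wi \<omega> * cos (th t \<omega> + c))" for c
    proof (rule integrable_const_bound[where B=1])
      show "AE \<omega> in M. norm (?wi \<omega> * cos (th t \<omega> + c)) \<le> 1"
        unfolding real_norm_def by (rule AE_I2) (rule wc)
    qed measurable
    have "cos (y + - pi/2) = sin y" for y :: real by (simp add: cos_diff)
    then have "?wi \<omega> *\<^sub>R iexp (th t \<omega>) = of_real (?wi \<omega> * cos (th t \<omega> + 0)) + \<i> * of_real (?wi \<omega> * cos (th t \<omega> + (-pi/2)))" for \<omega>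
      by (simp only: cis_conv_exp[symmetric]) (simp add: complex_eq_iff)
    then have "(CLINT \<omega>|M. ?wi \<omega> *\<^sub>R iexp (th t \<omega>)) = (CLINT \<omega>|M. of_real (?wi \<omega> * cos (th t \<omega> + 0)) + \<i> * of_real (?wi \<omega> * cos (th t \<omega> + (-pi/2))))"
      by simp
    also have "\<dots> = (CLINT \<omega>|M. of_real (?wi \<omega> * cos (th t \<omega> + 0))) + (CLINT \<omega>|M. \<i> * of_real (?wi \<omega> * cos (th t \<omega> + (-pi/2))))"
      by (intro Bochner_Integration.integral_add integrable_mult_right integrable_of_real 2)
    also have "\<dots> = of_real (LINT \<omega>|M. ?wi \<omega> * cos (th t \<omega> + 0)) + \<i> * of_real (LINT \<omega>|M. ?wi \<omega> * cos (th t \<omega> + (-pi/2)))"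
      by (simp only: integral_mult_right_zero integral_complex_of_real)
    finally show ?thesis .
  qed
  have "(CLINT \<omega>|P. ?wi \<omega> *\<^sub>R iexp (th t \<omega>)) = (CLINT \<omega>|Q. ?wi \<omega> *\<^sub>R iexp (th t \<omega>))"
    unfolding F[OF P(1) wiM(1) thM(1)] F[OF Q(1) wiM(2) thM(2)] E ..
  then show ?case using insert.hyps by (simp add: w_def th_def mult.commute)
qed

text \<open>Boxes over finitely many coordinates determine a finite measure on the product;
  \<open>char_box_eq\<close> with no coordinate left in the exponential compares their
  measures.\<close>

lemma char_unique_PiM:
  fixes P Q :: "('i \<Rightarrow> real) measure"
  assumes P: "finite_measure P" "sets P = sets (PiM UNIV (\<lambda>_. borel))"
    and Q: "finite_measure Q" "sets Q = sets (PiM UNIV (\<lambda>_. borel))"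
    and eq: "\<And>J t. finite J \<Longrightarrow> (CLINT \<omega>|P. iexp (\<Sum>j\<in>J. t j * \<omega> j)) = (CLINT \<omega>|Q. iexp (\<Sum>j\<in>J. t j * \<omega> j))"
  shows "P = Q"
proof (rule measure_eqI_PiM_infinite[OF P(2) Q(2) _ P(1)])
  interpret P: finite_measure P by fact
  interpret Q: finite_measure Q by fact
  fix A :: "'i \<Rightarrow> real set" and J assume J: "finite J" "J \<subseteq> UNIV" and A: "\<And>i. i \<in> J \<Longrightarrow> A i \<in> sets borel"
  define B where "B j = (if j \<in> J then A j else {})" for j
  have B: "B j \<in> sets borel" for j unfolding B_def using A by auto
  let ?X = "prod_emb UNIV (\<lambda>_. borel) J (Pi\<^sub>E J A)"
  have X: "?X = {\<omega>. \<forall>j\<in>J. \<omega> j \<in> A j}"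
    by (auto simp: prod_emb_def PiE_def Pi_def extensional_def restrict_def)
  have meas: "?X \<in> sets (PiM UNIV (\<lambda>_. borel))"
    by (rule sets_PiM_I) (use J A in auto)
  have *: "of_real (measure M ?X) = (CLINT \<omega>|M. (\<Prod>j\<in>J. indicator (B j) (\<omega> j)) *\<^sub>R iexp (\<Sum>k\<in>{}. 0 * \<omega> k))"
     if "finite_measure M" "sets M = sets (PiM UNIV (\<lambda>_. borel))" for M :: "('i \<Rightarrow> real) measure"
  proof -
    interpret finite_measure M by fact
    have "of_real (measure M ?X) = (CLINT \<omega>|M. of_real (indicator ?X \<omega>))"
      using meas that by (subst integral_complex_of_real) simp
    also have "\<dots> = (CLINT \<omega>|M. (\<Prod>j\<in>J. indicator (B j) (\<omega> j)) *\<^sub>R iexp (\<Sum>k\<in>{}. 0 * \<omega> k))"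
    proof (rule Bochner_Integration.integral_cong[OF refl])
      fix \<omega>
      have "(\<Prod>j\<in>J. indicator (B j) (\<omega> j) :: real) = indicator ?X \<omega>"
        unfolding X using J by (cases "\<forall>j\<in>J. \<omega> j \<in> A j") (auto simp: B_def indicator_def)
      then show "of_real (indicator ?X \<omega>) = (\<Prod>j\<in>J. indicator (B j) (\<omega> j)) *\<^sub>R iexp (\<Sum>k\<in>{}. 0 * \<omega> k)"
        by (simp add: scaleR_conv_of_real)
    qed
    finally show ?thesis .
  qed
  have "complex_of_real (measure P ?X) = complex_of_real (measure Q ?X)"
    unfolding *[OF P] *[OF Q] by (rule char_box_eq[OF P Q eq B]) (use J in auto)
  then show "emeasure P ?X = emeasure Q ?X"
    by (simp add: P.emeasure_eq_measure Q.emeasure_eq_measure)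
qed

section \<open>Gaussian families\<close>

abbreviation iid_normal :: "('i \<Rightarrow> real) measure" where
  "iid_normal \<equiv> PiM UNIV (\<lambda>_. std_normal_distribution)"

interpretation std_normal: real_distribution std_normal_distribution
  by (rule real_dist_normal_dist)

lemma prob_space_iid_normal: "prob_space iid_normal"
  by (intro prob_space_PiM std_normal.prob_space_axioms)

lemma sets_iid_normal: "sets iid_normal = sets (PiM UNIV (\<lambda>_. borel))"
  by (intro sets_PiM_cong) auto

lemma space_iid_normal[simp]: "space iid_normal = UNIV"
  by (simp add: space_PiM)

lemma measurable_iid_normal_component[measurable]: "(\<lambda>\<omega>. \<omega> i) \<in> borel_measurable iid_normal"
  by (subst measurable_cong_sets[OF sets_iid_normal refl]) simp

text \<open>The definition through characteristic functions admits degenerate covariances, in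
  particular families indexed by all matrix positions whose entries outside the range
  vanish.\<close>

definition gaussian_family :: "'a measure \<Rightarrow> ('i \<Rightarrow> 'a \<Rightarrow> real) \<Rightarrow> ('i \<Rightarrow> 'i \<Rightarrow> real) \<Rightarrow> bool" where
  "gaussian_family M X C \<longleftrightarrow> prob_space M \<and> (\<forall>a. X a \<in> borel_measurable M) \<and>
     (\<forall>J t. finite J \<longrightarrow> (CLINT \<omega>|M. iexp (\<Sum>a\<in>J. t a * X a \<omega>))
        = complex_of_real (exp (- (\<Sum>a\<in>J. \<Sum>b\<in>J. t a * t b * C a b) / 2)))"

lemma gaussian_familyD:
  assumes "gaussian_family M X C"
  shows "prob_space M" "X a \<in> borel_measurable M"
    "finite J \<Longrightarrow> (CLINT \<omega>|M. iexp (\<Sum>a\<in>J. t a * X a \<omega>))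
        = complex_of_real (exp (- (\<Sum>a\<in>J. \<Sum>b\<in>J. t a * t b * C a b) / 2))"
  using assms unfolding gaussian_family_def by auto

text \<open>The joint characteristic functions depend on the covariance only, so the law does. To
  move an expectation from one model of a Gaussian object to another it therefore suffices to
  compute two covariances.\<close>

lemma gaussian_family_distr:
  assumes "gaussian_family M X C" "gaussian_family M' Y C"
  shows "distr M (PiM UNIV (\<lambda>_. borel)) (\<lambda>\<omega> a. X a \<omega>) = distr M' (PiM UNIV (\<lambda>_. borel)) (\<lambda>\<omega> a. Y a \<omega>)"
proof (rule char_unique_PiM)
  interpret M: prob_space M using gaussian_familyD(1)[OF assms(1)] .
  interpret M': prob_space M' using gaussian_familyD(1)[OF assms(2)] .
  note [measurable] = gaussian_familyD(2)[OF assms(1)] gaussian_familyD(2)[OF assms(2)]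
  have X[measurable]: "(\<lambda>\<omega> a. X a \<omega>) \<in> measurable M (PiM UNIV (\<lambda>_. borel))"
    by (rule measurable_PiM_single') auto
  have Y[measurable]: "(\<lambda>\<omega> a. Y a \<omega>) \<in> measurable M' (PiM UNIV (\<lambda>_. borel))"
    by (rule measurable_PiM_single') auto
  interpret A: prob_space "distr M (PiM UNIV (\<lambda>_. borel)) (\<lambda>\<omega> a. X a \<omega>)" by (rule M.prob_space_distr) fact
  interpret B: prob_space "distr M' (PiM UNIV (\<lambda>_. borel)) (\<lambda>\<omega> a. Y a \<omega>)" by (rule M'.prob_space_distr) fact
  show "finite_measure (distr M (PiM UNIV (\<lambda>_. borel)) (\<lambda>\<omega> a. X a \<omega>))"
       "finite_measure (distr M' (PiM UNIV (\<lambda>_. borel)) (\<lambda>\<omega> a. Y a \<omega>))" by unfold_locales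
  fix J :: "'b set" and t assume J: "finite J"
  have "(CLINT \<omega>|distr M (PiM UNIV (\<lambda>_. borel)) (\<lambda>\<omega> a. X a \<omega>). iexp (\<Sum>j\<in>J. t j * \<omega> j)) = (CLINT \<omega>|M. iexp (\<Sum>j\<in>J. t j * X j \<omega>))"
    by (rule integral_distr) auto
  moreover have "(CLINT \<omega>|distr M' (PiM UNIV (\<lambda>_. borel)) (\<lambda>\<omega> a. Y a \<omega>). iexp (\<Sum>j\<in>J. t j * \<omega> j)) = (CLINT \<omega>|M'. iexp (\<Sum>j\<in>J. t j * Y j \<omega>))"
    by (rule integral_distr) auto
  ultimately show "(CLINT \<omega>|distr M (PiM UNIV (\<lambda>_. borel)) (\<lambda>\<omega> a. X a \<omega>). iexp (\<Sum>j\<in>J. t j * \<omega> j))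
      = (CLINT \<omega>|distr M' (PiM UNIV (\<lambda>_. borel)) (\<lambda>\<omega> a. Y a \<omega>). iexp (\<Sum>j\<in>J. t j * \<omega> j))"
    unfolding gaussian_familyD(3)[OF assms(1) J] gaussian_familyD(3)[OF assms(2) J] by simp
qed auto

lemma measurable_gaussian_family:
  assumes "gaussian_family M X C"
  shows "(\<lambda>\<omega> a. X a \<omega>) \<in> measurable M (PiM UNIV (\<lambda>_. borel))"
  by (rule measurable_PiM_single') (use gaussian_familyD(2)[OF assms] in auto)

lemma gaussian_family_integral:
  fixes F :: "('i \<Rightarrow> real) \<Rightarrow> real"
  assumes X: "gaussian_family M X C" and Y: "gaussian_family M' Y C"
    and F: "F \<in> borel_measurable (PiM UNIV (\<lambda>_. borel))"
  shows "(LINT \<omega>|M. F (\<lambda>a. X a \<omega>)) = (LINT \<omega>|M'. F (\<lambda>a. Y a \<omega>))"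
    and "integrable M (\<lambda>\<omega>. F (\<lambda>a. X a \<omega>)) \<longleftrightarrow> integrable M' (\<lambda>\<omega>. F (\<lambda>a. Y a \<omega>))"
  using integral_distr[OF measurable_gaussian_family[OF X] F] integral_distr[OF measurable_gaussian_family[OF Y] F]
    integrable_distr_eq[OF measurable_gaussian_family[OF X] F] integrable_distr_eq[OF measurable_gaussian_family[OF Y] F]
    gaussian_family_distr[OF X Y] by auto

lemma gaussian_family_nn_integral:
  assumes X: "gaussian_family M X C" and Y: "gaussian_family M' Y C"
    and F: "F \<in> borel_measurable (PiM UNIV (\<lambda>_. borel))"
  shows "(\<integral>\<^sup>+\<omega>. F (\<lambda>a. X a \<omega>) \<partial>M) = (\<integral>\<^sup>+\<omega>. F (\<lambda>a. Y a \<omega>) \<partial>M')"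
  using nn_integral_distr[OF measurable_gaussian_family[OF X], of F] nn_integral_distr[OF measurable_gaussian_family[OF Y], of F]
    gaussian_family_distr[OF X Y] F by simp

lemma gaussian_family_linear:
  assumes X: "gaussian_family M X C" and I: "\<And>a. finite (I a)"
  shows "gaussian_family M (\<lambda>a \<omega>. \<Sum>i\<in>I a. A a i * X i \<omega>)
     (\<lambda>a b. \<Sum>i\<in>I a. \<Sum>j\<in>I b. A a i * A b j * C i j)"
  unfolding gaussian_family_def
proof (intro conjI allI impI)
  show "prob_space M" using gaussian_familyD(1)[OF X] .
  note [measurable] = gaussian_familyD(2)[OF X]
  show "(\<lambda>\<omega>. \<Sum>i\<in>I a. A a i * X i \<omega>) \<in> borel_measurable M" for a by measurable
  fix J :: "'c set" and t assume J: "finite J"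
  define K where "K = (\<Union>a\<in>J. I a)"
  have K: "finite K" using J I by (auto simp: K_def)
  define B where "B a i = (if i \<in> I a then A a i else 0)" for a i
  define u where "u i = (\<Sum>a\<in>J. t a * B a i)" for i
  have s: "(\<Sum>i\<in>I a. A a i * f i) = (\<Sum>i\<in>K. B a i * f i)" if "a \<in> J" for a and f :: "'b \<Rightarrow> real"
    unfolding B_def by (rule sum.mono_neutral_cong_left) (use that K in \<open>auto simp: K_def\<close>)
  have 1: "(\<Sum>a\<in>J. t a * (\<Sum>i\<in>I a. A a i * X i \<omega>)) = (\<Sum>i\<in>K. u i * X i \<omega>)" for \<omega>
  proof -
    have "(\<Sum>a\<in>J. t a * (\<Sum>i\<in>I a. A a i * X i \<omega>)) = (\<Sum>a\<in>J. \<Sum>i\<in>K. t a * B a i * X i \<omega>)"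
      by (intro sum.cong refl) (simp add: s sum_distrib_left mult.assoc)
    also have "\<dots> = (\<Sum>i\<in>K. u i * X i \<omega>)" by (subst sum.swap) (simp add: u_def sum_distrib_right)
    finally show ?thesis .
  qed
  have 2: "(\<Sum>a\<in>J. \<Sum>b\<in>J. t a * t b * (\<Sum>i\<in>I a. \<Sum>j\<in>I b. A a i * A b j * C i j)) = (\<Sum>i\<in>K. \<Sum>j\<in>K. u i * u j * C i j)"
  proof -
    have "(\<Sum>i\<in>I a. \<Sum>j\<in>I b. A a i * A b j * C i j) = (\<Sum>i\<in>K. \<Sum>j\<in>K. B a i * B b j * C i j)" if "a \<in> J" "b \<in> J" for a b
    proof -
      have "(\<Sum>i\<in>I a. \<Sum>j\<in>I b. A a i * A b j * C i j) = (\<Sum>i\<in>I a. A a i * (\<Sum>j\<in>I b. A b j * C i j))"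
        by (simp add: sum_distrib_left mult.assoc)
      also have "\<dots> = (\<Sum>i\<in>K. B a i * (\<Sum>j\<in>K. B b j * C i j))"
        unfolding s[OF that(1)] s[OF that(2)] ..
      also have "\<dots> = (\<Sum>i\<in>K. \<Sum>j\<in>K. B a i * B b j * C i j)"
        by (simp add: sum_distrib_left mult.assoc)
      finally show ?thesis .
    qed
    then have "(\<Sum>a\<in>J. \<Sum>b\<in>J. t a * t b * (\<Sum>i\<in>I a. \<Sum>j\<in>I b. A a i * A b j * C i j))
       = (\<Sum>a\<in>J. \<Sum>b\<in>J. \<Sum>i\<in>K. \<Sum>j\<in>K. t a * t b * (B a i * B b j * C i j))"
      by (simp add: sum_distrib_left)
    also have "\<dots> = (\<Sum>i\<in>K. \<Sum>j\<in>K. \<Sum>a\<in>J. \<Sum>b\<in>J. t a * t b * (B a i * B b j * C i j))"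
      by (simp only: sum.swap[of _ K J])
    also have "\<dots> = (\<Sum>i\<in>K. \<Sum>j\<in>K. u i * u j * C i j)"
      unfolding u_def sum_product sum_distrib_right by (intro sum.cong refl) (simp add: sum_distrib_left mult_ac)
    finally show ?thesis .
  qed
  show "(CLINT \<omega>|M. iexp (\<Sum>a\<in>J. t a * (\<Sum>i\<in>I a. A a i * X i \<omega>))) =
     complex_of_real (exp (- (\<Sum>a\<in>J. \<Sum>b\<in>J. t a * t b * (\<Sum>i\<in>I a. \<Sum>j\<in>I b. A a i * A b j * C i j)) / 2))"
    unfolding 1 2 by (rule gaussian_familyD(3)[OF X K])
qed

text \<open>The product measure makes the summands independent; the characteristic function
  factorises and the exponents add.\<close>

lemma gaussian_family_add:
  assumes X: "gaussian_family M1 X C" and Y: "gaussian_family M2 Y D"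
  shows "gaussian_family (M1 \<Otimes>\<^sub>M M2) (\<lambda>a \<omega>. X a (fst \<omega>) + Y a (snd \<omega>)) (\<lambda>a b. C a b + D a b)"
  unfolding gaussian_family_def
proof (intro conjI allI impI)
  interpret M1: prob_space M1 using gaussian_familyD(1)[OF X] .
  interpret M2: prob_space M2 using gaussian_familyD(1)[OF Y] .
  interpret P: pair_prob_space M1 M2 ..
  show "prob_space (M1 \<Otimes>\<^sub>M M2)" by (rule P.prob_space_axioms)
  note [measurable] = gaussian_familyD(2)[OF X] gaussian_familyD(2)[OF Y]
  show "(\<lambda>\<omega>. X a (fst \<omega>) + Y a (snd \<omega>)) \<in> borel_measurable (M1 \<Otimes>\<^sub>M M2)" for a by measurable
  fix J :: "'b set" and t assume J: "finite J"
  define U where "U \<omega> = (\<Sum>a\<in>J. t a * X a \<omega>)" for \<omega>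
  define V where "V \<omega> = (\<Sum>a\<in>J. t a * Y a \<omega>)" for \<omega>
  have [measurable]: "U \<in> borel_measurable M1" "V \<in> borel_measurable M2" unfolding U_def V_def by measurable
  have "(CLINT \<omega>|M1 \<Otimes>\<^sub>M M2. iexp (\<Sum>a\<in>J. t a * (X a (fst \<omega>) + Y a (snd \<omega>)))) = (CLINT \<omega>|M1 \<Otimes>\<^sub>M M2. iexp (U (fst \<omega>)) * iexp (V (snd \<omega>)))"
    by (intro Bochner_Integration.integral_cong refl)
       (simp add: U_def V_def exp_add[symmetric] algebra_simps sum.distrib)
  also have "\<dots> = (CLINT x|M1. CLINT y|M2. iexp (U x) * iexp (V y))"
  proof (subst P.integral_fst'[symmetric])
    show "integrable (M1 \<Otimes>\<^sub>M M2) (\<lambda>\<omega>. iexp (U (fst \<omega>)) * iexp (V (snd \<omega>)))"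
      by (rule P.integrable_const_bound[where B=1]) (auto simp: norm_mult)
  qed simp
  also have "\<dots> = (CLINT x|M1. iexp (U x)) * (CLINT y|M2. iexp (V y))" by simp
  also have "\<dots> = complex_of_real (exp (- (\<Sum>a\<in>J. \<Sum>b\<in>J. t a * t b * (C a b + D a b)) / 2))"
    unfolding U_def V_def gaussian_familyD(3)[OF X J] gaussian_familyD(3)[OF Y J]
    by (simp add: exp_add[symmetric] sum.distrib algebra_simps diff_divide_distrib add_divide_distrib flip: of_real_mult)
  finally show "(CLINT \<omega>|M1 \<Otimes>\<^sub>M M2. iexp (\<Sum>a\<in>J. t a * (X a (fst \<omega>) + Y a (snd \<omega>)))) =
     complex_of_real (exp (- (\<Sum>a\<in>J. \<Sum>b\<in>J. t a * t b * (C a b + D a b)) / 2))" .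
qed

lemma std_normal_iexp: "(CLINT x|std_normal_distribution. iexp (t * x)) = complex_of_real (exp (- t\<^sup>2 / 2))"
  using fun_cong[OF char_std_normal_distribution, of t] unfolding char_def by simp

text \<open>One normal variable drives all members, whence the rank one covariance. Sums of such
  pieces realise the small explicit covariances needed below.\<close>

lemma gaussian_family_std_normal:
  "gaussian_family std_normal_distribution (\<lambda>a x. c a * x) (\<lambda>a b. c a * c b)"
  unfolding gaussian_family_def
proof (intro conjI allI impI)
  show "prob_space std_normal_distribution" by (rule std_normal.prob_space_axioms)
  show "(*) (c a) \<in> borel_measurable std_normal_distribution" for a by simp
  fix J :: "'a set" and t assume J: "finite J"
  have "(\<Sum>a\<in>J. t a * (c a * x)) = (\<Sum>a\<in>J. t a * c a) * x" for x by (simp add: sum_distrib_right mult.assoc)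
  moreover have "(\<Sum>a\<in>J. \<Sum>b\<in>J. t a * t b * (c a * c b)) = (\<Sum>a\<in>J. t a * c a)\<^sup>2"
    by (simp add: power2_eq_square sum_product mult_ac)
  ultimately show "(CLINT x|std_normal_distribution. iexp (\<Sum>a\<in>J. t a * (c a * x)))
    = complex_of_real (exp (- (\<Sum>a\<in>J. \<Sum>b\<in>J. t a * t b * (c a * c b)) / 2))"
    by (simp only: std_normal_iexp)
qed

lemma gaussian_family_cong:
  assumes "gaussian_family M X C" "\<And>a \<omega>. \<omega> \<in> space M \<Longrightarrow> X a \<omega> = Y a \<omega>" "\<And>a b. C a b = D a b"
  shows "gaussian_family M Y D"
proof -
  have "C = D" using assms(3) by (simp add: fun_eq_iff)
  moreover have "(CLINT \<omega>|M. iexp (\<Sum>a\<in>J. t a * X a \<omega>)) = (CLINT \<omega>|M. iexp (\<Sum>a\<in>J. t a * Y a \<omega>))" for J t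
    by (rule Bochner_Integration.integral_cong) (auto simp: assms(2))
  moreover have "X a \<in> borel_measurable M \<longleftrightarrow> Y a \<in> borel_measurable M" for a
    by (rule measurable_cong) (rule assms(2))
  ultimately show ?thesis using assms(1) unfolding gaussian_family_def by simp
qed

text \<open>The constraints of a box split into those on coordinates in \<open>A\<close> and those
  outside, and the product formula multiplies the two parts together again. With a row of the array
  as \<open>A\<close>, this replaces conditioning on the other rows.\<close>

lemma distr_resample:
  "distr (iid_normal \<Otimes>\<^sub>M iid_normal) iid_normal (\<lambda>(\<eta>, \<zeta>) x. if x \<in> A then \<eta> x else \<zeta> x) = (iid_normal :: ('i \<Rightarrow> real) measure)"
proof (rule measure_eqI_PiM_infinite[symmetric, OF refl])
  interpret Z: prob_space "iid_normal :: ('i \<Rightarrow> real) measure" by (rule prob_space_iid_normal)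
  interpret PZ: product_prob_space "\<lambda>_. std_normal_distribution" "UNIV :: 'i set" ..
  interpret ZZ: pair_prob_space "iid_normal :: ('i \<Rightarrow> real) measure" "iid_normal :: ('i \<Rightarrow> real) measure" ..
  show "finite_measure (iid_normal :: ('i \<Rightarrow> real) measure)" by unfold_locales
  let ?f = "\<lambda>(\<eta>, \<zeta>) x. if x \<in> A then \<eta> x else \<zeta> x"
  have c[measurable]: "(\<lambda>\<omega>::'i \<Rightarrow> real. \<omega> i) \<in> measurable iid_normal std_normal_distribution" for i
    by (rule measurable_component_singleton) simp
  have f: "?f \<in> measurable (iid_normal \<Otimes>\<^sub>M iid_normal) iid_normal"
  proof (rule measurable_PiM_single')
    show "(\<lambda>\<omega>. (case \<omega> of (\<eta>, \<zeta>) \<Rightarrow> \<lambda>x. if x \<in> A then \<eta> x else \<zeta> x) i) \<in> (iid_normal \<Otimes>\<^sub>M iid_normal) \<rightarrow>\<^sub>M std_normal_distribution" for i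
      unfolding case_prod_beta by (cases "i \<in> A") simp_all
  qed simp
  fix B and J :: "'i set" assume J: "finite J" "J \<subseteq> UNIV" and B: "\<And>i. i \<in> J \<Longrightarrow> B i \<in> sets std_normal_distribution"
  let ?X = "prod_emb UNIV (\<lambda>_. std_normal_distribution) J (Pi\<^sub>E J B)"
  let ?Y = "\<lambda>K. prod_emb UNIV (\<lambda>_. std_normal_distribution) K (Pi\<^sub>E K B)"
  have X: "?Y K = {\<omega>. \<forall>j\<in>K. \<omega> j \<in> B j}" for K :: "'i set"
    by (auto simp: prod_emb_def PiE_def Pi_def extensional_def restrict_def)
  have Ys: "?Y K \<in> sets iid_normal" if "K \<subseteq> J" for K
    by (rule sets_PiM_I) (use that J B finite_subset in auto)
  have "emeasure (distr (iid_normal \<Otimes>\<^sub>M iid_normal) iid_normal ?f) ?X = emeasure (iid_normal \<Otimes>\<^sub>M iid_normal) (?f -` ?X \<inter> space (iid_normal \<Otimes>\<^sub>M iid_normal))"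
    by (rule emeasure_distr[OF f]) (rule Ys, simp)
  also have "?f -` ?X \<inter> space (iid_normal \<Otimes>\<^sub>M iid_normal) = ?Y (J \<inter> A) \<times> ?Y (J - A)"
    unfolding X by (auto simp: space_pair_measure split: if_splits)
  also have "emeasure (iid_normal \<Otimes>\<^sub>M iid_normal) \<dots> = emeasure iid_normal (?Y (J \<inter> A)) * emeasure iid_normal (?Y (J - A))"
    by (rule Z.emeasure_pair_measure_Times) (rule Ys, auto)+
  also have "\<dots> = (\<Prod>i\<in>J \<inter> A. emeasure std_normal_distribution (B i)) * (\<Prod>i\<in>J - A. emeasure std_normal_distribution (B i))"
    using J B by (subst (1 2) PZ.emeasure_PiM_emb) auto
  also have "\<dots> = (\<Prod>i\<in>J. emeasure std_normal_distribution (B i))"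
    using J by (simp add: prod.Int_Diff[symmetric])
  also have "\<dots> = emeasure iid_normal ?X" using J B by (subst PZ.emeasure_PiM_emb) auto
  finally show "emeasure iid_normal ?X = emeasure (distr (iid_normal \<Otimes>\<^sub>M iid_normal) iid_normal ?f) ?X" ..
qed simp

lemma gaussian_family_iid_normal:
  "gaussian_family iid_normal (\<lambda>i \<omega>. \<omega> i) (\<lambda>i j. if i = j then 1 else 0)"
  unfolding gaussian_family_def
proof (intro conjI allI impI)
  interpret Z: prob_space "iid_normal :: ('i \<Rightarrow> real) measure" by (rule prob_space_iid_normal)
  show "prob_space (iid_normal :: ('i \<Rightarrow> real) measure)" by (rule prob_space_iid_normal)
  show "(\<lambda>\<omega>. \<omega> i) \<in> borel_measurable iid_normal" for i :: 'i by (rule measurable_iid_normal_component)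
  fix J :: "'i set" and t assume J: "finite J"
  interpret PZ: product_prob_space "\<lambda>_. std_normal_distribution" "UNIV :: 'i set" ..
  have "(CLINT \<omega>|iid_normal. iexp (\<Sum>a\<in>J. t a * \<omega> a)) = (CLINT \<omega>|distr iid_normal (PiM J (\<lambda>_. std_normal_distribution)) (\<lambda>\<omega>. restrict \<omega> J). iexp (\<Sum>a\<in>J. t a * \<omega> a))"
  proof (subst integral_distr)
    have "(\<lambda>\<omega>. \<omega> a) \<in> borel_measurable (PiM J (\<lambda>_. std_normal_distribution))" if "a \<in> J" for a
      using measurable_component_singleton[OF that, of "\<lambda>_. std_normal_distribution"] by simp
    then have [measurable]: "(\<lambda>\<omega>. \<Sum>a\<in>J. t a * \<omega> a) \<in> borel_measurable (PiM J (\<lambda>_. std_normal_distribution))"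
      by (intro borel_measurable_sum borel_measurable_times borel_measurable_const)
    show "(\<lambda>\<omega>. iexp (\<Sum>a\<in>J. t a * \<omega> a)) \<in> borel_measurable (PiM J (\<lambda>_. std_normal_distribution))"
      by measurable
  qed (auto intro!: measurable_restrict_subset)
  also have "distr iid_normal (PiM J (\<lambda>_. std_normal_distribution)) (\<lambda>\<omega>. restrict \<omega> J) = PiM J (\<lambda>_. std_normal_distribution)"
    by (rule PZ.distr_PiM_restrict_finite) (use J in auto)
  also have "(CLINT \<omega>|PiM J (\<lambda>_. std_normal_distribution). iexp (\<Sum>a\<in>J. t a * \<omega> a)) = (CLINT \<omega>|PiM J (\<lambda>_. std_normal_distribution). (\<Prod>a\<in>J. iexp (t a * \<omega> a)))"
    using J by (simp add: exp_sum sum_distrib_left)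
  also have "\<dots> = (\<Prod>a\<in>J. CLINT x|std_normal_distribution. iexp (t a * x))"
    by (rule PZ.product_integral_prod[OF J]) (rule std_normal.integrable_iexp, simp_all)
  also have "\<dots> = complex_of_real (exp (- (\<Sum>a\<in>J. (t a)\<^sup>2) / 2))"
    unfolding std_normal_iexp using J by (simp add: exp_sum sum_negf[symmetric] sum_divide_distrib)
  also have "(\<Sum>a\<in>J. (t a)\<^sup>2) = (\<Sum>a\<in>J. \<Sum>b\<in>J. t a * t b * (if a = b then 1 else 0))"
    using J by (auto simp: power2_eq_square if_distrib cong: if_cong intro!: sum.cong)
  finally show "(CLINT \<omega>|iid_normal. iexp (\<Sum>a\<in>J. t a * \<omega> a))
     = complex_of_real (exp (- (\<Sum>a\<in>J. \<Sum>b\<in>J. t a * t b * (if a = b then 1 else 0)) / 2))" .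
qed

section \<open>Convergence in probability\<close>

lemma gaussian_family_reindex:
  assumes "gaussian_family M X C"
  shows "gaussian_family M (\<lambda>a. X (h a)) (\<lambda>a b. C (h a) (h b))"
  using gaussian_family_linear[OF assms, of "\<lambda>a. {h a}" "\<lambda>_ _. 1"] by simp

text \<open>Limits along this filter are limits in probability.\<close>

definition prob_filter :: "'a measure \<Rightarrow> (nat \<times> 'a) filter" where
  "prob_filter P = Abs_filter (\<lambda>Q. \<exists>E. (\<forall>N. E N \<in> sets P) \<and> (\<forall>N. \<forall>\<omega>\<in>space P - E N. Q (N, \<omega>)) \<and> (\<lambda>N. measure P (E N)) \<longlonglongrightarrow> 0)"

context prob_space
begin

text \<open>The exceptional sets are measurable supersets of the failure sets, so \<open>Q\<close>
  itself may be non-measurable; the operator norm bound, which quantifies over all vectors, can thus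
  be used as an eventual property. Closure under conjunction is the union bound.\<close>

lemma eventually_prob_filter:
  "eventually Q (prob_filter M) \<longleftrightarrow>
    (\<exists>E. (\<forall>N. E N \<in> events) \<and> (\<forall>N. \<forall>\<omega>\<in>space M - E N. Q (N, \<omega>)) \<and> (\<lambda>N. prob (E N)) \<longlonglongrightarrow> 0)"
  unfolding prob_filter_def
proof (rule eventually_Abs_filter, rule is_filter.intro)
  fix P Q :: "nat \<times> 'a \<Rightarrow> bool"
  assume P: "\<exists>E. (\<forall>N. E N \<in> events) \<and> (\<forall>N. \<forall>\<omega>\<in>space M - E N. P (N, \<omega>)) \<and> (\<lambda>N. prob (E N)) \<longlonglongrightarrow> 0" and Q: "\<exists>E. (\<forall>N. E N \<in> events) \<and> (\<forall>N. \<forall>\<omega>\<in>space M - E N. Q (N, \<omega>)) \<and> (\<lambda>N. prob (E N)) \<longlonglongrightarrow> 0"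
  from P obtain A where A: "\<forall>N. A N \<in> events" "\<forall>N. \<forall>\<omega>\<in>space M - A N. P (N, \<omega>)" "(\<lambda>N. prob (A N)) \<longlonglongrightarrow> 0" by blast
  from Q obtain B where B: "\<forall>N. B N \<in> events" "\<forall>N. \<forall>\<omega>\<in>space M - B N. Q (N, \<omega>)" "(\<lambda>N. prob (B N)) \<longlonglongrightarrow> 0" by blast
  have "(\<lambda>N. prob (A N \<union> B N)) \<longlonglongrightarrow> 0"
  proof (rule tendsto_sandwich[OF _ _ tendsto_const])
    show "(\<lambda>N. prob (A N) + prob (B N)) \<longlonglongrightarrow> 0" using tendsto_add[OF A(3) B(3)] by simp
    show "\<forall>\<^sub>F N in sequentially. prob (A N \<union> B N) \<le> prob (A N) + prob (B N)"
      using A(1) B(1) by (auto intro!: always_eventually measure_Un_le)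
  qed auto
  then show "\<exists>E. (\<forall>N. E N \<in> events) \<and> (\<forall>N. \<forall>\<omega>\<in>space M - E N. P (N, \<omega>) \<and> Q (N, \<omega>)) \<and> (\<lambda>N. prob (E N)) \<longlonglongrightarrow> 0"
    using A(1,2) B(1,2) by (intro exI[of _ "\<lambda>N. A N \<union> B N"]) auto
next
  fix P Q :: "nat \<times> 'a \<Rightarrow> bool"
  assume PQ: "\<forall>x. P x \<longrightarrow> Q x" and P: "\<exists>E. (\<forall>N. E N \<in> events) \<and> (\<forall>N. \<forall>\<omega>\<in>space M - E N. P (N, \<omega>)) \<and> (\<lambda>N. prob (E N)) \<longlonglongrightarrow> 0"
  from P obtain A where A: "\<forall>N. A N \<in> events" "\<forall>N. \<forall>\<omega>\<in>space M - A N. P (N, \<omega>)" "(\<lambda>N. prob (A N)) \<longlonglongrightarrow> 0" by blast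
  then show "\<exists>E. (\<forall>N. E N \<in> events) \<and> (\<forall>N. \<forall>\<omega>\<in>space M - E N. Q (N, \<omega>)) \<and> (\<lambda>N. prob (E N)) \<longlonglongrightarrow> 0" using PQ by (intro exI[of _ A]) blast
qed (intro exI[of _ "\<lambda>_. {}"], simp)

lemma eventually_prob_filterI:
  assumes "\<And>N. E N \<in> events" "\<And>N \<omega>. \<omega> \<in> space M \<Longrightarrow> \<omega> \<notin> E N \<Longrightarrow> Q (N, \<omega>)" "(\<lambda>N. prob (E N)) \<longlonglongrightarrow> 0"
  shows "eventually Q (prob_filter M)"
  unfolding eventually_prob_filter using assms by (intro exI[of _ E]) auto

lemma filterlim_fst_prob_filter: "filterlim fst sequentially (prob_filter M)"
  unfolding filterlim_iff
proof (intro allI impI)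
  fix P assume P: "eventually P sequentially"
  show "eventually (\<lambda>x. P (fst x)) (prob_filter M)"
  proof (rule eventually_prob_filterI[where E="\<lambda>N. if P N then {} else space M"])
    show "(\<lambda>N. prob (if P N then {} else space M)) \<longlonglongrightarrow> 0"
      by (rule tendsto_eventually, rule eventually_mono[OF P]) simp
  qed (auto split: if_splits)
qed

lemma eventually_fst_prob_filter:
  "eventually P sequentially \<Longrightarrow> eventually (\<lambda>p. P (fst p)) (prob_filter M)"
  using filterlim_fst_prob_filter unfolding filterlim_iff by blast

text \<open>Chebyshev's inequality. The bound is asked for \<open>N \<ge> 1\<close> only, since
  averages over an empty index set carry no information.\<close>

lemma tendsto_prob_filter_L2:
  fixes X :: "nat \<Rightarrow> 'a \<Rightarrow> real"
  assumes X: "\<And>N. X N \<in> borel_measurable M" and i: "\<And>N. integrable M (\<lambda>\<omega>. (X N \<omega> - c)\<^sup>2)"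
    and b: "\<And>N. N \<ge> 1 \<Longrightarrow> expectation (\<lambda>\<omega>. (X N \<omega> - c)\<^sup>2) \<le> b N" "b \<longlonglongrightarrow> 0"
  shows "((\<lambda>p. X (fst p) (snd p)) \<longlongrightarrow> c) (prob_filter M)"
proof (rule tendstoI)
  fix e :: real assume e: "e > 0"
  define E where "E N = {\<omega>\<in>space M. e\<^sup>2 \<le> (X N \<omega> - c)\<^sup>2}" for N
  note [measurable] = X
  show "\<forall>\<^sub>F x in prob_filter M. dist (X (fst x) (snd x)) c < e"
  proof (rule eventually_prob_filterI[where E=E])
    show "E N \<in> events" for N unfolding E_def by measurable
    show "dist (X (fst (N, \<omega>)) (snd (N, \<omega>))) c < e" if "\<omega> \<in> space M" "\<omega> \<notin> E N" for N \<omega>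
    proof -
      have "(X N \<omega> - c)\<^sup>2 < e\<^sup>2" using that by (simp add: E_def)
      then have "\<bar>X N \<omega> - c\<bar> < \<bar>e\<bar>" using abs_le_square_iff not_le by blast
      then show ?thesis using e by (simp add: dist_real_def)
    qed
    show "(\<lambda>N. prob (E N)) \<longlonglongrightarrow> 0"
    proof (rule tendsto_sandwich[OF _ _ tendsto_const])
      show "(\<lambda>N. b N / e\<^sup>2) \<longlonglongrightarrow> 0" using tendsto_divide[OF b(2) tendsto_const[of "e\<^sup>2"]] e by simp
      show "\<forall>\<^sub>F N in sequentially. prob (E N) \<le> b N / e\<^sup>2"
        using eventually_ge_at_top[of 1]
      proof eventually_elim
        fix N :: nat assume N: "1 \<le> N"
        have "prob (E N) \<le> expectation (\<lambda>\<omega>. (X N \<omega> - c)\<^sup>2) / e\<^sup>2"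
          unfolding E_def by (rule integral_Markov_inequality_measure[OF i[of N], of "{}"]) (use e in auto)
        also have "\<dots> \<le> b N / e\<^sup>2" using b(1)[OF N] by (simp add: divide_right_mono)
        finally show "prob (E N) \<le> b N / e\<^sup>2" .
      qed
    qed auto
  qed
qed

text \<open>Off the exceptional event the error is below \<open>e / 2\<close>; on it the error is at
  most \<open>B + \<bar>c\<bar>\<close>, and the probability of the event tends to 0.\<close>

lemma bounded_convergence_in_prob:
  fixes X :: "nat \<Rightarrow> 'a \<Rightarrow> real"
  assumes X: "\<And>N. X N \<in> borel_measurable M" and B: "\<And>N \<omega>. \<omega> \<in> space M \<Longrightarrow> \<bar>X N \<omega>\<bar> \<le> B"
    and lim: "((\<lambda>p. X (fst p) (snd p)) \<longlongrightarrow> c) (prob_filter M)"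
  shows "(\<lambda>N. expectation (X N)) \<longlonglongrightarrow> c"
proof (rule tendstoI)
  fix e :: real assume e: "e > 0"
  note [measurable] = X
  have "\<forall>\<^sub>F p in prob_filter M. dist (X (fst p) (snd p)) c < e / 2" by (rule tendstoD[OF lim]) (use e in simp)
  then obtain E where E: "\<And>N. E N \<in> events" "\<And>N \<omega>. \<omega> \<in> space M - E N \<Longrightarrow> dist (X N \<omega>) c < e / 2" "(\<lambda>N. prob (E N)) \<longlonglongrightarrow> 0"
    unfolding eventually_prob_filter by auto
  note [measurable] = E(1)
  have "(\<lambda>N. e / 2 + (B + \<bar>c\<bar>) * prob (E N)) \<longlonglongrightarrow> e / 2 + (B + \<bar>c\<bar>) * 0"
    by (intro tendsto_intros E)
  then have "\<forall>\<^sub>F N in sequentially. e / 2 + (B + \<bar>c\<bar>) * prob (E N) < e"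
    by (rule order_tendstoD) (use e in simp)
  then show "\<forall>\<^sub>F N in sequentially. dist (expectation (X N)) c < e"
  proof eventually_elim
    fix N assume N: "e / 2 + (B + \<bar>c\<bar>) * prob (E N) < e"
    have iX: "integrable M (X N)" by (rule integrable_const_bound[where B=B]) (use B in auto)
    have iE: "integrable M (\<lambda>\<omega>. e / 2 + (B + \<bar>c\<bar>) * indicator (E N) \<omega>)"
      by (intro Bochner_Integration.integrable_add integrable_mult_right integrable_const) (auto simp: emeasure_eq_measure)
    have "\<bar>expectation (X N) - c\<bar> = \<bar>expectation (\<lambda>\<omega>. X N \<omega> - c)\<bar>" using iX by (simp add: prob_space)
    also have "\<dots> \<le> expectation (\<lambda>\<omega>. \<bar>X N \<omega> - c\<bar>)" by (rule integral_abs_bound)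
    also have "\<dots> \<le> expectation (\<lambda>\<omega>. e / 2 + (B + \<bar>c\<bar>) * indicator (E N) \<omega>)"
    proof (rule integral_mono[OF _ iE])
      show "integrable M (\<lambda>\<omega>. \<bar>X N \<omega> - c\<bar>)" using iX by simp
      fix \<omega> assume \<omega>: "\<omega> \<in> space M"
      show "\<bar>X N \<omega> - c\<bar> \<le> e / 2 + (B + \<bar>c\<bar>) * indicator (E N) \<omega>"
        using E(2)[of \<omega> N] B[OF \<omega>, of N] \<omega> e by (cases "\<omega> \<in> E N") (auto simp: dist_real_def)
    qed
    also have "\<dots> = e / 2 + (B + \<bar>c\<bar>) * prob (E N)"
      using E(1)[of N] by (subst Bochner_Integration.integral_add) (auto simp: prob_space emeasure_eq_measure)
    finally show "dist (expectation (X N)) c < e" using N by (simp add: dist_real_def)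
  qed
qed

end

section \<open>Fresh copies of coordinates and the law of large numbers\<close>

interpretation iid: prob_space "iid_normal :: ('i \<Rightarrow> real) measure"
  by (rule prob_space_iid_normal)

interpretation iid_pair: pair_prob_space "iid_normal :: ('i \<Rightarrow> real) measure" "iid_normal :: ('j \<Rightarrow> real) measure"
  by unfold_locales

lemma measurable_resample:
  "(\<lambda>(\<eta>, \<zeta>) x. if x \<in> A then \<eta> x else \<zeta> x) \<in> measurable (iid_normal \<Otimes>\<^sub>M iid_normal) iid_normal"
proof (rule measurable_PiM_single')
  have c[measurable]: "(\<lambda>\<omega>::'i \<Rightarrow> real. \<omega> i) \<in> measurable iid_normal std_normal_distribution" for i
    by (rule measurable_component_singleton) simp
  show "(\<lambda>\<omega>. (case \<omega> of (\<eta>, \<zeta>) \<Rightarrow> \<lambda>x. if x \<in> A then \<eta> x else \<zeta> x) i) \<in> (iid_normal \<Otimes>\<^sub>M iid_normal) \<rightarrow>\<^sub>M std_normal_distribution" for i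
    unfolding case_prod_beta by (cases "i \<in> A") simp_all
qed simp

lemma nn_integral_resample:
  assumes [measurable]: "H \<in> borel_measurable iid_normal"
  shows "(\<integral>\<^sup>+\<omega>. H \<omega> \<partial>iid_normal) = (\<integral>\<^sup>+\<zeta>. \<integral>\<^sup>+\<eta>. H (\<lambda>x. if x \<in> A then \<eta> x else \<zeta> x) \<partial>iid_normal \<partial>iid_normal)"
proof -
  note m[measurable] = measurable_resample[of A]
  have "(\<integral>\<^sup>+\<omega>. H \<omega> \<partial>iid_normal) = (\<integral>\<^sup>+p. H ((\<lambda>(\<eta>, \<zeta>) x. if x \<in> A then \<eta> x else \<zeta> x) p) \<partial>(iid_normal \<Otimes>\<^sub>M iid_normal))"
    by (subst distr_resample[of A, symmetric], subst nn_integral_distr[OF m]) auto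
  also have "\<dots> = (\<integral>\<^sup>+\<zeta>. \<integral>\<^sup>+\<eta>. H ((\<lambda>(\<eta>, \<zeta>) x. if x \<in> A then \<eta> x else \<zeta> x) (\<eta>, \<zeta>)) \<partial>iid_normal \<partial>iid_normal)"
    by (rule iid_pair.nn_integral_snd[symmetric]) measurable
  finally show ?thesis by simp
qed

text \<open>After resampling on \<open>A\<close>, the two factors depend on different components of
  a product measure, so Fubini separates them.\<close>

lemma integral_mult_disjoint_coords:
  fixes f g :: "('i \<Rightarrow> real) \<Rightarrow> real"
  assumes f: "integrable iid_normal f" and g: "integrable iid_normal g"
    and fA: "\<And>\<omega> \<omega>'. (\<And>x. x \<in> A \<Longrightarrow> \<omega> x = \<omega>' x) \<Longrightarrow> f \<omega> = f \<omega>'"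
    and gA: "\<And>\<omega> \<omega>'. (\<And>x. x \<notin> A \<Longrightarrow> \<omega> x = \<omega>' x) \<Longrightarrow> g \<omega> = g \<omega>'"
  shows "integrable iid_normal (\<lambda>\<omega>. f \<omega> * g \<omega>)"
    and "(LINT \<omega>|iid_normal. f \<omega> * g \<omega>) = (LINT \<omega>|iid_normal. f \<omega>) * (LINT \<omega>|iid_normal. g \<omega>)"
proof -
  note [measurable] = borel_measurable_integrable[OF f] borel_measurable_integrable[OF g]
  note m[measurable] = measurable_resample[of A]
  have i: "integrable (iid_normal \<Otimes>\<^sub>M iid_normal) (\<lambda>(\<eta>, \<zeta>). f \<eta> * g \<zeta>)"
  proof (rule iid_pair.Fubini_integrable)
    show "(\<lambda>(x, y). f x * g y) \<in> borel_measurable (iid_normal \<Otimes>\<^sub>M iid_normal)" by measurable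
    have "integrable iid_normal (\<lambda>x. \<bar>f x\<bar> * (LINT y|iid_normal. \<bar>g y\<bar>))" using f by simp
    then show "integrable iid_normal (\<lambda>x. LINT y|iid_normal. norm (case (x, y) of (x, y) \<Rightarrow> f x * g y))"
      by (simp add: abs_mult)
    show "AE x in iid_normal. integrable iid_normal (\<lambda>y. case (x, y) of (x, y) \<Rightarrow> f x * g y)" using g by simp
  qed
  let ?T = "\<lambda>(\<eta>, \<zeta>) x. if x \<in> A then \<eta> x else \<zeta> x"
  have T: "f (?T p) * g (?T p) = (case p of (\<eta>, \<zeta>) \<Rightarrow> f \<eta> * g \<zeta>)" for p
    using fA[of "?T p" "fst p"] gA[of "?T p" "snd p"] by (simp add: case_prod_beta)
  have fg: "(\<lambda>\<omega>. f \<omega> * g \<omega>) \<in> borel_measurable iid_normal" by measurable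
  show "integrable iid_normal (\<lambda>\<omega>. f \<omega> * g \<omega>)"
    using integrable_distr_eq[OF m fg] i unfolding distr_resample T by simp
  have "(LINT \<omega>|iid_normal. f \<omega> * g \<omega>) = (LINT p|(iid_normal \<Otimes>\<^sub>M iid_normal). (case p of (\<eta>, \<zeta>) \<Rightarrow> f \<eta> * g \<zeta>))"
    using integral_distr[OF m fg] unfolding distr_resample T .
  also have "\<dots> = (LINT x|iid_normal. LINT y|iid_normal. f x * g y)"
    using iid_pair.integral_fst[OF i] by simp
  finally show "(LINT \<omega>|iid_normal. f \<omega> * g \<omega>) = (LINT \<omega>|iid_normal. f \<omega>) * (LINT \<omega>|iid_normal. g \<omega>)" by simp
qed

lemma gaussian_family_column:
  "gaussian_family (iid_normal :: (nat \<times> nat \<Rightarrow> real) measure) (\<lambda>l \<omega>. \<omega> (l, i)) (\<lambda>a b. if a = b then 1 else 0)"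
  using gaussian_family_reindex[OF gaussian_family_iid_normal, of "\<lambda>l. (l, i)"] by simp

lemma measurable_column[measurable]:
  "(\<lambda>\<omega> l. \<omega> (l, i)) \<in> measurable (iid_normal :: (nat \<times> nat \<Rightarrow> real) measure) (PiM UNIV (\<lambda>_. borel))"
  by (rule measurable_gaussian_family[OF gaussian_family_column])

text \<open>Centered functions of different columns are orthogonal, so the average of
  \<open>N\<close> of them has variance \<open>v / N\<close>. All dimensions share one array, and
  dimension \<open>N\<close> reads its first \<open>N\<close> columns.\<close>

lemma weak_lln_columns:
  fixes F :: "(nat \<Rightarrow> real) \<Rightarrow> real"
  assumes F[measurable]: "F \<in> borel_measurable (PiM UNIV (\<lambda>_. borel))"
    and i1: "integrable iid_normal F" and i2: "integrable iid_normal (\<lambda>\<omega>. (F \<omega>)\<^sup>2)"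
  shows "((\<lambda>p. (1 / real (fst p)) * (\<Sum>i=1..fst p. F (\<lambda>l. snd p (l, i)))) \<longlongrightarrow> (LINT \<omega>|iid_normal. F \<omega>))
    (prob_filter (iid_normal :: (nat \<times> nat \<Rightarrow> real) measure))"
proof -
  let ?Z = "iid_normal :: (nat \<times> nat \<Rightarrow> real) measure"
  define c where "c = (LINT \<omega>|iid_normal. F \<omega>)"
  define X where "X i \<omega> = F (\<lambda>l. \<omega> (l, i)) - c" for i and \<omega> :: "nat \<times> nat \<Rightarrow> real"
  have X[measurable]: "X i \<in> borel_measurable ?Z" for i unfolding X_def by measurable
  note gf = gaussian_family_integral[OF gaussian_family_column gaussian_family_iid_normal]
  have I1: "integrable ?Z (X i)" "(LINT \<omega>|?Z. X i \<omega>) = 0" for i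
    using gf[OF F, of i] i1 by (simp_all add: X_def[abs_def] c_def iid.prob_space[simplified])
  have I2: "integrable ?Z (\<lambda>\<omega>. (X i \<omega>)\<^sup>2)" "(LINT \<omega>|?Z. (X i \<omega>)\<^sup>2) = (LINT \<omega>|iid_normal. (F \<omega> - c)\<^sup>2)" for i
  proof -
    have [measurable]: "(\<lambda>\<omega>. (F \<omega> - c)\<^sup>2) \<in> borel_measurable (PiM UNIV (\<lambda>_. borel))" by measurable
    have "integrable iid_normal (\<lambda>\<omega>. (F \<omega>)\<^sup>2 - 2 * c * F \<omega> + c\<^sup>2)" using i1 i2 by simp
    then have "integrable iid_normal (\<lambda>\<omega>. (F \<omega> - c)\<^sup>2)" by (simp add: power2_eq_square algebra_simps)
    then show "integrable ?Z (\<lambda>\<omega>. (X i \<omega>)\<^sup>2)" "(LINT \<omega>|?Z. (X i \<omega>)\<^sup>2) = (LINT \<omega>|iid_normal. (F \<omega> - c)\<^sup>2)"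
      using gf[of "\<lambda>\<omega>. (F \<omega> - c)\<^sup>2" i] by (simp_all add: X_def[abs_def])
  qed
  define v where "v = (LINT \<omega>|iid_normal. (F \<omega> - c)\<^sup>2)"
  have I3: "integrable ?Z (\<lambda>\<omega>. X i \<omega> * X j \<omega>)" "(LINT \<omega>|?Z. X i \<omega> * X j \<omega>) = (if i = j then v else 0)" for i j
  proof (atomize(full), cases "i = j")
    case True
    then show "integrable ?Z (\<lambda>\<omega>. X i \<omega> * X j \<omega>) \<and> (LINT \<omega>|?Z. X i \<omega> * X j \<omega>) = (if i = j then v else 0)"
      using I2[of i] by (simp add: v_def power2_eq_square)
  next
    case False
    have a: "X i \<omega> = X i \<omega>'" if "\<And>x. x \<in> {(l, i) |l. True} \<Longrightarrow> \<omega> x = \<omega>' x" for \<omega> \<omega>'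
      using that by (simp add: X_def)
    have b: "X j \<omega> = X j \<omega>'" if "\<And>x. x \<notin> {(l, i) |l. True} \<Longrightarrow> \<omega> x = \<omega>' x" for \<omega> \<omega>'
      using that False by (simp add: X_def)
    show "integrable ?Z (\<lambda>\<omega>. X i \<omega> * X j \<omega>) \<and> (LINT \<omega>|?Z. X i \<omega> * X j \<omega>) = (if i = j then v else 0)"
    proof -
      note m = integral_mult_disjoint_coords[OF I1(1)[of i] I1(1)[of j], where A="{(l, i) |l. True}"]
      have "integrable ?Z (\<lambda>\<omega>. X i \<omega> * X j \<omega>)"
        by (rule m(1); (rule a | rule b); simp)
      moreover have "(LINT \<omega>|?Z. X i \<omega> * X j \<omega>) = (LINT \<omega>|?Z. X i \<omega>) * (LINT \<omega>|?Z. X j \<omega>)"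
        by (rule m(2); (rule a | rule b); simp)
      ultimately show ?thesis using False I1(2) by simp
    qed
  qed
  define Y where "Y N \<omega> = (1 / real N) * (\<Sum>i=1..N. F (\<lambda>l. \<omega> (l, i)))" for N and \<omega> :: "nat \<times> nat \<Rightarrow> real"
  have Y: "(Y N \<omega> - c)\<^sup>2 = (1 / real N)\<^sup>2 * (\<Sum>i=1..N. \<Sum>j=1..N. X i \<omega> * X j \<omega>)" if "N \<ge> 1" for N \<omega>
  proof -
    have "Y N \<omega> - c = (1 / real N) * (\<Sum>i=1..N. X i \<omega>)"
      using that by (simp add: Y_def X_def sum_subtractf field_simps)
    then show ?thesis by (simp add: power_mult_distrib power2_eq_square sum_product)
  qed
  have "((\<lambda>p. Y (fst p) (snd p)) \<longlongrightarrow> c) (prob_filter ?Z)"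
  proof (rule iid.tendsto_prob_filter_L2)
    show "Y N \<in> borel_measurable ?Z" for N unfolding Y_def by measurable
    show "integrable ?Z (\<lambda>\<omega>. (Y N \<omega> - c)\<^sup>2)" for N
    proof (cases "N \<ge> 1")
      case True
      show ?thesis unfolding Y[OF True] by (intro integrable_mult_right Bochner_Integration.integrable_sum I3)
    next
      case False
      then show ?thesis by (simp add: Y_def)
    qed
    show "iid.expectation (\<lambda>\<omega>. (Y N \<omega> - c)\<^sup>2) \<le> v / real N" if "N \<ge> 1" for N
    proof -
      have "iid.expectation (\<lambda>\<omega>. (Y N \<omega> - c)\<^sup>2) = (1 / real N)\<^sup>2 * (\<Sum>i=1..N. \<Sum>j=1..N. (if i = j then v else 0))"
        unfolding Y[OF that] by (simp add: I3)
      also have "\<dots> = v / real N" using that by (simp add: power2_eq_square)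
      finally show ?thesis by simp
    qed
    show "(\<lambda>N. v / real N) \<longlonglongrightarrow> 0" by (rule lim_const_over_n)
  qed
  then show ?thesis unfolding Y_def c_def .
qed

section \<open>One-dimensional Gaussian inequalities\<close>

lemma integrable_std_normal_id: "integrable std_normal_distribution (\<lambda>x::real. x)"
  using integrable_std_normal_distribution_moment[of 1] by simp

lemma integral_std_normal_id: "(LINT x|std_normal_distribution. x) = 0"
  using integral_std_normal_moment_odd[of 0] by (simp add: integral_density)

text \<open>Crude, but enough to make the boundary terms of the integration by parts vanish.\<close>

lemma std_normal_density_le_inverse: "x \<noteq> 0 \<Longrightarrow> std_normal_density x \<le> 1 / \<bar>x\<bar>"
proof -
  assume x: "x \<noteq> 0"
  have "2 * 1 * \<bar>x\<bar> \<le> 1\<^sup>2 + \<bar>x\<bar>\<^sup>2" by (rule sum_squares_bound)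
  then have "\<bar>x\<bar> \<le> 1 + x\<^sup>2 / 2" by simp
  also have "\<dots> \<le> exp (x\<^sup>2 / 2)" by (rule exp_ge_add_one_self)
  finally have 1: "exp (- x\<^sup>2 / 2) \<le> 1 / \<bar>x\<bar>" using x by (simp add: exp_minus field_simps)
  have "1 \<le> sqrt (2 * pi)" using pi_gt3 by simp
  then have "std_normal_density x \<le> exp (- x\<^sup>2 / 2)"
    unfolding std_normal_density_def by (simp add: field_simps)
  with 1 show ?thesis by simp
qed

lemma DERIV_std_normal_density: "(std_normal_density has_real_derivative - x * std_normal_density x) (at x)"
  unfolding std_normal_density_def by (auto intro!: derivative_eq_intros simp: field_simps)

text \<open>The derivative of \<open>std_normal_density x * F x\<close> is the density times
  \<open>F' x - x * F x\<close>. Its integral over the line is 0, because boundedness of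
  \<open>F\<close> kills the boundary values.\<close>

lemma gaussian_integration_by_parts:
  assumes F: "\<And>x. (F has_real_derivative F' x) (at x)" and c: "\<And>x. isCont F' x"
    and B: "\<And>x. \<bar>F x\<bar> \<le> B" and B': "\<And>x. \<bar>F' x\<bar> \<le> B'"
  shows "(LINT x|std_normal_distribution. x * F x) = (LINT x|std_normal_distribution. F' x)"
    and "integrable std_normal_distribution (\<lambda>x. x * F x)" and "integrable std_normal_distribution F'"
proof -
  have cF: "isCont F x" for x using F DERIV_isCont by blast
  have [measurable]: "F \<in> borel_measurable borel" "F' \<in> borel_measurable borel"
    using cF c by (auto intro!: borel_measurable_continuous_onI continuous_at_imp_continuous_on)
  show i1: "integrable std_normal_distribution (\<lambda>x. x * F x)"
  proof (rule Bochner_Integration.integrable_bound)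
    show "integrable std_normal_distribution (\<lambda>x. B * x)" using integrable_std_normal_id by simp
    have "0 \<le> B" using B[of 0] by simp
    then show "AE x in std_normal_distribution. norm (x * F x) \<le> norm (B * x)"
      using B by (auto simp: abs_mult mult.commute[of B] intro!: mult_left_mono AE_I2)
  qed simp
  show i2: "integrable std_normal_distribution F'"
    by (rule std_normal.integrable_const_bound[where B=B']) (use B' in auto)
  define G where "G x = std_normal_density x * F x" for x
  define g where "g x = std_normal_density x * F' x - std_normal_density x * (x * F x)" for x
  have j1: "integrable lborel (\<lambda>x. std_normal_density x * (x * F x))"
    using i1 by (subst (asm) integrable_density) auto
  have j2: "integrable lborel (\<lambda>x. std_normal_density x * F' x)"
    using i2 by (subst (asm) integrable_density) auto
  have gi: "integrable lborel g" unfolding g_def using j1 j2 by simp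
  have lim: "(G \<longlongrightarrow> 0) at_infinity"
  proof (rule Lim_null_comparison)
    show "\<forall>\<^sub>F x in at_infinity. norm (G x) \<le> B * norm (inverse x)"
      unfolding eventually_at_infinity
    proof (intro exI[of _ 1] allI impI)
      fix x :: real assume "1 \<le> norm x"
      then have x: "x \<noteq> 0" by auto
      have "norm (G x) = \<bar>F x\<bar> * std_normal_density x" by (simp add: G_def abs_mult)
      also have "\<dots> \<le> B * (1 / \<bar>x\<bar>)"
        by (intro mult_mono B std_normal_density_le_inverse x) (use B[of 0] in auto)
      finally show "norm (G x) \<le> B * norm (inverse x)" by (simp add: divide_inverse)
    qed
    show "((\<lambda>x::real. B * norm (inverse x)) \<longlongrightarrow> 0) at_infinity"
      using tendsto_mult[OF tendsto_const[of B] tendsto_norm[OF tendsto_inverse_0[where 'a=real]]] by simp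
  qed
  have "(LBINT x=-\<infinity>..\<infinity>. g x) = 0 - 0"
  proof (rule interval_integral_FTC_integrable[where F=G])
    show "(G has_vector_derivative g x) (at x)" for x
      unfolding has_real_derivative_iff_has_vector_derivative[symmetric] G_def g_def
      by (auto intro!: derivative_eq_intros F DERIV_std_normal_density simp: algebra_simps)
    have cd: "isCont std_normal_density x" for x using DERIV_std_normal_density DERIV_isCont by blast
    show "isCont g x" for x unfolding g_def using cd c cF by (intro continuous_intros) auto
    show "set_integrable lborel (einterval (- \<infinity>) \<infinity>) g" using gi by (simp add: set_integrable_def)
    show "((G \<circ> real_of_ereal) \<longlongrightarrow> 0) (at_right (- \<infinity>))"
      using tendsto_mono[OF at_bot_le_at_infinity lim] by (simp add: ereal_tendsto_simps)
    show "((G \<circ> real_of_ereal) \<longlongrightarrow> 0) (at_left \<infinity>)"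
      using tendsto_mono[OF at_top_le_at_infinity lim] by (simp add: ereal_tendsto_simps)
  qed simp
  then have "(LINT x|lborel. g x) = 0" by (simp add: interval_lebesgue_integral_def set_lebesgue_integral_def)
  then have "(LINT x|lborel. std_normal_density x * F' x) = (LINT x|lborel. std_normal_density x * (x * F x))"
    unfolding g_def using j1 j2 by simp
  then show "(LINT x|std_normal_distribution. x * F x) = (LINT x|std_normal_distribution. F' x)"
    by (simp add: integral_density)
qed

lemma (in prob_space) integral_pos:
  fixes u :: "'a \<Rightarrow> real"
  assumes "integrable M u" "AE x in M. 0 < u x"
  shows "0 < expectation u"
proof -
  have nn: "AE x in M. 0 \<le> u x" using assms(2) by eventually_elim simp
  have "expectation u \<noteq> 0"
  proof
    assume "expectation u = 0"
    then have "AE x in M. u x = 0" using integral_nonneg_eq_0_iff_AE[OF assms(1) nn] by simp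
    with assms(2) have "AE x in M. False" by eventually_elim simp
    then show False by (simp add: AE_False)
  qed
  then show ?thesis using integral_nonneg_AE[OF nn] by simp
qed

lemma AE_std_normal_neq: "AE x in std_normal_distribution. x \<noteq> (y::real)"
proof -
  have "AE x in lborel. x \<noteq> y" by (rule AE_lborel_singleton)
  then show ?thesis by (subst AE_density) auto
qed

text \<open>For independent standard normals, the combination with coefficients \<open>a\<close> and
  \<open>b\<close> is a centered Gaussian of variance \<open>a^2 + b^2\<close>; the signs of the
  coefficients are free.\<close>

lemma gaussian_mixture:
  fixes F :: "real \<Rightarrow> real"
  assumes [measurable]: "F \<in> borel_measurable borel" and B: "\<And>x. \<bar>F x\<bar> \<le> B"
  shows "(LINT z|std_normal_distribution. LINT x|std_normal_distribution. F (a * z + b * x))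
     = (LINT z|std_normal_distribution. F (sqrt (a\<^sup>2 + b\<^sup>2) * z))"
proof -
  interpret P: pair_prob_space std_normal_distribution std_normal_distribution by unfold_locales
  have 1: "gaussian_family (std_normal_distribution \<Otimes>\<^sub>M std_normal_distribution) (\<lambda>_::unit. \<lambda>\<omega>. a * fst \<omega> + b * snd \<omega>) (\<lambda>_ _. a\<^sup>2 + b\<^sup>2)"
    using gaussian_family_add[OF gaussian_family_std_normal gaussian_family_std_normal, of "\<lambda>_. a" "\<lambda>_. b"]
    by (simp add: power2_eq_square)
  have "gaussian_family std_normal_distribution (\<lambda>_::unit. \<lambda>\<omega>. sqrt (a\<^sup>2 + b\<^sup>2) * \<omega>) (\<lambda>_ _. sqrt (a\<^sup>2 + b\<^sup>2) * sqrt (a\<^sup>2 + b\<^sup>2))"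
    by (rule gaussian_family_std_normal)
  then have 2: "gaussian_family std_normal_distribution (\<lambda>_::unit. \<lambda>\<omega>. sqrt (a\<^sup>2 + b\<^sup>2) * \<omega>) (\<lambda>_ _. a\<^sup>2 + b\<^sup>2)" by simp
  have "(LINT \<omega>|(std_normal_distribution \<Otimes>\<^sub>M std_normal_distribution). F (a * fst \<omega> + b * snd \<omega>)) = (LINT z|std_normal_distribution. F (sqrt (a\<^sup>2 + b\<^sup>2) * z))"
    using gaussian_family_integral(1)[OF 1 2, of "\<lambda>\<omega>. F (\<omega> ())"] by simp
  moreover have "integrable (std_normal_distribution \<Otimes>\<^sub>M std_normal_distribution) (\<lambda>\<omega>. F (a * fst \<omega> + b * snd \<omega>))"
    by (rule P.integrable_const_bound[where B=B]) (use B in auto)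
  ultimately show ?thesis using P.integral_fst'[of "\<lambda>\<omega>. F (a * fst \<omega> + b * snd \<omega>)"] by simp
qed

lemma DERIV_tanh_affine:
  "((\<lambda>x::real. tanh (A + c * x)) has_real_derivative c * (1 - (tanh (A + c * x))\<^sup>2)) (at x)"
  by (auto intro!: derivative_eq_intros)

text \<open>The function \<open>H = c (T - T\<^sup>3 / 3)\<close> is the antiderivative of \<open>(T')\<^sup>2\<close> for \<open>T = tanh (A + c x)\<close>;
  the bound is the Cauchy--Schwarz inequality for \<open>T x - T y = \<integral> T'\<close>, and is strict as \<open>T'\<close> is
  not constant on any interval.\<close>

lemma tanh_affine_cauchy_schwarz:
  fixes A c :: real
  assumes c: "c > 0" and xy: "x \<noteq> y"
  defines "T \<equiv> \<lambda>x. tanh (A + c * x)"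
  defines "H \<equiv> \<lambda>x. c * (T x - (T x)^3 / 3)"
  shows "(T x - T y)\<^sup>2 < (x - y) * (H x - H y)"
proof -
  have T': "(T has_real_derivative c * (1 - (T x)\<^sup>2)) (at x)" for x
    unfolding T_def by (rule DERIV_tanh_affine)
  have H': "(H has_real_derivative (c * (1 - (T x)\<^sup>2))\<^sup>2) (at x)" for x
    unfolding H_def by (auto intro!: derivative_eq_intros T' simp: power2_eq_square field_simps)
  have inj: "T u < T v" if "u < v" for u v
    using that c by (simp add: T_def)
  have main: "(T x - T y)\<^sup>2 < (x - y) * (H x - H y)" if xy: "y < x" for x y
  proof -
    define s where "s = (T x - T y) / (x - y)"
    \<comment> \<open>\<open>k\<close> is a primitive of the square of \<open>T' - s\<close>, where
      \<open>s\<close> is the mean slope. Monotonicity of \<open>k\<close> is Cauchy-Schwarz, and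
      equality would force \<open>T'\<close> to be the constant \<open>s\<close> in between.\<close>
    define k where "k u = H u - 2 * s * T u + s\<^sup>2 * u" for u
    have k': "(k has_real_derivative (c * (1 - (T u)\<^sup>2) - s)\<^sup>2) (at u)" for u
      unfolding k_def by (auto intro!: derivative_eq_intros T' H' simp: power2_eq_square algebra_simps)
    have mono: "k u \<le> k v" if "u \<le> v" for u v
    proof (rule DERIV_nonneg_imp_nondecreasing[OF that])
      show "\<exists>y. (k has_real_derivative y) (at w) \<and> 0 \<le> y" for w
        by (rule exI[of _ "(c * (1 - (T w)\<^sup>2) - s)\<^sup>2"]) (simp add: k')
    qed
    have "k y \<noteq> k x"
    proof
      assume eq: "k y = k x"
      have sq: "c * (1 - (T u)\<^sup>2) = s" if "y < u" "u < x" for u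
      proof -
        have "k v = k y" if "v \<in> {y<..<x}" for v
          using mono[of y v] mono[of v x] eq that by auto
        moreover have "((\<lambda>_. k y) has_real_derivative 0) (at u)" by simp
        ultimately have "(k has_real_derivative 0) (at u)"
          using that by (subst DERIV_cong_ev[OF refl _ refl, of _ "\<lambda>_. k y"])
             (auto intro!: eventually_nhds_in_open[THEN eventually_mono, of "{y<..<x}"])
        with k'[of u] have "(c * (1 - (T u)\<^sup>2) - s)\<^sup>2 = 0" by (rule DERIV_unique)
        then show ?thesis by simp
      qed
      \<comment> \<open>Three interior points: a constant slope gives \<open>T\<close> the same
        square at all of them, but an injective function takes each square at most twice.\<close>
      define u where "u j = y + (x - y) * (j / 4)" for j :: real
      have u: "y < u j \<and> u j < x" if "0 < j" "j < 4" for j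
      proof -
        have "(x - y) * (j / 4) < (x - y) * 1" using xy that by (intro mult_strict_left_mono) auto
        then show ?thesis using xy that by (auto simp: u_def)
      qed
      have "(T (u 1))\<^sup>2 = (T (u 2))\<^sup>2" "(T (u 2))\<^sup>2 = (T (u 3))\<^sup>2"
        using sq[of "u 1"] sq[of "u 2"] sq[of "u 3"] u[of 1] u[of 2] u[of 3] c by auto
      moreover have "T (u 1) < T (u 2)" "T (u 2) < T (u 3)"
        using xy by (auto intro!: inj simp: u_def)
      ultimately show False unfolding power2_eq_iff by linarith
    qed
    then have "0 < k x - k y" using mono[of y x] xy by simp
    then have "0 < (x - y) * (k x - k y)" using xy by simp
    also have "(x - y) * (k x - k y) = (x - y) * (H x - H y) - 2 * (s * (x - y)) * (T x - T y) + (s * (x - y))\<^sup>2"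
      by (simp add: k_def power2_eq_square algebra_simps)
    also have "s * (x - y) = T x - T y" using xy by (simp add: s_def)
    finally show ?thesis by (simp add: power2_eq_square algebra_simps)
  qed
  show ?thesis
  proof (cases "y < x")
    case True then show ?thesis by (rule main)
  next
    case False
    then have "(T y - T x)\<^sup>2 < (y - x) * (H y - H x)" using xy by (intro main) simp
    then show ?thesis by (simp add: power2_eq_square algebra_simps)
  qed
qed

text \<open>Averaging the previous bound over independent \<open>x\<close> and \<open>y\<close> and integrating \<open>x H x\<close> by parts gives the
  Gaussian Poincare inequality with its sharp constant.\<close>

lemma tanh_affine_variance:
  fixes A c :: real
  assumes c: "c > 0"
  defines "T \<equiv> \<lambda>x. tanh (A + c * x)"
  shows "(LINT x|std_normal_distribution. (T x)\<^sup>2) - (LINT x|std_normal_distribution. T x)\<^sup>2 > 0"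
    and "(LINT x|std_normal_distribution. (T x)\<^sup>2) - (LINT x|std_normal_distribution. T x)\<^sup>2
       < (LINT x|std_normal_distribution. (c * (1 - (T x)\<^sup>2))\<^sup>2)"
proof -
  let ?G = "std_normal_distribution"
  have T': "(T has_real_derivative c * (1 - (T x)\<^sup>2)) (at x)" for x
    unfolding T_def by (rule DERIV_tanh_affine)
  have contT: "isCont T x" for x using T' DERIV_isCont by blast
  have [measurable]: "T \<in> borel_measurable borel"
    using contT by (auto intro!: borel_measurable_continuous_onI continuous_at_imp_continuous_on)
  have T1: "\<bar>T x\<bar> \<le> 1" for x unfolding T_def
    using tanh_real_lt_1[of "A + c * x"] tanh_real_gt_neg1[of "A + c * x"] by (simp add: abs_le_iff)
  have T2: "0 \<le> (T x)\<^sup>2 \<and> (T x)\<^sup>2 \<le> 1" for x using T1[of x] by (simp add: abs_square_le_1)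
  define H where "H x = c * (T x - (T x)^3 / 3)" for x
  have H': "(H has_real_derivative (c * (1 - (T x)\<^sup>2))\<^sup>2) (at x)" for x
    unfolding H_def by (auto intro!: derivative_eq_intros T' simp: power2_eq_square field_simps)
  have Hb: "\<bar>H x\<bar> \<le> 2 * c" for x
  proof -
    have "\<bar>T x ^ 3\<bar> \<le> 1" using T1[of x] by (simp add: power_abs power_le_one)
    then have "\<bar>T x - (T x)^3 / 3\<bar> \<le> 2" using T1[of x] by linarith
    then show ?thesis using c by (simp add: H_def abs_mult)
  qed
  have [measurable]: "H \<in> borel_measurable borel" unfolding H_def by measurable
  have iT: "integrable ?G T" by (rule std_normal.integrable_const_bound[where B=1]) (use T1 in auto)
  have iT2: "integrable ?G (\<lambda>x. (T x)\<^sup>2)" by (rule std_normal.integrable_const_bound[where B=1]) (use T2 in auto)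
  have iH: "integrable ?G H" by (rule std_normal.integrable_const_bound[where B="2*c"]) (use Hb in auto)
  have gp: "(LINT x|?G. x * H x) = (LINT x|?G. (c * (1 - (T x)\<^sup>2))\<^sup>2)" "integrable ?G (\<lambda>x. x * H x)"
  proof -
    have bd: "\<bar>(c * (1 - (T x)\<^sup>2))\<^sup>2\<bar> \<le> c\<^sup>2" for x
    proof -
      have "(c * (1 - (T x)\<^sup>2))\<^sup>2 \<le> (c * 1)\<^sup>2" by (rule power_mono) (use c T2[of x] in \<open>auto intro: mult_left_mono\<close>)
      then show ?thesis by simp
    qed
    show "(LINT x|?G. x * H x) = (LINT x|?G. (c * (1 - (T x)\<^sup>2))\<^sup>2)"
      by (rule gaussian_integration_by_parts(1)[OF H' _ Hb bd]) (intro continuous_intros contT)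
    show "integrable ?G (\<lambda>x. x * H x)"
      by (rule gaussian_integration_by_parts(2)[OF H' _ Hb bd]) (intro continuous_intros contT)
  qed
  define m where "m = (LINT x|?G. T x)"
  define s where "s = (LINT x|?G. (T x)\<^sup>2)"
  note id = integrable_std_normal_id integral_std_normal_id
  have "0 < (LINT x|?G. (T x - m)\<^sup>2)"
  proof (rule std_normal.integral_pos)
    show "integrable ?G (\<lambda>x. (T x - m)\<^sup>2)" using iT iT2 by (simp add: power2_eq_square algebra_simps)
    show "AE x in ?G. 0 < (T x - m)\<^sup>2"
    \<comment> \<open>\<open>T\<close> is injective, so it attains its mean at one point at most, a
      null set.\<close>
    proof (cases "\<exists>y. T y = m")
      case True
      then obtain y where y: "T y = m" by auto
      have ne: "T x \<noteq> m" if "x \<noteq> y" for x using that c unfolding y[symmetric] T_def by simp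
      show ?thesis using AE_std_normal_neq[of y] by eventually_elim (use ne in auto)
    next
      case False
      then show ?thesis by auto
    qed
  qed
  also have "(LINT x|?G. (T x - m)\<^sup>2) = s - m\<^sup>2"
  proof -
    have "(LINT x|?G. (T x - m)\<^sup>2) = (LINT x|?G. (T x)\<^sup>2 - 2 * m * T x + m\<^sup>2)"
      by (rule Bochner_Integration.integral_cong) (auto simp: power2_eq_square algebra_simps)
    also have "\<dots> = s - 2 * m * m + m\<^sup>2"
      using iT iT2 std_normal.prob_space by (simp add: m_def s_def)
    finally show ?thesis by (simp add: power2_eq_square)
  qed
  finally show "(LINT x|?G. (T x)\<^sup>2) - (LINT x|?G. T x)\<^sup>2 > 0" by (simp add: m_def s_def)
  \<comment> \<open>The gap in the pointwise inequality. It is positive for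
    \<open>x \<noteq> y\<close>, and its expansion consists of products of one function of
    \<open>x\<close> and one of \<open>y\<close>, so the two averages can be taken one after the
    other.\<close>
  define D where "D y x = (x - y) * (H x - H y) - (T x - T y)\<^sup>2" for y x
  have D_eq: "D y = (\<lambda>x. x * H x - H y * x - y * H x + y * H y - (T x)\<^sup>2 + 2 * T y * T x - (T y)\<^sup>2)" for y
    by (auto simp: D_def power2_eq_square algebra_simps)
  have iD: "integrable ?G (D y)" for y unfolding D_eq using gp(2) iH iT iT2 id by simp
  define a b where "a = (LINT x|?G. x * H x)" and "b = (LINT x|?G. H x)"
  have D: "(LINT x|?G. D y x) = a - y * b + y * H y - s + 2 * T y * m - (T y)\<^sup>2" for y
    unfolding D_eq using gp(2) iH iT iT2 id std_normal.prob_space by (simp add: a_def b_def m_def s_def)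
  have Dpos: "0 < (LINT x|?G. D y x)" for y
  proof (rule std_normal.integral_pos[OF iD])
    show "AE x in ?G. 0 < D y x"
      using AE_std_normal_neq[of y]
    proof eventually_elim
      fix x assume "x \<noteq> y"
      from tanh_affine_cauchy_schwarz[OF c this, of A] show "0 < D y x"
        by (simp add: D_def H_def T_def)
    qed
  qed
  \<comment> \<open>In the average over \<open>y\<close> the term with \<open>b\<close> drops out
    since the normal law has mean 0, and \<open>y * H y\<close> contributes a second
    \<open>a\<close>, the mean square derivative by integration by parts.\<close>
  have "0 < (LINT y|?G. a - y * b + y * H y - s + 2 * T y * m - (T y)\<^sup>2)"
  proof (rule std_normal.integral_pos)
    show "integrable ?G (\<lambda>y. a - y * b + y * H y - s + 2 * T y * m - (T y)\<^sup>2)"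
      using gp(2) iH iT iT2 id by simp
    show "AE y in ?G. 0 < a - y * b + y * H y - s + 2 * T y * m - (T y)\<^sup>2"
      using Dpos unfolding D by simp
  qed
  also have "\<dots> = 2 * a - 2 * s + 2 * m * m"
    using gp(2) iH iT iT2 id std_normal.prob_space by (simp add: a_def m_def s_def)
  finally show "(LINT x|?G. (T x)\<^sup>2) - (LINT x|?G. T x)\<^sup>2 < (LINT x|?G. (c * (1 - (T x)\<^sup>2))\<^sup>2)"
    using gp(1) by (simp add: a_def m_def s_def power2_eq_square)
qed

section \<open>The overlap recursion\<close>

abbreviation gauss_int :: "(real \<Rightarrow> real) \<Rightarrow> real" where
  "gauss_int F \<equiv> (LINT x|std_normal_distribution. F x)"

locale tap_model =
  fixes h \<beta> q :: real
  assumes h_pos: "h > 0" and beta_pos: "\<beta> > 0" and q_pos: "q > 0"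
    and q_eq: "q = (\<integral>z. (tanh (h + \<beta> * sqrt q * z))\<^sup>2 \<partial>std_normal_distribution)"
    and AT: "\<beta>\<^sup>2 * (\<integral>z. 1 / cosh (h + \<beta> * sqrt q * z) ^ 4 \<partial>std_normal_distribution) \<le> 1"
begin

abbreviation f :: "real \<Rightarrow> real" where "f \<equiv> Th h \<beta>"

lemma f_bound: "\<bar>f x\<bar> \<le> 1"
  using tanh_real_lt_1[of "h + \<beta> * x"] tanh_real_gt_neg1[of "h + \<beta> * x"] by (simp add: Th_def abs_le_iff)

lemma f_square: "0 \<le> (f x)\<^sup>2" "(f x)\<^sup>2 \<le> 1"
  using f_bound[of x] by (auto simp: abs_square_le_1)

lemma DERIV_f: "(f has_real_derivative \<beta> * (1 - (f x)\<^sup>2)) (at x)"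
  using DERIV_tanh_affine[of h \<beta> x] unfolding Th_def[abs_def] .

lemma f_isCont: "isCont f x"
  using DERIV_f DERIV_isCont by blast

lemma f_continuous: "continuous_on UNIV f"
  by (simp add: f_isCont continuous_at_imp_continuous_on)

lemma f_measurable[measurable]: "f \<in> borel_measurable borel"
  by (rule borel_measurable_continuous_onI[OF f_continuous])

lemma f_lipschitz: "\<bar>f x - f y\<bar> \<le> \<beta> * \<bar>x - y\<bar>"
proof -
  have *: "\<bar>f x - f y\<bar> \<le> \<beta> * \<bar>x - y\<bar>" if xy: "x < y" for x y
  proof -
    obtain z where z: "f y - f x = (y - x) * (\<beta> * (1 - (f z)\<^sup>2))"
      using MVT2[OF xy, of f "\<lambda>x. \<beta> * (1 - (f x)\<^sup>2)"] DERIV_f by blast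
    have "\<bar>f x - f y\<bar> = \<bar>y - x\<bar> * (\<beta> * (1 - (f z)\<^sup>2))"
      using f_square[of z] beta_pos by (subst abs_minus_commute) (simp add: z abs_mult)
    also have "\<dots> \<le> \<bar>y - x\<bar> * (\<beta> * 1)"
      using f_square[of z] beta_pos by (intro mult_left_mono) auto
    finally show ?thesis by (simp add: mult.commute abs_minus_commute)
  qed
  show ?thesis using *[of x y] *[of y x] by (cases x y rule: linorder_cases) (auto simp: abs_minus_commute)
qed

lemma q_eq': "gauss_int (\<lambda>z. (f (sqrt q * z))\<^sup>2) = q"
  using q_eq by (simp add: Th_def mult.assoc)

text \<open>For \<open>0 \<le> t \<le> q\<close> this is the expectation of \<open>f X * f Y\<close>
  for centered Gaussians of variance \<open>q\<close> and covariance \<open>t\<close>: given the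
  common part \<open>z\<close>, the factors are independent with equal conditional means.\<close>

definition psi :: "real \<Rightarrow> real" where
  "psi t = gauss_int (\<lambda>z. (gauss_int (\<lambda>x. f (sqrt t * z + sqrt (q - t) * x)))\<^sup>2)"

definition alpha :: real where
  "alpha = \<beta>\<^sup>2 * gauss_int (\<lambda>z. 1 / cosh (h + \<beta> * sqrt q * z) ^ 4)"

lemma alpha_le_1: "alpha \<le> 1" using AT by (simp add: alpha_def)

text \<open>The derivative of \<open>tanh\<close> is the inverse square of \<open>cosh\<close>, so
  \<open>alpha\<close> is the mean square slope of \<open>f\<close> under the Gaussian of variance
  \<open>q\<close>, the constant that the Poincare inequality produces.\<close>

lemma alpha_eq: "alpha = gauss_int (\<lambda>z. (\<beta> * (1 - (f (sqrt q * z))\<^sup>2))\<^sup>2)"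
proof -
  have "1 / cosh x ^ 4 = (1 - (tanh x)\<^sup>2)\<^sup>2" for x :: real
  proof -
    have "1 - (tanh x)\<^sup>2 = 1 / (cosh x)\<^sup>2"
    proof -
      have "1 - (tanh x)\<^sup>2 = ((cosh x)\<^sup>2 - (sinh x)\<^sup>2) / (cosh x)\<^sup>2"
        by (simp add: tanh_def power_divide diff_divide_distrib)
      then show ?thesis by (simp only: hyperbolic_pythagoras)
    qed
    then show ?thesis by (simp add: power_divide flip: power_mult)
  qed
  then show ?thesis unfolding alpha_def Th_def by (simp add: power_mult_distrib mult.assoc)
qed

lemma gauss_int_bound:
  assumes "\<And>x. \<bar>F x\<bar> \<le> 1" "F \<in> borel_measurable borel"
  shows "\<bar>gauss_int F\<bar> \<le> 1"
proof -
  have "\<bar>gauss_int F\<bar> \<le> gauss_int (\<lambda>x. \<bar>F x\<bar>)" by (rule integral_abs_bound)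
  also have "\<dots> \<le> gauss_int (\<lambda>x. 1)"
    by (rule integral_mono) (use assms in \<open>auto intro!: std_normal.integrable_const_bound[where B=1]\<close>)
  finally show ?thesis using std_normal.prob_space by simp
qed

lemma inner_bound: "\<bar>gauss_int (\<lambda>x. f (a * z + b * x))\<bar> \<le> 1"
  by (rule gauss_int_bound) (auto simp: f_bound)

lemma inner_square_bound: "\<bar>gauss_int (\<lambda>x. (f (a * z + b * x))\<^sup>2)\<bar> \<le> 1"
  by (rule gauss_int_bound) (auto simp: f_square)

lemma psi_integrable: "integrable std_normal_distribution (\<lambda>z. (gauss_int (\<lambda>x. f (a * z + b * x)))\<^sup>2)"
proof (rule std_normal.integrable_const_bound[where B=1])
  show "AE z in std_normal_distribution. norm ((gauss_int (\<lambda>x. f (a * z + b * x)))\<^sup>2) \<le> 1"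
    using inner_bound[of a _ b] by (simp add: abs_square_le_1)
qed simp

text \<open>Given \<open>z\<close>, \<open>V\<close> is the variance of
  \<open>f (a * z + b * x)\<close> and \<open>W\<close> its Poincare bound, carrying the factor
  \<open>b^2 = q - t\<close>. Averaging over \<open>z\<close> restores the variance
  \<open>a^2 + b^2 = q\<close>, so the mean of \<open>W\<close> no longer involves \<open>t\<close>
  except through that factor.\<close>

lemma psi_gap:
  assumes t: "0 \<le> t" "t < q"
  shows "psi t < q" "q - psi t < alpha * (q - t)"
proof -
  let ?G = std_normal_distribution
  define a b where "a = sqrt t" and "b = sqrt (q - t)"
  have ab: "sqrt (a\<^sup>2 + b\<^sup>2) = sqrt q" and b: "b > 0" and bb: "b\<^sup>2 = q - t" using t by (auto simp: a_def b_def)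
  define V where "V z = gauss_int (\<lambda>x. (f (a * z + b * x))\<^sup>2) - (gauss_int (\<lambda>x. f (a * z + b * x)))\<^sup>2" for z
  define W where "W z = gauss_int (\<lambda>x. (\<beta> * b * (1 - (f (a * z + b * x))\<^sup>2))\<^sup>2)" for z
  have Vpos: "0 < V z" and VW: "V z < W z" for z
    using tanh_affine_variance[of "\<beta> * b" "h + \<beta> * a * z"] b beta_pos
    by (simp_all add: V_def W_def Th_def algebra_simps)
  have i1: "integrable ?G (\<lambda>z. gauss_int (\<lambda>x. (f (a * z + b * x))\<^sup>2))"
    by (rule std_normal.integrable_const_bound[where B=1]) (use inner_square_bound in auto)
  have iV: "integrable ?G V" unfolding V_def using i1 psi_integrable by simp
  have W_eq: "W z = b\<^sup>2 * gauss_int (\<lambda>x. (\<beta> * (1 - (f (a * z + b * x))\<^sup>2))\<^sup>2)" for z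
  proof -
    have "(\<beta> * b * (1 - (f (a * z + b * x))\<^sup>2))\<^sup>2 = b\<^sup>2 * (\<beta> * (1 - (f (a * z + b * x))\<^sup>2))\<^sup>2" for x
      by (simp add: power_mult_distrib)
    then show ?thesis by (simp add: W_def)
  qed
  have gb: "\<bar>(\<beta> * (1 - (f x)\<^sup>2))\<^sup>2\<bar> \<le> \<beta>\<^sup>2" for x
  proof -
    have "(\<beta> * (1 - (f x)\<^sup>2))\<^sup>2 \<le> (\<beta> * 1)\<^sup>2"
      by (rule power_mono) (use beta_pos f_square[of x] in \<open>auto intro!: mult_left_mono\<close>)
    then show ?thesis by simp
  qed
  have IW: "gauss_int W = (q - t) * alpha"
    unfolding W_eq using gaussian_mixture[of "\<lambda>x. (\<beta> * (1 - (f x)\<^sup>2))\<^sup>2" "\<beta>\<^sup>2" a b, OF _ gb, unfolded ab]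
    by (simp add: bb alpha_eq)
  have iW: "integrable ?G W"
  proof (rule std_normal.integrable_const_bound[where B="b\<^sup>2 * \<beta>\<^sup>2"])
    show "AE z in ?G. norm (W z) \<le> b\<^sup>2 * \<beta>\<^sup>2"
    proof (rule AE_I2)
      fix z
      have i: "integrable ?G (\<lambda>x. (\<beta> * (1 - (f (a * z + b * x))\<^sup>2))\<^sup>2)"
        by (rule std_normal.integrable_const_bound[where B="\<beta>\<^sup>2"]) (use gb in auto)
      have "\<bar>gauss_int (\<lambda>x. (\<beta> * (1 - (f (a * z + b * x))\<^sup>2))\<^sup>2)\<bar> \<le> gauss_int (\<lambda>x. \<beta>\<^sup>2)"
        by (rule order_trans[OF integral_abs_bound integral_mono]) (use gb i in auto)
      then have "\<bar>gauss_int (\<lambda>x. (\<beta> * (1 - (f (a * z + b * x))\<^sup>2))\<^sup>2)\<bar> \<le> \<beta>\<^sup>2" using std_normal.prob_space by simp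
      then show "norm (W z) \<le> b\<^sup>2 * \<beta>\<^sup>2" unfolding W_eq by (simp add: abs_mult mult_left_mono)
    qed
    show "W \<in> borel_measurable ?G" unfolding W_def by measurable
  qed
  have IV: "gauss_int V = q - psi t"
  proof -
    have "gauss_int V = gauss_int (\<lambda>z. gauss_int (\<lambda>x. (f (a * z + b * x))\<^sup>2)) - psi t"
      unfolding V_def psi_def a_def[symmetric] b_def[symmetric] using i1 psi_integrable by simp
    also have "gauss_int (\<lambda>z. gauss_int (\<lambda>x. (f (a * z + b * x))\<^sup>2)) = q"
      using gaussian_mixture[of "\<lambda>x. (f x)\<^sup>2" 1 a b] f_square q_eq' by (simp add: ab)
    finally show ?thesis .
  qed
  have "0 < gauss_int V" by (rule std_normal.integral_pos[OF iV]) (use Vpos in auto)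
  then show "psi t < q" using IV by simp
  have "0 < gauss_int (\<lambda>z. W z - V z)" by (rule std_normal.integral_pos) (use VW iV iW in auto)
  then show "q - psi t < alpha * (q - t)" using IV IW iV iW by (simp add: mult.commute)
qed

lemma psi_greater:
  assumes "0 \<le> t" "t < q" shows "t < psi t"
proof -
  have "alpha * (q - t) \<le> 1 * (q - t)" using assms alpha_le_1 by (intro mult_right_mono) auto
  then show ?thesis using psi_gap(2)[OF assms] by simp
qed

text \<open>Used to identify the limit of \<open>rho\<close> as a fixed point; dominated convergence
  with bound 1 handles both integrals.\<close>

lemma psi_tendsto:
  assumes u: "u \<longlonglongrightarrow> t" and b: "0 \<le> t" "t \<le> q"
  shows "(\<lambda>k. psi (u k)) \<longlonglongrightarrow> psi t"
  unfolding psi_def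
proof (rule integral_dominated_convergence[where w="\<lambda>_. 1"])
  show "AE z in std_normal_distribution. (\<lambda>k. (gauss_int (\<lambda>x. f (sqrt (u k) * z + sqrt (q - u k) * x)))\<^sup>2)
      \<longlonglongrightarrow> (gauss_int (\<lambda>x. f (sqrt t * z + sqrt (q - t) * x)))\<^sup>2"
  proof (rule AE_I2, rule tendsto_power)
    fix z
    show "(\<lambda>k. gauss_int (\<lambda>x. f (sqrt (u k) * z + sqrt (q - u k) * x))) \<longlonglongrightarrow> gauss_int (\<lambda>x. f (sqrt t * z + sqrt (q - t) * x))"
    proof (rule integral_dominated_convergence[where w="\<lambda>_. 1"])
      show "AE x in std_normal_distribution. (\<lambda>k. f (sqrt (u k) * z + sqrt (q - u k) * x)) \<longlonglongrightarrow> f (sqrt t * z + sqrt (q - t) * x)"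
        by (intro AE_I2 isCont_tendsto_compose[OF f_isCont] tendsto_intros u)
    qed (auto simp: f_bound)
  qed
  show "AE z in std_normal_distribution. norm ((gauss_int (\<lambda>x. f (sqrt (u k) * z + sqrt (q - u k) * x)))\<^sup>2) \<le> 1" for k
    using inner_bound by (simp add: abs_square_le_1)
qed auto

text \<open>The limiting overlap of the iterate \<open>k + 1\<close> with every later one. The start
  value belongs to the first iterate, the deterministic vector with entries
  \<open>sqrt q\<close>.\<close>

primrec rho :: "nat \<Rightarrow> real" where
  "rho 0 = sqrt q * gauss_int (\<lambda>z. f (sqrt q * z))"
| "rho (Suc k) = psi (rho k)"

text \<open>Averaging the integrand over \<open>z\<close> and \<open>- z\<close> makes it pointwise
  nonnegative: \<open>tanh\<close> is odd and increasing, and \<open>h > 0\<close>. This puts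
  \<open>rho 0\<close> into the range where \<open>psi\<close> is controlled.\<close>

lemma integral_f_nonneg: "0 \<le> gauss_int (\<lambda>z. f (sqrt q * z))"
proof -
  have i: "integrable std_normal_distribution (\<lambda>z. f (c * z))" for c
    by (rule std_normal.integrable_const_bound[where B=1]) (auto simp: f_bound)
  have "gauss_int (\<lambda>z. f (- sqrt q * z)) = gauss_int (\<lambda>z. f (sqrt q * z))"
    \<comment> \<open>The coefficients \<open>- sqrt q\<close> and \<open>0\<close> express the
      symmetry of the normal law.\<close>
    using gaussian_mixture[of f 1 "- sqrt q" 0, OF _ f_bound] q_pos std_normal.prob_space by simp
  then have "2 * gauss_int (\<lambda>z. f (sqrt q * z)) = gauss_int (\<lambda>z. f (sqrt q * z) + f (- sqrt q * z))"
    using i[of "sqrt q"] i[of "- sqrt q"] by simp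
  also have "\<dots> \<ge> 0"
  proof (rule integral_nonneg_AE, rule AE_I2)
    fix z
    have "tanh (\<beta> * (sqrt q * z) - h) \<le> tanh (h + \<beta> * (sqrt q * z))" using h_pos by simp
    moreover have "tanh (h + \<beta> * (- sqrt q * z)) = - tanh (\<beta> * (sqrt q * z) - h)"
      by (subst tanh_minus[symmetric]) simp
    ultimately show "0 \<le> f (sqrt q * z) + f (- sqrt q * z)" by (simp add: Th_def)
  qed
  finally show ?thesis by simp
qed

text \<open>At the start, the squared mean of \<open>f\<close> lies strictly below its second moment
  \<open>q\<close> because the variance is positive. Strictness at every \<open>k\<close> later
  keeps the Cholesky pivots positive.\<close>

lemma rho_bounds: "0 \<le> rho k" "rho k < q"
proof (atomize(full), induction k)
  case 0
  have "(gauss_int (\<lambda>z. f (sqrt q * z)))\<^sup>2 < q"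
    using tanh_affine_variance(1)[of "\<beta> * sqrt q" h] beta_pos q_pos q_eq by (simp add: Th_def mult.assoc)
  then have "gauss_int (\<lambda>z. f (sqrt q * z)) < sqrt q" by (simp add: real_less_rsqrt)
  then have "sqrt q * gauss_int (\<lambda>z. f (sqrt q * z)) < sqrt q * sqrt q"
    using q_pos by (intro mult_strict_left_mono) auto
  then show ?case using integral_f_nonneg q_pos by simp
next
  case (Suc k)
  then show ?case using psi_gap(1)[of "rho k"] psi_greater[of "rho k"] by simp
qed

lemma rho_Suc_less: "rho k < rho (Suc k)"
  using psi_greater rho_bounds by simp

text \<open>The monotone limit is a fixed point of the continuous map \<open>psi\<close>, and
  \<open>t < psi t\<close> excludes fixed points below \<open>q\<close>. The boundary case
  \<open>alpha = 1\<close> is covered because the Poincare inequality itself is strict.\<close>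

lemma rho_tendsto: "rho \<longlonglongrightarrow> q"
proof -
  have inc: "incseq rho" using rho_Suc_less less_imp_le by (intro incseq_SucI) blast
  obtain L where L: "rho \<longlonglongrightarrow> L" "\<And>i. rho i \<le> L"
    using incseq_convergent[OF inc, of q] rho_bounds(2) less_imp_le by metis
  have L0: "0 \<le> L" using rho_bounds(1)[of 0] L(2)[of 0] by simp
  have Lq: "L \<le> q" by (rule LIMSEQ_le_const2[OF L(1)]) (use rho_bounds(2) less_imp_le in blast)
  have "(\<lambda>k. rho (Suc k)) \<longlonglongrightarrow> psi L" using psi_tendsto[OF L(1) L0 Lq] by simp
  moreover have "(\<lambda>k. rho (Suc k)) \<longlonglongrightarrow> L" using L(1) by (rule LIMSEQ_Suc)
  ultimately have "psi L = L" by (rule LIMSEQ_unique)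
  then have "L = q" using psi_greater[OF L0] Lq by force
  then show ?thesis using L(1) by simp
qed

lemma rho_gap: "q - rho k \<le> q * alpha ^ k"
proof (induction k)
  case 0
  then show ?case using rho_bounds[of 0] by simp
next
  case (Suc k)
  have a: "0 \<le> alpha" unfolding alpha_eq by simp
  have "q - rho (Suc k) \<le> alpha * (q - rho k)" using psi_gap(2)[of "rho k"] rho_bounds[of k] by simp
  also have "\<dots> \<le> alpha * (q * alpha ^ k)" using Suc a by (intro mult_left_mono) auto
  finally show ?case by (simp add: mult_ac)
qed

section \<open>Gaussian expectations involving f\<close>

lemma gaussian_single:
  assumes X: "gaussian_family M X C" and C: "C a a = q" and [measurable]: "F \<in> borel_measurable borel"
  shows "(LINT \<omega>|M. F (X a \<omega>)) = gauss_int (\<lambda>z. F (sqrt q * z))"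
proof -
  have "gaussian_family M (\<lambda>_::unit. X a) (\<lambda>_ _. q)"
    using gaussian_family_reindex[OF X, of "\<lambda>_::unit. a"] C by simp
  moreover have "gaussian_family std_normal_distribution (\<lambda>_::unit. \<lambda>z. sqrt q * z) (\<lambda>_ _. q)"
    using gaussian_family_std_normal[of "\<lambda>_::unit. sqrt q"] q_pos by simp
  ultimately show ?thesis using gaussian_family_integral(1)[of _ _ _ _ _ "\<lambda>\<omega>. F (\<omega> ())"] by force
qed

text \<open>The pair is realised with a common part of variance \<open>t\<close> and two independent
  parts of variance \<open>q - t\<close>; conditionally on the common part the expectation is a
  square.\<close>

lemma gaussian_pair:
  assumes X: "gaussian_family M X C" and C: "C True True = q" "C False False = q" "C True False = t" "C False True = t"
    and t: "0 \<le> t" "t \<le> q"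
  shows "(LINT \<omega>|M. f (X True \<omega>) * f (X False \<omega>)) = psi t"
proof -
  let ?G = std_normal_distribution
  interpret P: pair_prob_space ?G ?G by unfold_locales
  interpret PP: pair_prob_space ?G "?G \<Otimes>\<^sub>M ?G" by unfold_locales
  define Y where "Y b \<omega> = sqrt t * fst \<omega> + ((if b then sqrt (q - t) else 0) * fst (snd \<omega>) + (if b then 0 else sqrt (q - t)) * snd (snd \<omega>))"
    for b and \<omega> :: "real \<times> real \<times> real"
  have Y: "gaussian_family (?G \<Otimes>\<^sub>M (?G \<Otimes>\<^sub>M ?G)) Y C"
    by (rule gaussian_family_cong[OF gaussian_family_add[OF gaussian_family_std_normal[of "\<lambda>_. sqrt t"]
         gaussian_family_add[OF gaussian_family_std_normal[of "\<lambda>b. if b then sqrt (q - t) else 0"]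
             gaussian_family_std_normal[of "\<lambda>b. if b then 0 else sqrt (q - t)"]]]])
       (use C t in \<open>auto simp: Y_def split: if_splits bool.splits\<close>)
  note [measurable] = gaussian_familyD(2)[OF Y]
  have "(LINT \<omega>|M. f (X True \<omega>) * f (X False \<omega>)) = (LINT \<omega>|(?G \<Otimes>\<^sub>M (?G \<Otimes>\<^sub>M ?G)). f (Y True \<omega>) * f (Y False \<omega>))"
    using gaussian_family_integral(1)[OF X Y, of "\<lambda>\<omega>. f (\<omega> True) * f (\<omega> False)"] by simp
  also have "\<dots> = (LINT z|?G. LINT p|(?G \<Otimes>\<^sub>M ?G). f (Y True (z, p)) * f (Y False (z, p)))"
    by (rule PP.integral_fst'[symmetric], rule PP.integrable_const_bound[where B=1])
      (auto simp: abs_mult f_bound intro!: mult_le_one)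
  also have "\<dots> = psi t" unfolding psi_def
  proof (rule Bochner_Integration.integral_cong[OF refl])
    fix z
    have "(LINT p|(?G \<Otimes>\<^sub>M ?G). f (Y True (z, p)) * f (Y False (z, p)))
       = (LINT x|?G. LINT y|?G. f (sqrt t * z + sqrt (q - t) * x) * f (sqrt t * z + sqrt (q - t) * y))"
      by (subst P.integral_fst'[symmetric])
        (auto intro!: P.integrable_const_bound[where B=1] AE_I2 mult_le_one simp: abs_mult f_bound Y_def)
    then show "(LINT p|(?G \<Otimes>\<^sub>M ?G). f (Y True (z, p)) * f (Y False (z, p))) = (gauss_int (\<lambda>x. f (sqrt t * z + sqrt (q - t) * x)))\<^sup>2"
      by (simp add: power2_eq_square)
  qed
  finally show ?thesis .
qed

text \<open>With the second variable written as \<open>a * z + b * x\<close>, integration by parts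
  in \<open>z\<close> yields \<open>a\<close> times the mean of \<open>f'\<close>. The equation for
  \<open>q\<close> evaluates that mean as \<open>\<beta> * (1 - q)\<close>, the coefficient of the
  Onsager term.\<close>

lemma gaussian_stein:
  assumes X: "gaussian_family M X C" and C: "C True True = 1" "C False False = q" "C True False = a" "C False True = a"
    and a: "a\<^sup>2 \<le> q"
  shows "(LINT \<omega>|M. X True \<omega> * f (X False \<omega>)) = a * (\<beta> * (1 - q))"
proof -
  let ?G = std_normal_distribution
  interpret P: pair_prob_space ?G ?G by unfold_locales
  define b where "b = sqrt (q - a\<^sup>2)"
  have b2: "a * a + b * b = q" using a by (simp add: b_def power2_eq_square)
  define Y where "Y c \<omega> = (if c then 1 else a) * fst \<omega> + (if c then 0 else b) * snd \<omega>" for c and \<omega> :: "real \<times> real"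
  have Y: "gaussian_family (?G \<Otimes>\<^sub>M ?G) Y C"
    by (rule gaussian_family_cong[OF gaussian_family_add[OF gaussian_family_std_normal[of "\<lambda>c. if c then 1 else a"]
         gaussian_family_std_normal[of "\<lambda>c. if c then 0 else b"]]])
       (use C b2 in \<open>auto simp: Y_def split: if_splits\<close>)
  note [measurable] = gaussian_familyD(2)[OF Y]
  have "(LINT \<omega>|M. X True \<omega> * f (X False \<omega>)) = (LINT \<omega>|(?G \<Otimes>\<^sub>M ?G). Y True \<omega> * f (Y False \<omega>))"
    using gaussian_family_integral(1)[OF X Y, of "\<lambda>\<omega>. \<omega> True * f (\<omega> False)"] by simp
  also have "\<dots> = (LINT (z, x)|(?G \<Otimes>\<^sub>M ?G). z * f (a * z + b * x))"
    by (intro Bochner_Integration.integral_cong) (auto simp: Y_def)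
  also have "\<dots> = (LINT x|?G. LINT z|?G. z * f (a * z + b * x))"
  proof (rule P.integral_snd[symmetric])
    have "integrable (?G \<Otimes>\<^sub>M ?G) (\<lambda>(z, x). z * f (a * z + b * x))"
    proof (rule P.Fubini_integrable)
      have i: "integrable ?G (\<lambda>x. \<bar>z\<bar> * \<bar>f (a * z + b * x)\<bar>)" for z
        by (intro integrable_mult_right std_normal.integrable_const_bound[where B=1]) (auto simp: f_bound)
      show "integrable ?G (\<lambda>z. LINT x|?G. norm (case (z, x) of (z, x) \<Rightarrow> z * f (a * z + b * x)))"
      proof (rule Bochner_Integration.integrable_bound[OF integrable_std_normal_id])
        show "AE z in ?G. norm (LINT x|?G. norm (case (z, x) of (z, x) \<Rightarrow> z * f (a * z + b * x))) \<le> norm z"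
        proof (rule AE_I2)
          fix z :: real
          have "(LINT x|?G. \<bar>z\<bar> * \<bar>f (a * z + b * x)\<bar>) \<le> (LINT x|?G. \<bar>z\<bar>)"
            by (rule integral_mono[OF i]) (auto simp: f_bound mult_left_le)
          then show "norm (LINT x|?G. norm (case (z, x) of (z, x) \<Rightarrow> z * f (a * z + b * x))) \<le> norm z"
            using std_normal.prob_space by (simp add: abs_mult)
        qed
      qed measurable
      show "AE z in ?G. integrable ?G (\<lambda>x. case (z, x) of (z, x) \<Rightarrow> z * f (a * z + b * x))"
      proof (rule AE_I2)
        fix z
        show "integrable ?G (\<lambda>x. case (z, x) of (z, x) \<Rightarrow> z * f (a * z + b * x))" unfolding prod.case
          by (intro integrable_mult_right std_normal.integrable_const_bound[where B=1]) (auto simp: f_bound)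
      qed
    qed measurable
    then show "integrable (?G \<Otimes>\<^sub>M ?G) (\<lambda>(z, x). z * f (a * z + b * x))" .
  qed
  also have "\<dots> = (LINT x|?G. LINT z|?G. a * (\<beta> * (1 - (f (a * z + b * x))\<^sup>2)))"
  proof (rule Bochner_Integration.integral_cong[OF refl])
    fix x
    show "(LINT z|?G. z * f (a * z + b * x)) = (LINT z|?G. a * (\<beta> * (1 - (f (a * z + b * x))\<^sup>2)))"
    proof (rule gaussian_integration_by_parts(1)[where B=1 and B'="\<bar>a\<bar> * \<beta>"])
      show "((\<lambda>z. f (a * z + b * x)) has_real_derivative a * (\<beta> * (1 - (f (a * z + b * x))\<^sup>2))) (at z)" for z
      proof -
        have "((\<lambda>z. a * z + b * x) has_real_derivative a) (at z)" by (auto intro!: derivative_eq_intros)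
        from DERIV_chain2[OF DERIV_f this] show ?thesis by (simp add: mult.commute[of _ a])
      qed
      show "isCont (\<lambda>z. a * (\<beta> * (1 - (f (a * z + b * x))\<^sup>2))) z" for z
        by (intro continuous_intros isCont_o2[OF _ f_isCont])
      show "\<bar>a * (\<beta> * (1 - (f (a * z + b * x))\<^sup>2))\<bar> \<le> \<bar>a\<bar> * \<beta>" for z
      proof -
        have "\<bar>a * (\<beta> * (1 - (f (a * z + b * x))\<^sup>2))\<bar> = \<bar>a\<bar> * (\<beta> * (1 - (f (a * z + b * x))\<^sup>2))"
          using beta_pos f_square[of "a * z + b * x"] by (simp add: abs_mult)
        also have "\<dots> \<le> \<bar>a\<bar> * (\<beta> * 1)"
          using beta_pos f_square[of "a * z + b * x"] by (intro mult_left_mono) auto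
        finally show ?thesis by simp
      qed
    qed (rule f_bound)
  qed
  also have "\<dots> = a * (\<beta> * (1 - (LINT x|?G. LINT z|?G. (f (b * x + a * z))\<^sup>2)))"
  proof -
    have i: "integrable ?G (\<lambda>z. (f (b * x + a * z))\<^sup>2)" for x
      by (rule std_normal.integrable_const_bound[where B=1]) (auto simp: f_square)
    have e: "(LINT z|?G. a * (\<beta> * (1 - (f (a * z + b * x))\<^sup>2))) = a * (\<beta> * (1 - (LINT z|?G. (f (b * x + a * z))\<^sup>2)))" for x
      using i[of x] std_normal.prob_space by (simp add: add.commute)
    moreover have "integrable ?G (\<lambda>x. LINT z|?G. (f (b * x + a * z))\<^sup>2)"
      by (rule std_normal.integrable_const_bound[where B=1]) (use inner_square_bound in auto)
    ultimately show ?thesis unfolding e using std_normal.prob_space by simp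
  qed
  also have "(LINT x|?G. LINT z|?G. (f (b * x + a * z))\<^sup>2) = q"
    using gaussian_mixture[of "\<lambda>x. (f x)\<^sup>2" 1 b a] f_square q_eq' b2 by (simp add: power2_eq_square add.commute)
  finally show ?thesis .
qed

end

section \<open>The operator norm of a Gaussian matrix\<close>

text \<open>Chernoff bound with the exponent \<open>T / S\<close>, which is optimal when the
  variance equals its bound \<open>S\<close>.\<close>

lemma std_normal_tail:
  fixes s S T :: real
  assumes s: "s\<^sup>2 \<le> S" and S: "S > 0" and T: "T > 0"
  shows "measure std_normal_distribution {x. T \<le> s * x} \<le> exp (- T\<^sup>2 / (2 * S))"
proof -
  let ?G = std_normal_distribution
  define \<theta> where "\<theta> = T / S"
  define r where "r = \<theta> * s"
  have "ennreal (measure ?G {x. T \<le> s * x}) = (\<integral>\<^sup>+x. indicator {x. T \<le> s * x} x \<partial>?G)"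
    by (simp add: std_normal.emeasure_eq_measure)
  also have "\<dots> \<le> (\<integral>\<^sup>+x. ennreal (exp (r * x - \<theta> * T)) \<partial>?G)"
  proof (rule nn_integral_mono)
    fix x
    show "indicator {x. T \<le> s * x} x \<le> ennreal (exp (r * x - \<theta> * T))"
    proof (cases "T \<le> s * x")
      case True
      then have "\<theta> * T \<le> \<theta> * (s * x)" using S T by (intro mult_left_mono) (auto simp: \<theta>_def)
      then have "1 \<le> exp (r * x - \<theta> * T)" by (simp add: r_def mult.assoc)
      then show ?thesis by (auto simp: indicator_def)
    qed simp
  qed
  also have "\<dots> = (\<integral>\<^sup>+x. ennreal (exp (r\<^sup>2 / 2 - \<theta> * T)) * ennreal (normal_density r 1 x) \<partial>lborel)"
  proof (subst nn_integral_density; (intro nn_integral_cong)?)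
    fix x
    \<comment> \<open>Completing the square: the exponential tilt only moves the mean of the density
      to \<open>r\<close>.\<close>
    have "std_normal_density x * exp (r * x - \<theta> * T) = exp (r\<^sup>2 / 2 - \<theta> * T) * normal_density r 1 x"
    proof -
      have "- x\<^sup>2 / 2 + (r * x - \<theta> * T) = (r\<^sup>2 / 2 - \<theta> * T) + (- (x - r)\<^sup>2 / 2)"
        by (simp add: power2_eq_square field_simps)
      then have "exp (- x\<^sup>2 / 2) * exp (r * x - \<theta> * T) = exp (r\<^sup>2 / 2 - \<theta> * T) * exp (- (x - r)\<^sup>2 / 2)"
        by (simp only: exp_add[symmetric])
      then show ?thesis by (simp add: normal_density_def)
    qed
    then show "ennreal (std_normal_density x) * ennreal (exp (r * x - \<theta> * T)) = ennreal (exp (r\<^sup>2 / 2 - \<theta> * T)) * ennreal (normal_density r 1 x)"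
      by (simp add: ennreal_mult[symmetric])
  qed simp_all
  also have "\<dots> = ennreal (exp (r\<^sup>2 / 2 - \<theta> * T)) * (\<integral>\<^sup>+x. ennreal (normal_density r 1 x) \<partial>lborel)"
    by (rule nn_integral_cmult) simp
  also have "(\<integral>\<^sup>+x. ennreal (normal_density r 1 x) \<partial>lborel) = 1"
    by (subst nn_integral_eq_integral) auto
  also have "ennreal (exp (r\<^sup>2 / 2 - \<theta> * T)) * 1 \<le> ennreal (exp (- T\<^sup>2 / (2 * S)))"
  proof -
    have "r\<^sup>2 = \<theta>\<^sup>2 * s\<^sup>2" by (simp add: r_def power_mult_distrib)
    also have "\<dots> \<le> \<theta>\<^sup>2 * S" using s by (intro mult_left_mono) auto
    also have "\<dots> = T\<^sup>2 / S" using S by (simp add: \<theta>_def power2_eq_square)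
    finally have "r\<^sup>2 / 2 - \<theta> * T \<le> - T\<^sup>2 / (2 * S)" using S by (simp add: \<theta>_def power2_eq_square field_simps)
    then show ?thesis by (simp add: ennreal_leI)
  qed
  finally show ?thesis by (simp add: ennreal_le_iff)
qed

section \<open>Gaussian bilinear forms on a lattice net\<close>

definition bform :: "nat \<Rightarrow> (nat \<Rightarrow> real) \<Rightarrow> (nat \<Rightarrow> real) \<Rightarrow> (nat \<times> nat \<Rightarrow> real) \<Rightarrow> real" where
  "bform N x y W = (\<Sum>i=1..N. \<Sum>j=1..N. x i * y j * W (i, j))"

lemma bform_add: "bform N (\<lambda>i. x i + x' i) y W = bform N x y W + bform N x' y W"
    "bform N x (\<lambda>i. y i + y' i) W = bform N x y W + bform N x y' W"
  by (simp_all add: bform_def sum.distrib algebra_simps)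

lemma bform_scale: "bform N (\<lambda>i. c * x i) y W = c * bform N x y W" "bform N x (\<lambda>i. c * y i) W = c * bform N x y W"
  by (simp_all add: bform_def sum_distrib_left mult_ac)

lemma bform_measurable[measurable]: "bform N x y \<in> borel_measurable iid_normal"
  unfolding bform_def[abs_def] by measurable

text \<open>For fixed vectors the form is a centered Gaussian whose variance is the product of the
  two squared Euclidean lengths.\<close>

lemma bform_tail:
  assumes x: "(\<Sum>i=1..N. (x i)\<^sup>2) \<le> S" and y: "(\<Sum>i=1..N. (y i)\<^sup>2) \<le> S" and S: "S > 0" and T: "T > 0"
  shows "measure iid_normal {W. T \<le> bform N x y W} \<le> exp (- T\<^sup>2 / (2 * S\<^sup>2))"
proof -
  define s where "s = sqrt ((\<Sum>i=1..N. (x i)\<^sup>2) * (\<Sum>i=1..N. (y i)\<^sup>2))"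
  have ss: "s * s = (\<Sum>i=1..N. (x i)\<^sup>2) * (\<Sum>i=1..N. (y i)\<^sup>2)"
    by (simp add: s_def sum_nonneg)
  have "gaussian_family iid_normal (\<lambda>_::unit. \<lambda>W. \<Sum>p\<in>{1..N} \<times> {1..N}. x (fst p) * y (snd p) * W p)
     (\<lambda>_ _. \<Sum>p\<in>{1..N} \<times> {1..N}. \<Sum>r\<in>{1..N} \<times> {1..N}. (x (fst p) * y (snd p)) * (x (fst r) * y (snd r)) * (if p = r then 1 else 0))"
    by (rule gaussian_family_linear[OF gaussian_family_iid_normal]) simp
  then have 1: "gaussian_family iid_normal (\<lambda>_::unit. bform N x y) (\<lambda>_ _. s * s)"
  proof (rule gaussian_family_cong)
    show "(\<Sum>p\<in>{1..N} \<times> {1..N}. x (fst p) * y (snd p) * W p) = bform N x y W" for W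
      by (simp add: bform_def sum.cartesian_product case_prod_beta)
    have "(\<Sum>p\<in>{1..N} \<times> {1..N}. \<Sum>r\<in>{1..N} \<times> {1..N}. (x (fst p) * y (snd p)) * (x (fst r) * y (snd r)) * (if p = r then 1 else 0))
      = (\<Sum>p\<in>{1..N} \<times> {1..N}. (x (fst p))\<^sup>2 * (y (snd p))\<^sup>2)"
      by (rule sum.cong[OF refl]) (simp add: if_distrib[of "(*) _"] power2_eq_square mult_ac cong: if_cong)
    also have "\<dots> = s * s" unfolding ss sum_product by (simp add: sum.cartesian_product case_prod_beta)
    finally show "(\<Sum>p\<in>{1..N} \<times> {1..N}. \<Sum>r\<in>{1..N} \<times> {1..N}. (x (fst p) * y (snd p)) * (x (fst r) * y (snd r)) * (if p = r then 1 else 0)) = s * s" .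
  qed
  have 2: "gaussian_family std_normal_distribution (\<lambda>_::unit. (*) s) (\<lambda>_ _. s * s)"
    by (rule gaussian_family_std_normal)
  have "(LINT W|iid_normal. indicator {T..} (bform N x y W)) = (LINT z|std_normal_distribution. indicator {T..} (s * z) :: real)"
    using gaussian_family_integral(1)[OF 1 2, of "\<lambda>\<omega>. indicator {T..} (\<omega> ())"] by simp
  moreover have "(LINT W|iid_normal. indicator {T..} (bform N x y W)) = measure iid_normal {W. T \<le> bform N x y W}"
  proof -
    have "{W \<in> space iid_normal. T \<le> bform N x y W} \<in> sets iid_normal" by measurable
    then have "{W. T \<le> bform N x y W} \<in> sets iid_normal" by simp
    moreover have "indicator {T..} (bform N x y W) = (indicator {W. T \<le> bform N x y W} W :: real)" for W by (simp add: indicator_def)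
    ultimately show ?thesis by simp
  qed
  moreover have "(LINT z|std_normal_distribution. indicator {T..} (s * z) :: real) = measure std_normal_distribution {x. T \<le> s * x}"
  proof -
    have "indicator {T..} (s * z) = (indicator {x. T \<le> s * x} z :: real)" for z by (simp add: indicator_def)
    then show ?thesis by simp
  qed
  ultimately have "measure iid_normal {W. T \<le> bform N x y W} = measure std_normal_distribution {x. T \<le> s * x}" by simp
  also have "\<dots> \<le> exp (- T\<^sup>2 / (2 * S\<^sup>2))"
  proof (rule std_normal_tail)
    show "s\<^sup>2 \<le> S\<^sup>2"
      unfolding power2_eq_square[of s] power2_eq_square[of S] ss using x y S by (intro mult_mono) (auto intro: sum_nonneg)
  qed (use S T in auto)
  finally show ?thesis .
qed

text \<open>Integer vectors of norm at most \<open>5 sqrt N\<close>; after division by 4 they serve as a net of the ball of radius \<open>sqrt N\<close>.\<close>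

definition lattice_net :: "nat \<Rightarrow> (nat \<Rightarrow> int) set" where
  "lattice_net N = {n \<in> PiE {1..N} (\<lambda>_. {- int (25 * N)..int (25 * N)}). (\<Sum>i=1..N. (n i)\<^sup>2) \<le> int (25 * N)}"

lemma finite_lattice_net: "finite (lattice_net N)"
  unfolding lattice_net_def by (rule finite_subset[of _ "PiE {1..N} (\<lambda>_. {- int (25 * N)..int (25 * N)})"]) (auto intro: finite_PiE)

lemma sum_half_power_abs: "(\<Sum>k\<in>{- int M..int M}. (1/2::real) ^ nat \<bar>k\<bar>) \<le> 3"
proof -
  have "(\<Sum>k\<in>{- int M..int M}. (1/2::real) ^ nat \<bar>k\<bar>) = 3 - 2 * (1/2) ^ M"
  proof (induction M)
    case (Suc M)
    have "{- int (Suc M)..int (Suc M)} = Set.insert (- int (Suc M)) (Set.insert (int (Suc M)) {- int M..int M})" by auto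
    then show ?case using Suc by (simp add: nat_abs_int_diff nat_add_distrib)
  qed simp
  then show ?thesis by simp
qed

lemma abs_le_square_int: "\<bar>k\<bar> \<le> (k::int)\<^sup>2"
proof (cases "k = 0")
  case False
  then have "\<bar>k\<bar> * 1 \<le> \<bar>k\<bar> * \<bar>k\<bar>" by (intro mult_left_mono) auto
  then show ?thesis by (simp add: power2_eq_square)
qed simp

text \<open>For integers \<open>\<bar>k\<bar> \<le> k^2\<close>, so the absolute values of the
  entries of a net vector sum to at most \<open>25 * N\<close>. The weight
  \<open>2 ^ (25 * N)\<close> times the product of \<open>(1/2) ^ \<bar>n i\<bar>\<close> is
  therefore at least 1, and its sum over the whole box factorises into geometric sums bounded by
  3.\<close>

lemma card_lattice_net: "real (card (lattice_net N)) \<le> (3 * 2 ^ 25) ^ N"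
proof -
  let ?P = "PiE {1..N} (\<lambda>_. {- int (25 * N)..int (25 * N)})"
  have "real (card (lattice_net N)) = (\<Sum>n\<in>lattice_net N. 1)" by simp
  also have "\<dots> \<le> (\<Sum>n\<in>lattice_net N. 2 ^ (25 * N) * (\<Prod>i=1..N. (1/2) ^ nat \<bar>n i\<bar>))"
  proof (rule sum_mono)
    fix n assume n: "n \<in> lattice_net N"
    have "(\<Sum>i=1..N. \<bar>n i\<bar>) \<le> (\<Sum>i=1..N. (n i)\<^sup>2)" by (intro sum_mono abs_le_square_int)
    then have le: "(\<Sum>i=1..N. \<bar>n i\<bar>) \<le> int (25 * N)" using n by (auto simp: lattice_net_def)
    have "int (\<Sum>i=1..N. nat \<bar>n i\<bar>) = (\<Sum>i=1..N. \<bar>n i\<bar>)" by simp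
    then have le': "(\<Sum>i=1..N. nat \<bar>n i\<bar>) \<le> 25 * N" using le by linarith
    have "(1::real) = 2 ^ (25 * N) * (1/2) ^ (25 * N)" by (simp add: power_mult_distrib[symmetric])
    also have "\<dots> \<le> 2 ^ (25 * N) * (1/2) ^ (\<Sum>i=1..N. nat \<bar>n i\<bar>)"
      using power_decreasing[OF le', of "1/2::real"] by (intro mult_left_mono) auto
    finally show "(1::real) \<le> 2 ^ (25 * N) * (\<Prod>i=1..N. (1/2) ^ nat \<bar>n i\<bar>)" by (simp add: power_sum)
  qed
  also have "\<dots> \<le> (\<Sum>n\<in>?P. 2 ^ (25 * N) * (\<Prod>i=1..N. (1/2) ^ nat \<bar>n i\<bar>))"
    by (rule sum_mono2) (auto simp: lattice_net_def intro!: finite_PiE prod_nonneg mult_nonneg_nonneg)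
  also have "\<dots> = 2 ^ (25 * N) * (\<Prod>i=1..N. \<Sum>k\<in>{- int (25 * N)..int (25 * N)}. (1/2) ^ nat \<bar>k\<bar>)"
    by (subst prod_sum_PiE) (auto simp: sum_distrib_left)
  also have "\<dots> \<le> 2 ^ (25 * N) * (\<Prod>i=1..N. 3)"
    by (intro mult_left_mono prod_mono conjI sum_half_power_abs sum_nonneg) auto
  also have "\<dots> = (2 ^ 25) ^ N * 3 ^ N" by (simp only: power_mult prod_constant card_atLeastAtMost diff_Suc_1)
  also have "\<dots> = (3 * 2 ^ 25) ^ N" by (simp only: power_mult_distrib mult.commute)
  finally show ?thesis .
qed

text \<open>Rounding \<open>4 * x\<close> down coordinatewise leaves a remainder with entries in
  \<open>[0, 1)\<close>, hence again a vector of the ball of radius \<open>sqrt N\<close>.\<close>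

lemma lattice_approx:
  assumes x: "(\<Sum>i=1..N. (x i)\<^sup>2) \<le> real N"
  obtains n r where "n \<in> lattice_net N" "(\<Sum>i=1..N. (real_of_int (n i))\<^sup>2) \<le> 25 * real N" "(\<Sum>i=1..N. (r i)\<^sup>2) \<le> real N"
    "\<And>i. i \<in> {1..N} \<Longrightarrow> 4 * x i = real_of_int (n i) + r i"
proof -
  define n where "n = restrict (\<lambda>i. \<lfloor>4 * x i\<rfloor>) {1..N}"
  define r where "r i = 4 * x i - real_of_int (n i)" for i
  have r01: "0 \<le> r i \<and> r i < 1" if "i \<in> {1..N}" for i using that unfolding r_def n_def by simp linarith
  have rs: "(\<Sum>i=1..N. (r i)\<^sup>2) \<le> real N"
  proof -
    have "(\<Sum>i=1..N. (r i)\<^sup>2) \<le> (\<Sum>i=1..N. 1)"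
      using power_le_one[OF conjunct1[OF r01] less_imp_le[OF conjunct2[OF r01]]] by (rule sum_mono)
    then show ?thesis by simp
  qed
  have ns: "(\<Sum>i=1..N. (real_of_int (n i))\<^sup>2) \<le> 25 * real N"
  proof -
    have "(real_of_int (n i))\<^sup>2 \<le> 20 * (x i)\<^sup>2 + 5 * (r i)\<^sup>2" for i
    proof -
      \<comment> \<open>Young's inequality for \<open>n = 4 * x - r\<close>, tuned so that the two
        contributions sum to \<open>20 + 5 = 25\<close>.\<close>
      have "0 \<le> (2 * x i + 2 * r i)\<^sup>2" by simp
      then show ?thesis unfolding r_def by (simp add: power2_eq_square algebra_simps)
    qed
    then have "(\<Sum>i=1..N. (real_of_int (n i))\<^sup>2) \<le> (\<Sum>i=1..N. 20 * (x i)\<^sup>2 + 5 * (r i)\<^sup>2)" by (intro sum_mono)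
    also have "\<dots> = 20 * (\<Sum>i=1..N. (x i)\<^sup>2) + 5 * (\<Sum>i=1..N. (r i)\<^sup>2)" by (simp add: sum.distrib sum_distrib_left)
    finally show ?thesis using rs x by linarith
  qed
  have "real_of_int (\<Sum>i=1..N. (n i)\<^sup>2) \<le> real_of_int (int (25 * N))" using ns by simp
  then have nsi: "(\<Sum>i=1..N. (n i)\<^sup>2) \<le> int (25 * N)" by (rule of_int_le_iff[THEN iffD1])
  have "\<bar>n i\<bar> \<le> int (25 * N)" if "i \<in> {1..N}" for i
  proof -
    have "\<bar>n i\<bar> \<le> (n i)\<^sup>2" by (rule abs_le_square_int)
    also have "\<dots> \<le> (\<Sum>i=1..N. (n i)\<^sup>2)" by (rule member_le_sum[OF that]) auto
    finally show ?thesis using nsi by simp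
  qed
  then have "n \<in> lattice_net N"
    using nsi by (auto simp: lattice_net_def PiE_def Pi_def n_def abs_le_iff minus_le_iff)
  moreover have "4 * x i = real_of_int (n i) + r i" for i by (simp add: r_def)
  ultimately show ?thesis using ns rs by (intro that)
qed

section \<open>The normalised norm and inner product\<close>

lemma nnorm_L2: "nnorm N x = L2_set x {1..N} / sqrt (real N)"
  by (simp add: nnorm_def nip_def L2_set_def real_sqrt_divide power2_eq_square)

lemma nnorm_nonneg[simp]: "0 \<le> nnorm N x" by (simp add: nnorm_L2)

lemma nnorm_triangle: "nnorm N (\<lambda>i. x i + y i) \<le> nnorm N x + nnorm N y"
  using L2_set_triangle_ineq[of x y "{1..N}"] unfolding nnorm_L2 add_divide_distrib[symmetric]
  by (intro divide_right_mono) auto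

lemma nnorm_scale: "nnorm N (\<lambda>i. c * x i) = \<bar>c\<bar> * nnorm N x"
proof -
  have "nip N (\<lambda>i. c * x i) (\<lambda>i. c * x i) = c\<^sup>2 * nip N x x"
    by (simp add: nip_def sum_distrib_left mult_ac power2_eq_square)
  then show ?thesis by (simp add: nnorm_def real_sqrt_mult)
qed

lemma nip_self: "nip N x x = (nnorm N x)\<^sup>2"
  by (simp add: nnorm_def nip_def sum_nonneg)

lemma nnorm_diff_triangle: "nnorm N (\<lambda>i. x i - y i) \<le> nnorm N x + nnorm N y"
  using nnorm_triangle[of N x "\<lambda>i. (-1) * y i"] nnorm_scale[of N "-1" y] by simp

lemma nip_cauchy: "\<bar>nip N x y\<bar> \<le> nnorm N x * nnorm N y"
proof -
  have "\<bar>\<Sum>i=1..N. x i * y i\<bar> \<le> (\<Sum>i=1..N. \<bar>x i\<bar> * \<bar>y i\<bar>)" by (rule order_trans[OF sum_abs]) (simp add: abs_mult)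
  also have "\<dots> \<le> L2_set x {1..N} * L2_set y {1..N}" by (rule L2_set_mult_ineq)
  finally have "\<bar>\<Sum>i=1..N. x i * y i\<bar> / real N \<le> L2_set x {1..N} * L2_set y {1..N} / real N" by (rule divide_right_mono) simp
  then show ?thesis by (simp add: nip_def nnorm_L2)
qed

lemma nip_commute: "nip N x y = nip N y x" by (simp add: nip_def mult.commute)

lemma nip_add: "nip N (\<lambda>i. x i + y i) z = nip N x z + nip N y z" "nip N z (\<lambda>i. x i + y i) = nip N z x + nip N z y"
  by (simp_all add: nip_def sum.distrib algebra_simps)

lemma nip_diff: "nip N (\<lambda>i. x i - y i) z = nip N x z - nip N y z" "nip N z (\<lambda>i. x i - y i) = nip N z x - nip N z y"
  by (simp_all add: nip_def sum_subtractf algebra_simps)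

lemma nip_scale: "nip N (\<lambda>i. c * x i) z = c * nip N x z" "nip N z (\<lambda>i. c * x i) = c * nip N z x"
  by (simp_all add: nip_def sum_distrib_left mult_ac)

lemma nip_sum: "nip N (\<lambda>i. \<Sum>r\<in>R. x r i) z = (\<Sum>r\<in>R. nip N (x r) z)" "nip N z (\<lambda>i. \<Sum>r\<in>R. x r i) = (\<Sum>r\<in>R. nip N z (x r))"
proof -
  show "nip N (\<lambda>i. \<Sum>r\<in>R. x r i) z = (\<Sum>r\<in>R. nip N (x r) z)"
    unfolding nip_def sum_distrib_right sum_distrib_left by (rule sum.swap)
  show "nip N z (\<lambda>i. \<Sum>r\<in>R. x r i) = (\<Sum>r\<in>R. nip N z (x r))"
    unfolding nip_def sum_distrib_left by (rule sum.swap)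
qed

lemma nip_cong: "(\<And>i. i \<in> {1..N} \<Longrightarrow> x i = x' i) \<Longrightarrow> (\<And>i. i \<in> {1..N} \<Longrightarrow> y i = y' i) \<Longrightarrow> nip N x y = nip N x' y'"
  by (simp add: nip_def)

lemma nnorm_cong: "(\<And>i. i \<in> {1..N} \<Longrightarrow> x i = x' i) \<Longrightarrow> nnorm N x = nnorm N x'"
  by (simp add: nnorm_def nip_def)

lemma nnorm_mono: "(\<And>i. i \<in> {1..N} \<Longrightarrow> \<bar>x i\<bar> \<le> \<bar>y i\<bar>) \<Longrightarrow> nnorm N x \<le> nnorm N y"
  unfolding nnorm_def nip_def
  by (intro real_sqrt_le_mono mult_left_mono sum_mono) (auto simp: abs_le_square_iff power2_eq_square[symmetric])

lemma nnorm_le_1: "(\<And>i. i \<in> {1..N} \<Longrightarrow> \<bar>x i\<bar> \<le> 1) \<Longrightarrow> nnorm N x \<le> 1"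
proof -
  assume x: "\<And>i. i \<in> {1..N} \<Longrightarrow> \<bar>x i\<bar> \<le> 1"
  have "nnorm N x \<le> nnorm N (\<lambda>_. 1)" by (rule nnorm_mono) (use x in auto)
  also have "\<dots> \<le> 1" by (simp add: nnorm_def nip_def)
  finally show ?thesis .
qed

text \<open>Let \<open>\<kappa>\<close> be the supremum over the ball of radius
  \<open>sqrt N\<close>, and split \<open>4 * x = n + r\<close> and \<open>4 * y = m + s\<close>.
  The pair \<open>n, m\<close> costs \<open>T\<close>, the pair \<open>n, s\<close> costs
  \<open>5 * \<kappa>\<close> since \<open>n\<close> has length at most \<open>5 * sqrt N\<close>,
  and the pair \<open>r, 4 * y\<close> costs \<open>4 * \<kappa>\<close>. Thus
  \<open>16 * \<kappa> \<le> T + 9 * \<kappa>\<close>.\<close>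

lemma bform_bound_of_net:
  assumes net: "\<And>n m. n \<in> lattice_net N \<Longrightarrow> m \<in> lattice_net N \<Longrightarrow> bform N (\<lambda>i. real_of_int (n i)) (\<lambda>i. real_of_int (m i)) W \<le> T"
    and x: "(\<Sum>i=1..N. (x i)\<^sup>2) \<le> real N" and y: "(\<Sum>i=1..N. (y i)\<^sup>2) \<le> real N"
  shows "bform N x y W \<le> T / 7"
proof -
  define S where "S = {bform N x y W |x y. (\<Sum>i=1..N. (x i)\<^sup>2) \<le> real N \<and> (\<Sum>i=1..N. (y i)\<^sup>2) \<le> real N}"
  \<comment> \<open>Without a finite supremum \<open>\<kappa>\<close> could not be absorbed into the
    left side below.\<close>
  have bdd: "bdd_above S"
  proof (rule bdd_aboveI)
    fix b assume "b \<in> S"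
    then obtain x y where b: "b = bform N x y W" and x: "(\<Sum>i=1..N. (x i)\<^sup>2) \<le> real N" and y: "(\<Sum>i=1..N. (y i)\<^sup>2) \<le> real N"
      by (auto simp: S_def)
    have c: "\<bar>z i\<bar> \<le> sqrt N" if "(\<Sum>i=1..N. (z i)\<^sup>2) \<le> real N" "i \<in> {1..N}" for z :: "nat \<Rightarrow> real" and i
    proof (rule real_le_rsqrt)
      have "(z i)\<^sup>2 \<le> (\<Sum>i=1..N. (z i)\<^sup>2)" by (rule member_le_sum[OF that(2)]) auto
      then show "\<bar>z i\<bar>\<^sup>2 \<le> real N" using that by simp
    qed
    have "b \<le> (\<Sum>i=1..N. \<Sum>j=1..N. sqrt N * sqrt N * \<bar>W (i, j)\<bar>)"
      unfolding b bform_def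
    proof (intro sum_mono)
      fix i j assume ij: "i \<in> {1..N}" "j \<in> {1..N}"
      have "x i * y j * W (i, j) \<le> \<bar>x i\<bar> * \<bar>y j\<bar> * \<bar>W (i, j)\<bar>" by (metis abs_ge_self abs_mult)
      also have "\<dots> \<le> sqrt N * sqrt N * \<bar>W (i, j)\<bar>" by (intro mult_right_mono mult_mono c[OF x] c[OF y] ij) auto
      finally show "x i * y j * W (i, j) \<le> sqrt N * sqrt N * \<bar>W (i, j)\<bar>" .
    qed
    then show "b \<le> (\<Sum>i=1..N. \<Sum>j=1..N. sqrt N * sqrt N * \<bar>W (i, j)\<bar>)" .
  qed
  define \<kappa> where "\<kappa> = Sup S"
  have up: "bform N x y W \<le> \<kappa>" if "(\<Sum>i=1..N. (x i)\<^sup>2) \<le> real N" "(\<Sum>i=1..N. (y i)\<^sup>2) \<le> real N" for x y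
    unfolding \<kappa>_def by (rule cSup_upper[OF _ bdd]) (use that in \<open>auto simp: S_def\<close>)
  have "0 \<in> S" unfolding S_def by (rule CollectI, intro exI[of _ "\<lambda>_. 0"]) (auto simp: bform_def)
  then have ne: "S \<noteq> {}" by auto
  have "\<kappa> \<le> (T + 9 * \<kappa>) / 16"
    unfolding \<kappa>_def
  proof (rule cSup_least[OF ne], fold \<kappa>_def)
    fix b assume "b \<in> S"
    then obtain x y where b: "b = bform N x y W" and x: "(\<Sum>i=1..N. (x i)\<^sup>2) \<le> real N" and y: "(\<Sum>i=1..N. (y i)\<^sup>2) \<le> real N"
      by (auto simp: S_def)
    obtain n r where n: "n \<in> lattice_net N" "(\<Sum>i=1..N. (real_of_int (n i))\<^sup>2) \<le> 25 * real N" "(\<Sum>i=1..N. (r i)\<^sup>2) \<le> real N"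
      "\<And>i. i \<in> {1..N} \<Longrightarrow> 4 * x i = real_of_int (n i) + r i" by (rule lattice_approx[OF x]) blast
    obtain m s where m: "m \<in> lattice_net N" "(\<Sum>i=1..N. (real_of_int (m i))\<^sup>2) \<le> 25 * real N" "(\<Sum>i=1..N. (s i)\<^sup>2) \<le> real N"
      "\<And>i. i \<in> {1..N} \<Longrightarrow> 4 * y i = real_of_int (m i) + s i" by (rule lattice_approx[OF y]) blast
    let ?n = "\<lambda>i. real_of_int (n i)" and ?m = "\<lambda>i. real_of_int (m i)"
    have "bform N ?n s W = 5 * bform N (\<lambda>i. 1/5 * ?n i) s W" by (simp only: bform_scale)
    also have "\<dots> \<le> 5 * \<kappa>"
    proof -
      have "(\<Sum>i=1..N. (1/5 * ?n i)\<^sup>2) = 1/25 * (\<Sum>i=1..N. (?n i)\<^sup>2)" by (simp add: sum_distrib_left power_mult_distrib power_divide)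
      then have "(\<Sum>i=1..N. (1/5 * ?n i)\<^sup>2) \<le> real N" using n(2) by simp
      then show ?thesis using up[OF _ m(3), of "\<lambda>i. 1/5 * ?n i"] by simp
    qed
    finally have 1: "bform N ?n s W \<le> 5 * \<kappa>" .
    have "bform N r (\<lambda>i. 4 * y i) W = 4 * bform N r y W" by (simp only: bform_scale)
    also have "\<dots> \<le> 4 * \<kappa>" using up[OF n(3) y] by simp
    finally have 2: "bform N r (\<lambda>i. 4 * y i) W \<le> 4 * \<kappa>" .
    have cx: "bform N (\<lambda>i. 4 * x i) z W = bform N (\<lambda>i. ?n i + r i) z W" for z
      unfolding bform_def by (intro sum.cong refl) (simp add: n(4))
    have cy: "bform N ?n (\<lambda>i. 4 * y i) W = bform N ?n (\<lambda>i. ?m i + s i) W"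
      unfolding bform_def by (intro sum.cong refl) (simp add: m(4))
    have "16 * b = bform N (\<lambda>i. 4 * x i) (\<lambda>i. 4 * y i) W" unfolding b by (simp add: bform_scale)
    also have "\<dots> = bform N ?n ?m W + bform N ?n s W + bform N r (\<lambda>i. 4 * y i) W"
      unfolding cx bform_add(1) cy bform_add(2) ..
    also have "\<dots> \<le> T + 5 * \<kappa> + 4 * \<kappa>" using net[OF n(1) m(1)] 1 2 by linarith
    finally show "b \<le> (T + 9 * \<kappa>) / 16" by simp
  qed
  then have "\<kappa> \<le> T / 7" by simp
  then show ?thesis using up[OF x y] by simp
qed

lemma bform_bound_scaled:
  assumes net: "\<And>n m. n \<in> lattice_net N \<Longrightarrow> m \<in> lattice_net N \<Longrightarrow> bform N (\<lambda>i. real_of_int (n i)) (\<lambda>i. real_of_int (m i)) W \<le> T"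
  shows "bform N x y W \<le> T / 7 * (nnorm N x * nnorm N y)"
proof (cases "nnorm N x = 0 \<or> nnorm N y = 0")
  case True
  have z: "N = 0 \<or> (\<forall>i\<in>{1..N}. z i = 0)" if "nnorm N z = 0" for z :: "nat \<Rightarrow> real"
    using that by (auto simp: nnorm_L2 L2_set_eq_0_iff)
  have "bform N x y W = 0" using True z[of x] z[of y] by (auto simp: bform_def)
  then show ?thesis using True by auto
next
  case False
  then have pos: "nnorm N x > 0" "nnorm N y > 0" using nnorm_nonneg less_le by metis+
  have N: "N > 0" using pos by (auto simp: nnorm_L2 intro: Nat.gr0I)
  have s: "(\<Sum>i=1..N. (1 / nnorm N z * z i)\<^sup>2) \<le> real N" if "nnorm N z > 0" for z
  proof -
    have "(\<Sum>i=1..N. (1 / nnorm N z * z i)\<^sup>2) = real N * nip N (\<lambda>i. 1 / nnorm N z * z i) (\<lambda>i. 1 / nnorm N z * z i)"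
      using N by (simp add: nip_def power2_eq_square)
    also have "\<dots> = real N" unfolding nip_self nnorm_scale using that by simp
    finally show ?thesis by simp
  qed
  have "bform N (\<lambda>i. 1 / nnorm N x * x i) (\<lambda>i. 1 / nnorm N y * y i) W \<le> T / 7"
    by (rule bform_bound_of_net[OF net s[OF pos(1)] s[OF pos(2)]])
  then have "1 / nnorm N x * (1 / nnorm N y * bform N x y W) \<le> T / 7" by (simp only: bform_scale)
  then show ?thesis using pos by (simp add: field_simps)
qed

text \<open>The bound is \<open>K sqrt N\<close> for the operator norm; the factor \<open>N\<close> undoes the normalisation of \<open>nnorm\<close>.\<close>

lemma operator_norm_bound:
  obtains K where "K > 0" "eventually (\<lambda>p. \<forall>x y. bform (fst p) x y (snd p)
      \<le> K * sqrt (real (fst p)) * real (fst p) * (nnorm (fst p) x * nnorm (fst p) y)) (prob_filter iid_normal)"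
proof -
  \<comment> \<open>\<open>D ^ N\<close> bounds the number of pairs of net vectors, and
    \<open>1250 = 2 * 25^2\<close> is the variance constant of the tail bound on the net. With this
    \<open>t\<close> one pair costs \<open>(1 / (2 * D)) ^ N\<close>, so the union bound leaves
    \<open>(1 / 2) ^ N\<close>.\<close>
  define D :: real where "D = (3 * 2 ^ 25)\<^sup>2"
  define t where "t = sqrt (1250 * ln (2 * D))"
  have D: "D \<ge> 1" unfolding D_def by simp
  have t: "t > 0" "t\<^sup>2 = 1250 * ln (2 * D)" using D by (auto simp: t_def)
  have et: "exp (- t\<^sup>2 / 1250) * D = 1 / 2" using D t by (simp add: exp_minus field_simps)
  define A where "A N n m = {W :: nat \<times> nat \<Rightarrow> real. t * sqrt N * N \<le> bform N (\<lambda>i. real_of_int (n i)) (\<lambda>i. real_of_int (m i)) W}"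
    for N and n m :: "nat \<Rightarrow> int"
  have As: "A N n m \<in> sets iid_normal" for N n m
  proof -
    have "{W \<in> space iid_normal. t * sqrt N * N \<le> bform N (\<lambda>i. real_of_int (n i)) (\<lambda>i. real_of_int (m i)) W} \<in> sets iid_normal" by measurable
    then show ?thesis by (simp add: A_def)
  qed
  define E where "E N = (\<Union>p\<in>lattice_net N \<times> lattice_net N. A N (fst p) (snd p))" for N
  have fin: "finite (lattice_net N \<times> lattice_net N)" for N using finite_lattice_net by simp
  have "eventually (\<lambda>p. \<forall>x y. bform (fst p) x y (snd p)
      \<le> (t / 7) * sqrt (real (fst p)) * real (fst p) * (nnorm (fst p) x * nnorm (fst p) y)) (prob_filter (iid_normal :: (nat \<times> nat \<Rightarrow> real) measure))"
  proof (rule iid.eventually_prob_filterI[where E=E])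
    show "E N \<in> sets iid_normal" for N unfolding E_def by (intro sets.finite_UN fin As)
    show "\<forall>x y. bform (fst (N, W)) x y (snd (N, W))
      \<le> (t / 7) * sqrt (real (fst (N, W))) * real (fst (N, W)) * (nnorm (fst (N, W)) x * nnorm (fst (N, W)) y)"
      if "W \<notin> E N" for N W
    proof (intro allI)
      fix x y
      have "bform N x y W \<le> (t * sqrt N * N) / 7 * (nnorm N x * nnorm N y)"
        by (rule bform_bound_scaled) (use that in \<open>force simp: E_def A_def\<close>)
      then show "bform (fst (N, W)) x y (snd (N, W))
      \<le> (t / 7) * sqrt (real (fst (N, W))) * real (fst (N, W)) * (nnorm (fst (N, W)) x * nnorm (fst (N, W)) y)" by simp
    qed
    have bound: "measure iid_normal (E N) \<le> (1 / 2) ^ N" if N: "N \<ge> 1" for N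
    proof -
      have one: "measure iid_normal (A N n m) \<le> exp (- t\<^sup>2 / 1250) ^ N" if nm: "n \<in> lattice_net N" "m \<in> lattice_net N" for n m
      proof -
        have l: "(\<Sum>i=1..N. (real_of_int (n i))\<^sup>2) \<le> 25 * real N" if "n \<in> lattice_net N" for n
        proof -
          have "(\<Sum>i=1..N. (n i)\<^sup>2) \<le> int (25 * N)" using that by (simp add: lattice_net_def)
          then have "real_of_int (\<Sum>i=1..N. (n i)\<^sup>2) \<le> real_of_int (int (25 * N))" by (rule of_int_le_iff[THEN iffD2])
          then show ?thesis by simp
        qed
        have "measure iid_normal (A N n m) \<le> exp (- (t * sqrt N * N)\<^sup>2 / (2 * (25 * real N)\<^sup>2))"
          unfolding A_def by (rule bform_tail[OF l[OF nm(1)] l[OF nm(2)]]) (use N t in auto)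
        also have "- (t * sqrt N * N)\<^sup>2 / (2 * (25 * real N)\<^sup>2) = real N * (- t\<^sup>2 / 1250)"
          using N by (simp add: power_mult_distrib field_simps)
        also have "exp \<dots> = exp (- t\<^sup>2 / 1250) ^ N" by (rule exp_of_nat_mult)
        finally show ?thesis .
      qed
      have "measure iid_normal (E N) \<le> (\<Sum>p\<in>lattice_net N \<times> lattice_net N. measure iid_normal (A N (fst p) (snd p)))"
        unfolding E_def by (rule iid.finite_measure_subadditive_finite) (use fin As in auto)
      also have "\<dots> \<le> (\<Sum>p\<in>lattice_net N \<times> lattice_net N. exp (- t\<^sup>2 / 1250) ^ N)"
        by (rule sum_mono) (use one in auto)
      also have "\<dots> = (real (card (lattice_net N)))\<^sup>2 * exp (- t\<^sup>2 / 1250) ^ N" by (simp add: power2_eq_square card_cartesian_product)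
      also have "\<dots> \<le> ((3 * 2 ^ 25) ^ N)\<^sup>2 * exp (- t\<^sup>2 / 1250) ^ N"
        by (intro mult_right_mono power_mono card_lattice_net) auto
      also have "\<dots> = (exp (- t\<^sup>2 / 1250) * D) ^ N"
      proof -
        have "(c ^ N)\<^sup>2 = (c\<^sup>2) ^ N" for c :: real by (simp only: power_mult[symmetric] mult.commute)
        then show ?thesis unfolding D_def power_mult_distrib[of "exp _"] by simp
      qed
      finally show ?thesis unfolding et .
    qed
    show "(\<lambda>N. measure iid_normal (E N)) \<longlonglongrightarrow> 0"
    proof (rule tendsto_sandwich[OF _ _ tendsto_const])
      show "(\<lambda>N. (1 / 2 :: real) ^ N) \<longlonglongrightarrow> 0" by (rule LIMSEQ_power_zero) simp
      show "\<forall>\<^sub>F N in sequentially. measure iid_normal (E N) \<le> (1 / 2) ^ N"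
        using eventually_ge_at_top[of 1] by eventually_elim (rule bound)
    qed auto
  qed
  then show ?thesis using t by (intro that[of "t / 7"]) auto
qed

section \<open>Resampling a symmetric Gaussian matrix\<close>

text \<open>Entries outside \<open>{1..N}\<close> are zero, so that no range conditions are needed below.\<close>

definition unit_entry :: "nat \<Rightarrow> nat \<Rightarrow> nat \<Rightarrow> real" where
  "unit_entry N i k = (if i \<in> {1..N} \<and> i = k then 1 else 0)"

definition proj_entry :: "nat \<Rightarrow> (nat \<Rightarrow> real) \<Rightarrow> nat \<Rightarrow> nat \<Rightarrow> real" where
  "proj_entry N \<phi> i k = (if i \<in> {1..N} then (if i = k then 1 else 0) - \<phi> i * \<phi> k / real N else 0)"

definition dir_entry :: "nat \<Rightarrow> (nat \<Rightarrow> real) \<Rightarrow> nat \<Rightarrow> real" where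
  "dir_entry N \<phi> i = (if i \<in> {1..N} then \<phi> i / sqrt (real N) else 0)"

text \<open>The GOE before division by \<open>sqrt N\<close>: variance 1 off the diagonal and 2 on
  it, the ratio that makes the law invariant under rotations.\<close>

definition sym_mat :: "nat \<Rightarrow> (nat \<times> nat \<Rightarrow> real) \<Rightarrow> nat \<times> nat \<Rightarrow> real" where
  "sym_mat N W a = (if fst a \<in> {1..N} \<and> snd a \<in> {1..N} then (W a + W (snd a, fst a)) / sqrt 2 else 0)"

definition sandwich :: "nat \<Rightarrow> (nat \<Rightarrow> nat \<Rightarrow> real) \<Rightarrow> (nat \<times> nat \<Rightarrow> real) \<Rightarrow> nat \<times> nat \<Rightarrow> real" where
  "sandwich N P S a = (\<Sum>p\<in>{1..N} \<times> {1..N}. P (fst a) (fst p) * P (snd a) (snd p) * S p)"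

text \<open>Resampling a symmetric Gaussian matrix in the direction \<open>u = \<phi> / sqrt N\<close>: with \<open>P = 1 - u u\<^sup>T\<close>, the matrix
  \<open>P S P + (P z) u\<^sup>T + u (P z)\<^sup>T + sqrt 2 (u\<^sup>T z) u u\<^sup>T\<close> has the law of \<open>S\<close> if \<open>z\<close> is an independent standard Gaussian vector.\<close>

definition border :: "nat \<Rightarrow> (nat \<Rightarrow> real) \<Rightarrow> nat \<times> nat \<Rightarrow> nat \<Rightarrow> real" where
  "border N \<phi> a k = proj_entry N \<phi> (fst a) k * dir_entry N \<phi> (snd a) + dir_entry N \<phi> (fst a) * proj_entry N \<phi> (snd a) k
      + sqrt 2 * dir_entry N \<phi> k * dir_entry N \<phi> (fst a) * dir_entry N \<phi> (snd a)"

definition resample_dir :: "nat \<Rightarrow> (nat \<Rightarrow> real) \<Rightarrow> (nat \<Rightarrow> real) \<Rightarrow> (nat \<times> nat \<Rightarrow> real) \<Rightarrow> nat \<times> nat \<Rightarrow> real" where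
  "resample_dir N \<phi> z S a = sandwich N (proj_entry N \<phi>) S a + (\<Sum>k=1..N. border N \<phi> a k * z k)"

text \<open>The covariance sees \<open>P\<close> only through the Gram matrix \<open>G\<close> of
  its rows. One computation serves both the GOE itself (identity in place of \<open>P\<close>) and
  the part left over by a projection.\<close>

lemma gaussian_family_sandwich:
  fixes N :: nat and P :: "nat \<Rightarrow> nat \<Rightarrow> real"
  defines "G \<equiv> \<lambda>i k. \<Sum>p=1..N. P i p * P k p"
  shows "gaussian_family iid_normal (\<lambda>a W. sandwich N P (sym_mat N W) a)
      (\<lambda>a b. G (fst a) (fst b) * G (snd a) (snd b) + G (fst a) (snd b) * G (snd a) (fst b))"
proof (rule gaussian_family_cong)
  let ?R = "{1..N} \<times> {1..N}"
  let ?c = "\<lambda>a p. (P (fst a) (fst p) * P (snd a) (snd p) + P (snd a) (fst p) * P (fst a) (snd p)) / sqrt 2"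
  show "gaussian_family iid_normal (\<lambda>a W. \<Sum>p\<in>?R. ?c a p * W p)
     (\<lambda>a b. \<Sum>p\<in>?R. \<Sum>r\<in>?R. ?c a p * ?c b r * (if p = r then 1 else 0))"
    by (rule gaussian_family_linear[OF gaussian_family_iid_normal]) simp
  show "(\<Sum>p\<in>?R. ?c a p * W p) = sandwich N P (sym_mat N W) a" for a W
  proof -
    have "sandwich N P (sym_mat N W) a = (\<Sum>i=1..N. \<Sum>j=1..N. P (fst a) i * P (snd a) j * (W (i, j) + W (j, i)) / sqrt 2)"
      by (auto simp: sandwich_def sym_mat_def sum.cartesian_product intro!: sum.cong)
    also have "\<dots> = (\<Sum>i=1..N. \<Sum>j=1..N. P (fst a) i * P (snd a) j * W (i, j) / sqrt 2) + (\<Sum>i=1..N. \<Sum>j=1..N. P (fst a) i * P (snd a) j * W (j, i) / sqrt 2)"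
      by (simp add: sum.distrib[symmetric] distrib_left add_divide_distrib)
    also have "(\<Sum>i=1..N. \<Sum>j=1..N. P (fst a) i * P (snd a) j * W (j, i) / sqrt 2) = (\<Sum>i=1..N. \<Sum>j=1..N. P (fst a) j * P (snd a) i * W (i, j) / sqrt 2)"
      by (rule sum.swap)
    also have "(\<Sum>i=1..N. \<Sum>j=1..N. P (fst a) i * P (snd a) j * W (i, j) / sqrt 2) + \<dots> = (\<Sum>i=1..N. \<Sum>j=1..N. ?c a (i, j) * W (i, j))"
      unfolding sum.distrib[symmetric] by (intro sum.cong refl) (simp add: field_simps)
    finally show ?thesis by (simp add: sum.cartesian_product case_prod_beta)
  qed
  show "(\<Sum>p\<in>?R. \<Sum>r\<in>?R. ?c a p * ?c b r * (if p = r then 1 else 0))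
     = G (fst a) (fst b) * G (snd a) (snd b) + G (fst a) (snd b) * G (snd a) (fst b)" for a b
  proof -
    have "(\<Sum>p\<in>?R. \<Sum>r\<in>?R. ?c a p * ?c b r * (if p = r then 1 else 0)) = (\<Sum>p\<in>?R. ?c a p * ?c b p)"
      by (rule sum.cong[OF refl]) (simp add: if_distrib[of "(*) _"] cong: if_cong)
    also have "\<dots> = (\<Sum>i=1..N. \<Sum>j=1..N. ?c a (i, j) * ?c b (i, j))"
      by (simp add: sum.cartesian_product case_prod_beta)
    also have "\<dots> = (\<Sum>i=1..N. \<Sum>j=1..N.
         ((P (fst a) i * P (fst b) i) * (P (snd a) j * P (snd b) j) + (P (fst a) i * P (snd b) i) * (P (snd a) j * P (fst b) j)
        + (P (snd a) i * P (fst b) i) * (P (fst a) j * P (snd b) j) + (P (snd a) i * P (snd b) i) * (P (fst a) j * P (fst b) j)) / 2)"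
      by (intro sum.cong refl) (simp add: field_simps)
    also have "\<dots> = (G (fst a) (fst b) * G (snd a) (snd b) + G (fst a) (snd b) * G (snd a) (fst b)
        + G (snd a) (fst b) * G (fst a) (snd b) + G (snd a) (snd b) * G (fst a) (fst b)) / 2"
      unfolding G_def sum_product by (simp add: sum.distrib sum_divide_distrib[symmetric])
    finally show ?thesis by simp
  qed
qed

lemma sum_unit: "(\<Sum>k=1..N. unit_entry N i k * x k) = (if i \<in> {1..N} then x i else 0)"
  by (auto simp: unit_entry_def if_distrib[of "\<lambda>x. x * _"] cong: if_cong)

lemma sandwich_unit: "sandwich N (unit_entry N) (sym_mat N W) a = sym_mat N W a"
proof -
  have "sandwich N (unit_entry N) (sym_mat N W) a = (\<Sum>i=1..N. \<Sum>j=1..N. unit_entry N (fst a) i * unit_entry N (snd a) j * sym_mat N W (i, j))"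
    by (simp add: sandwich_def sum.cartesian_product case_prod_beta)
  also have "\<dots> = (\<Sum>i=1..N. unit_entry N (fst a) i * (\<Sum>j=1..N. unit_entry N (snd a) j * sym_mat N W (i, j)))"
    by (simp add: sum_distrib_left mult.assoc)
  also have "\<dots> = sym_mat N W a"
    unfolding sum_unit by (cases a) (auto simp: sym_mat_def)
  finally show ?thesis .
qed

lemma gaussian_family_sym_mat:
  "gaussian_family iid_normal (\<lambda>a W. sym_mat N W a)
      (\<lambda>a b. unit_entry N (fst a) (fst b) * unit_entry N (snd a) (snd b) + unit_entry N (fst a) (snd b) * unit_entry N (snd a) (fst b))"
proof (rule gaussian_family_cong[OF gaussian_family_sandwich[of N "unit_entry N"]])
  have "(\<Sum>p=1..N. unit_entry N i p * unit_entry N k p) = unit_entry N i k" for i k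
    unfolding sum_unit by (auto simp: unit_entry_def)
  then show "(\<Sum>p=1..N. unit_entry N (fst a) p * unit_entry N (fst b) p) * (\<Sum>p=1..N. unit_entry N (snd a) p * unit_entry N (snd b) p) +
       (\<Sum>p=1..N. unit_entry N (fst a) p * unit_entry N (snd b) p) * (\<Sum>p=1..N. unit_entry N (snd a) p * unit_entry N (fst b) p)
    = unit_entry N (fst a) (fst b) * unit_entry N (snd a) (snd b) + unit_entry N (fst a) (snd b) * unit_entry N (snd a) (fst b)" for a b
    by simp
qed (simp add: sandwich_unit)

context
  fixes N :: nat and \<phi> :: "nat \<Rightarrow> real"
  assumes unit: "nip N \<phi> \<phi> = 0 \<or> nip N \<phi> \<phi> = 1"
begin

private abbreviation "u \<equiv> dir_entry N \<phi>"
private abbreviation "P \<equiv> proj_entry N \<phi>"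

text \<open>Multiplied by \<open>u i\<close>, the identity holds for unit vectors and for the zero
  vector alike. A zero direction arises when a Gram-Schmidt residual vanishes; resampling then
  leaves the matrix as it is.\<close>

lemma sum_dir_square: "(\<Sum>k=1..N. u k * u k) * u i = u i"
proof -
  have "(\<Sum>k=1..N. u k * u k) = (\<Sum>k=1..N. \<phi> k * \<phi> k / real N)" by (intro sum.cong) (auto simp: dir_entry_def)
  also have "\<dots> = nip N \<phi> \<phi>" by (simp add: nip_def sum_divide_distrib)
  finally have e: "(\<Sum>k=1..N. u k * u k) = nip N \<phi> \<phi>" .
  show ?thesis
  proof (cases "nip N \<phi> \<phi> = 0")
    case True
    then have "\<forall>k\<in>{1..N}. u k * u k = 0" using e sum_nonneg_eq_0_iff[of "{1..N}" "\<lambda>k. u k * u k"] by simp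
    then have "u i = 0" by (cases "i \<in> {1..N}") (auto simp: dir_entry_def)
    then show ?thesis by simp
  next
    case False
    then show ?thesis using e unit by simp
  qed
qed

lemma proj_alt: "k \<in> {1..N} \<Longrightarrow> P i k = unit_entry N i k - u i * u k"
  by (auto simp: proj_entry_def unit_entry_def dir_entry_def)

lemma sum_proj_dir: "(\<Sum>k=1..N. P i k * u k) = 0"
proof -
  have "(\<Sum>k=1..N. P i k * u k) = (\<Sum>k=1..N. unit_entry N i k * u k - (u k * u k) * u i)"
    by (intro sum.cong refl) (simp add: proj_alt algebra_simps)
  also have "\<dots> = u i - (\<Sum>k=1..N. u k * u k) * u i"
    by (simp only: sum_subtractf sum_unit sum_distrib_right[symmetric]) (simp add: dir_entry_def)
  finally show ?thesis using sum_dir_square by simp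
qed

lemma sum_proj_proj: "(\<Sum>k=1..N. P i k * P j k) = unit_entry N i j - u i * u j"
proof -
  have "(\<Sum>k=1..N. P i k * P j k) = (\<Sum>k=1..N. unit_entry N i k * P j k - u i * (P j k * u k))"
    by (intro sum.cong refl) (simp add: proj_alt[of _ i] algebra_simps)
  also have "\<dots> = (if i \<in> {1..N} then P j i else 0)"
    by (simp only: sum_subtractf sum_unit sum_distrib_left[symmetric] sum_proj_dir mult_zero_right diff_zero)
  also have "\<dots> = unit_entry N i j - u i * u j"
    by (auto simp: proj_alt unit_entry_def dir_entry_def)
  finally show ?thesis .
qed

text \<open>The mixed products contain \<open>P u = 0\<close>. The squared factor
  \<open>sqrt 2\<close> produces the last term, the variance 2 of a GOE matrix in a diagonal
  direction.\<close>

lemma sum_border_border: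
  "(\<Sum>k=1..N. border N \<phi> a k * border N \<phi> b k)
    = (unit_entry N (fst a) (fst b) - u (fst a) * u (fst b)) * (u (snd a) * u (snd b))
    + (unit_entry N (fst a) (snd b) - u (fst a) * u (snd b)) * (u (snd a) * u (fst b))
    + (unit_entry N (snd a) (fst b) - u (snd a) * u (fst b)) * (u (fst a) * u (snd b))
    + (unit_entry N (snd a) (snd b) - u (snd a) * u (snd b)) * (u (fst a) * u (fst b))
    + 2 * (u (fst a) * u (snd a) * u (fst b) * u (snd b))"
proof -
  obtain i j k' l where ab: "a = (i, j)" "b = (k', l)" by (cases a, cases b) auto
  have "(\<Sum>k=1..N. border N \<phi> a k * border N \<phi> b k) = (\<Sum>k=1..N.
     (P i k * P k' k) * (u j * u l) + (P i k * P l k) * (u j * u k') + (P j k * P k' k) * (u i * u l) + (P j k * P l k) * (u i * u k')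
     + (P i k * u k) * (sqrt 2 * u k' * u l * u j) + (P j k * u k) * (sqrt 2 * u k' * u l * u i)
     + (P k' k * u k) * (sqrt 2 * u i * u j * u l) + (P l k * u k) * (sqrt 2 * u i * u j * u k')
     + (u k * u k) * (2 * (u i * u j * u k' * u l)))"
    by (intro sum.cong refl) (simp add: border_def ab algebra_simps)
  also have "\<dots> = (unit_entry N i k' - u i * u k') * (u j * u l) + (unit_entry N i l - u i * u l) * (u j * u k')
     + (unit_entry N j k' - u j * u k') * (u i * u l) + (unit_entry N j l - u j * u l) * (u i * u k')
     + (\<Sum>k=1..N. u k * u k) * (2 * (u i * u j * u k' * u l))"
    by (simp only: sum.distrib sum_distrib_right[symmetric] sum_proj_proj sum_proj_dir mult_zero_left add_0_right)
  also have "(\<Sum>k=1..N. u k * u k) * (2 * (u i * u j * u k' * u l)) = ((\<Sum>k=1..N. u k * u k) * u i) * (2 * (u j * u k' * u l))"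
    by (simp add: mult_ac)
  also have "\<dots> = 2 * (u i * u j * u k' * u l)" unfolding sum_dir_square by simp
  finally show ?thesis unfolding ab by simp
qed

text \<open>The sandwich has the GOE covariance with \<open>1 - u u^T\<close> in place of the
  identity; the border supplies exactly the terms missing after multiplying out. The fresh vector is
  row \<open>l\<close> of an independent array.\<close>

lemma gaussian_family_resample_dir:
  fixes l :: nat
  shows
  "gaussian_family (iid_normal \<Otimes>\<^sub>M iid_normal) (\<lambda>a p. resample_dir N \<phi> (\<lambda>i. snd p (l, i)) (sym_mat N (fst p)) a)
      (\<lambda>a b. unit_entry N (fst a) (fst b) * unit_entry N (snd a) (snd b) + unit_entry N (fst a) (snd b) * unit_entry N (snd a) (fst b))"
proof -
  have b: "gaussian_family (iid_normal :: (nat \<times> nat \<Rightarrow> real) measure) (\<lambda>a z. \<Sum>k=1..N. border N \<phi> a k * z (l, k))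
     (\<lambda>a b. \<Sum>k=1..N. border N \<phi> a k * border N \<phi> b k)"
  proof (rule gaussian_family_cong)
    have "gaussian_family (iid_normal :: (nat \<times> nat \<Rightarrow> real) measure) (\<lambda>i z. z (l, i)) (\<lambda>i j. if i = j then 1 else 0)"
      using gaussian_family_reindex[OF gaussian_family_iid_normal, of "\<lambda>i. (l, i)"] by simp
    from gaussian_family_linear[OF this, of "\<lambda>_. {1..N}" "border N \<phi>"]
    show "gaussian_family (iid_normal :: (nat \<times> nat \<Rightarrow> real) measure) (\<lambda>a z. \<Sum>k=1..N. border N \<phi> a k * z (l, k))
     (\<lambda>a b. \<Sum>k=1..N. \<Sum>j=1..N. border N \<phi> a k * border N \<phi> b j * (if k = j then 1 else 0))" by simp
    show "(\<Sum>k=1..N. \<Sum>j=1..N. border N \<phi> a k * border N \<phi> b j * (if k = j then 1 else 0)) = (\<Sum>k=1..N. border N \<phi> a k * border N \<phi> b k)" for a b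
      by (rule sum.cong[OF refl]) (simp add: if_distrib[of "(*) _"] cong: if_cong)
  qed simp
  show ?thesis
    by (rule gaussian_family_cong[OF gaussian_family_add[OF gaussian_family_sandwich[of N P] b]])
       (simp add: resample_dir_def, simp only: sum_proj_proj sum_border_border, simp add: algebra_simps)
qed

lemma nn_integral_resample_dir:
  fixes l :: nat
  assumes F: "F \<in> borel_measurable (PiM UNIV (\<lambda>_. borel))"
  shows "(\<integral>\<^sup>+\<eta>. \<integral>\<^sup>+W. F (resample_dir N \<phi> (\<lambda>i. \<eta> (l, i)) (sym_mat N W)) \<partial>iid_normal \<partial>(iid_normal :: (nat \<times> nat \<Rightarrow> real) measure))
     = (\<integral>\<^sup>+W. F (sym_mat N W) \<partial>iid_normal)"
proof -
  note m = measurable_gaussian_family[OF gaussian_family_resample_dir]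
  have "(\<integral>\<^sup>+\<eta>. \<integral>\<^sup>+W. F (resample_dir N \<phi> (\<lambda>i. \<eta> (l, i)) (sym_mat N W)) \<partial>iid_normal \<partial>(iid_normal :: (nat \<times> nat \<Rightarrow> real) measure))
    = (\<integral>\<^sup>+p. F (\<lambda>a. resample_dir N \<phi> (\<lambda>i. snd p (l, i)) (sym_mat N (fst p)) a) \<partial>(iid_normal \<Otimes>\<^sub>M iid_normal))"
    using iid_pair.nn_integral_snd[OF measurable_compose[OF m F], of l] by simp
  also have "\<dots> = (\<integral>\<^sup>+W. F (\<lambda>a. sym_mat N W a) \<partial>iid_normal)"
    by (rule gaussian_family_nn_integral[OF gaussian_family_resample_dir gaussian_family_sym_mat F])
  finally show ?thesis by simp
qed

end

text \<open>Step 0 is the outermost one, and each further step resamples the innermost matrix. So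
  the last row enters only through the innermost matrix, and integrating it out removes the last
  step while the outer steps stay fixed.\<close>

primrec wrap :: "nat \<Rightarrow> (nat \<Rightarrow> nat \<Rightarrow> real) \<Rightarrow> (nat \<times> nat \<Rightarrow> real) \<Rightarrow> nat \<Rightarrow> (nat \<times> nat \<Rightarrow> real) \<Rightarrow> nat \<times> nat \<Rightarrow> real" where
  "wrap N \<phi> \<zeta> 0 S = S"
| "wrap N \<phi> \<zeta> (Suc j) S = wrap N \<phi> \<zeta> j (resample_dir N (\<phi> j) (\<lambda>i. \<zeta> (j, i)) S)"

lemma wrap_cong:
  assumes "\<And>l. l < j \<Longrightarrow> \<phi> l = \<phi>' l" "\<And>l i. l < j \<Longrightarrow> \<zeta> (l, i) = \<zeta>' (l, i)"
  shows "wrap N \<phi> \<zeta> j S = wrap N \<phi>' \<zeta>' j S"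
  using assms
proof (induction j arbitrary: S)
  case (Suc j)
  from Suc.prems have "\<phi> j = \<phi>' j" "\<zeta> (j, i) = \<zeta>' (j, i)" for i by auto
  moreover have "wrap N \<phi> \<zeta> j S = wrap N \<phi>' \<zeta>' j S" for S by (rule Suc.IH) (use Suc.prems in auto)
  ultimately show ?case by simp
qed simp

lemma measurable_matrix:
  assumes "\<And>a. (\<lambda>\<omega>. g \<omega> a) \<in> borel_measurable M"
  shows "g \<in> measurable M (PiM UNIV (\<lambda>_. borel :: real measure))"
  by (rule measurable_PiM_single') (use assms in auto)

lemma measurable_matrix_entry:
  assumes "g \<in> measurable M (PiM UNIV (\<lambda>_. borel :: real measure))"
  shows "(\<lambda>\<omega>. g \<omega> a) \<in> borel_measurable M"
  using measurable_compose[OF assms, of "\<lambda>x. x a" borel] by simp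

lemma measurable_wrap:
  assumes \<phi>: "\<And>j i. (\<lambda>\<omega>. \<phi> \<omega> j i) \<in> borel_measurable M" and \<zeta>: "\<And>p. (\<lambda>\<omega>. \<zeta> \<omega> p) \<in> borel_measurable M"
    and g: "g \<in> measurable M (PiM UNIV (\<lambda>_. borel))"
  shows "(\<lambda>\<omega>. wrap N (\<phi> \<omega>) (\<zeta> \<omega>) j (g \<omega>)) \<in> measurable M (PiM UNIV (\<lambda>_. borel))"
  using g
proof (induction j arbitrary: g)
  case (Suc j)
  note [measurable] = \<phi> \<zeta> measurable_matrix_entry[OF Suc.prems]
  have "(\<lambda>\<omega>. resample_dir N (\<phi> \<omega> j) (\<lambda>i. \<zeta> \<omega> (j, i)) (g \<omega>)) \<in> measurable M (PiM UNIV (\<lambda>_. borel))"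
    by (rule measurable_matrix) (simp add: resample_dir_def sandwich_def border_def proj_entry_def dir_entry_def)
  from Suc.IH[OF this] show ?case by simp
qed simp

lemma measurable_sym_mat[measurable]: "sym_mat N \<in> measurable iid_normal (PiM UNIV (\<lambda>_. borel))"
  by (rule measurable_matrix) (simp add: sym_mat_def)

text \<open>In the induction step, row \<open>j\<close> is redrawn with all other rows frozen. By
  \<open>dep\<close> the directions up to \<open>j\<close> do not change, so the innermost matrix is
  resampled in a deterministic direction and keeps the law of the GOE matrix.\<close>

lemma nn_integral_wrap:
  assumes \<phi>: "\<And>j i. (\<lambda>\<zeta>. \<phi> \<zeta> j i) \<in> borel_measurable (iid_normal :: (nat \<times> nat \<Rightarrow> real) measure)"
    and unit: "\<And>\<zeta> j. nip N (\<phi> \<zeta> j) (\<phi> \<zeta> j) = 0 \<or> nip N (\<phi> \<zeta> j) (\<phi> \<zeta> j) = 1"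
    and dep: "\<And>\<zeta> \<zeta>' j. (\<And>l i. l < j \<Longrightarrow> \<zeta> (l, i) = \<zeta>' (l, i)) \<Longrightarrow> \<phi> \<zeta> j = \<phi> \<zeta>' j"
    and F: "F \<in> borel_measurable (PiM UNIV (\<lambda>_. borel))"
  shows "(\<integral>\<^sup>+\<zeta>. \<integral>\<^sup>+W. F (wrap N (\<phi> \<zeta>) \<zeta> K (sym_mat N W)) \<partial>iid_normal \<partial>iid_normal) = (\<integral>\<^sup>+W. F (sym_mat N W) \<partial>iid_normal)"
proof (induction K)
  case 0
  show ?case by (simp add: iid.emeasure_space_1[simplified])
next
  case (Suc j)
  let ?Z = "iid_normal :: (nat \<times> nat \<Rightarrow> real) measure"
  define H where "H \<zeta> = (\<integral>\<^sup>+W. F (wrap N (\<phi> \<zeta>) \<zeta> (Suc j) (sym_mat N W)) \<partial>?Z)" for \<zeta>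
  have w: "(\<lambda>(\<zeta>, W). wrap N (\<phi> \<zeta>) \<zeta> k (sym_mat N W)) \<in> measurable (?Z \<Otimes>\<^sub>M ?Z) (PiM UNIV (\<lambda>_. borel))" for k
    unfolding case_prod_beta
    by (rule measurable_wrap) (auto intro!: measurable_compose[OF measurable_fst] measurable_compose[OF measurable_snd] \<phi>)
  have H: "H \<in> borel_measurable ?Z"
    unfolding H_def using iid.borel_measurable_nn_integral_fst[OF measurable_compose[OF w[of "Suc j"] F]] by simp
  \<comment> \<open>Row \<open>j\<close> of the array, the fresh vector of the innermost
    step.\<close>
  define A :: "(nat \<times> nat) set" where "A = {(j, i) |i. True}"
  let ?m = "\<lambda>\<eta> \<zeta> x. if x \<in> A then \<eta> x else \<zeta> x"
  have m: "wrap N (\<phi> (?m \<eta> \<zeta>)) (?m \<eta> \<zeta>) (Suc j) S = wrap N (\<phi> \<zeta>) \<zeta> j (resample_dir N (\<phi> \<zeta> j) (\<lambda>i. \<eta> (j, i)) S)" for \<eta> \<zeta> S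
  proof -
    have a: "?m \<eta> \<zeta> (l, i) = \<zeta> (l, i)" if "l < j" for l i using that by (auto simp: A_def)
    have p: "\<phi> (?m \<eta> \<zeta>) l = \<phi> \<zeta> l" if "l \<le> j" for l
      by (rule dep) (rule a, use that in simp)
    have "wrap N (\<phi> (?m \<eta> \<zeta>)) (?m \<eta> \<zeta>) j S = wrap N (\<phi> \<zeta>) \<zeta> j S" for S
      by (rule wrap_cong) (simp add: p, rule a)
    moreover have "?m \<eta> \<zeta> (j, i) = \<eta> (j, i)" for i by (auto simp: A_def)
    ultimately show ?thesis by (simp add: p)
  qed
  have "(\<integral>\<^sup>+\<zeta>. H \<zeta> \<partial>?Z) = (\<integral>\<^sup>+\<zeta>. \<integral>\<^sup>+\<eta>. H (?m \<eta> \<zeta>) \<partial>?Z \<partial>?Z)" by (rule nn_integral_resample[OF H])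
  also have "\<dots> = (\<integral>\<^sup>+\<zeta>. \<integral>\<^sup>+W. F (wrap N (\<phi> \<zeta>) \<zeta> j (sym_mat N W)) \<partial>?Z \<partial>?Z)"
  proof (rule nn_integral_cong)
    fix \<zeta>
    have "(\<lambda>S. wrap N (\<phi> \<zeta>) \<zeta> j S) \<in> measurable (PiM UNIV (\<lambda>_. borel)) (PiM UNIV (\<lambda>_. borel))"
      by (rule measurable_wrap[where g="\<lambda>S. S"]) auto
    then have "(\<lambda>S. F (wrap N (\<phi> \<zeta>) \<zeta> j S)) \<in> borel_measurable (PiM UNIV (\<lambda>_. borel))"
      by (rule measurable_compose) (rule F)
    from nn_integral_resample_dir[OF unit this]
    show "(\<integral>\<^sup>+\<eta>. H (?m \<eta> \<zeta>) \<partial>?Z) = (\<integral>\<^sup>+W. F (wrap N (\<phi> \<zeta>) \<zeta> j (sym_mat N W)) \<partial>?Z)"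
      unfolding H_def m .
  qed
  finally show ?case using Suc.IH unfolding H_def by simp
qed

section \<open>Gram-Schmidt residuals and the field revealed so far\<close>

definition deflate :: "nat \<Rightarrow> (nat \<Rightarrow> nat \<Rightarrow> real) \<Rightarrow> nat \<Rightarrow> (nat \<Rightarrow> real) \<Rightarrow> nat \<Rightarrow> real" where
  "deflate N \<phi> k y i = y i - (\<Sum>r<k. nip N (\<phi> r) y * \<phi> r i)"

definition normalize_vec :: "nat \<Rightarrow> (nat \<Rightarrow> real) \<Rightarrow> nat \<Rightarrow> real" where
  "normalize_vec N y i = y i / nnorm N y"

text \<open>The part of \<open>A y\<close> that the first \<open>k\<close> resampling steps determine, where \<open>A\<close> is the resampled matrix over \<open>sqrt N\<close>.\<close>

definition known_field :: "nat \<Rightarrow> (nat \<Rightarrow> nat \<Rightarrow> real) \<Rightarrow> (nat \<times> nat \<Rightarrow> real) \<Rightarrow> nat \<Rightarrow> (nat \<Rightarrow> real) \<Rightarrow> nat \<Rightarrow> real" where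
  "known_field N \<phi> \<zeta> k y i = (\<Sum>l<k. nip N (\<phi> l) y * deflate N \<phi> (Suc l) (\<lambda>i. \<zeta> (l, i)) i
     + \<phi> l i * (nip N (\<lambda>i. \<zeta> (l, i)) (deflate N \<phi> (Suc l) y) + sqrt 2 * nip N (\<phi> l) (\<lambda>i. \<zeta> (l, i)) * nip N (\<phi> l) y))"

lemma deflate_0[simp]: "deflate N \<phi> 0 y = y" by (simp add: deflate_def fun_eq_iff)

lemma deflate_Suc: "deflate N \<phi> (Suc k) y i = deflate N \<phi> k y i - nip N (\<phi> k) y * \<phi> k i"
  by (simp add: deflate_def)

lemma deflate_cong: "(\<And>r. r < k \<Longrightarrow> \<phi> r = \<phi>' r) \<Longrightarrow> deflate N \<phi> k = deflate N \<phi>' k"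
  unfolding deflate_def[abs_def] by (intro ext arg_cong2[where f="(-)"] refl sum.cong) auto

lemma deflate_cong_range:
  assumes "\<And>i. i \<in> {1..N} \<Longrightarrow> y i = y' i" "i \<in> {1..N}"
  shows "deflate N \<phi> k y i = deflate N \<phi> k y' i"
proof -
  have "nip N (\<phi> r) y = nip N (\<phi> r) y'" for r by (rule nip_cong) (use assms in auto)
  then show ?thesis using assms by (simp add: deflate_def)
qed

lemma deflate_add: "deflate N \<phi> k (\<lambda>i. y i + z i) i = deflate N \<phi> k y i + deflate N \<phi> k z i"
  by (simp add: deflate_def nip_add sum.distrib algebra_simps)

lemma deflate_scale: "deflate N \<phi> k (\<lambda>i. c * y i) i = c * deflate N \<phi> k y i"
  by (simp add: deflate_def nip_scale sum_distrib_left algebra_simps)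

lemma nip_deflate: "nip N z (deflate N \<phi> k y) = nip N z y - (\<Sum>r<k. nip N (\<phi> r) y * nip N z (\<phi> r))"
  unfolding deflate_def[abs_def] nip_diff nip_sum nip_scale ..

lemma known_field_cong:
  assumes "\<And>r. r < k \<Longrightarrow> \<phi> r = \<phi>' r" "\<And>l i. l < k \<Longrightarrow> \<zeta> (l, i) = \<zeta>' (l, i)"
  shows "known_field N \<phi> \<zeta> k y i = known_field N \<phi>' \<zeta>' k y i"
  unfolding known_field_def
proof (rule sum.cong[OF refl])
  fix l assume "l \<in> {..<k}"
  then have l: "l < k" by simp
  have "deflate N \<phi> (Suc l) = deflate N \<phi>' (Suc l)" by (rule deflate_cong) (use assms l in auto)
  moreover have "(\<lambda>i. \<zeta> (l, i)) = (\<lambda>i. \<zeta>' (l, i))" using assms l by auto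
  ultimately show "nip N (\<phi> l) y * deflate N \<phi> (Suc l) (\<lambda>i. \<zeta> (l, i)) i
     + \<phi> l i * (nip N (\<lambda>i. \<zeta> (l, i)) (deflate N \<phi> (Suc l) y) + sqrt 2 * nip N (\<phi> l) (\<lambda>i. \<zeta> (l, i)) * nip N (\<phi> l) y)
    = nip N (\<phi>' l) y * deflate N \<phi>' (Suc l) (\<lambda>i. \<zeta>' (l, i)) i
     + \<phi>' l i * (nip N (\<lambda>i. \<zeta>' (l, i)) (deflate N \<phi>' (Suc l) y) + sqrt 2 * nip N (\<phi>' l) (\<lambda>i. \<zeta>' (l, i)) * nip N (\<phi>' l) y)"
    using assms(1)[OF l] by simp
qed

definition orthonormal :: "nat \<Rightarrow> (nat \<Rightarrow> nat \<Rightarrow> real) \<Rightarrow> bool" where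
  "orthonormal N \<phi> \<longleftrightarrow> (\<forall>j k. j \<noteq> k \<longrightarrow> nip N (\<phi> j) (\<phi> k) = 0) \<and> (\<forall>k. nip N (\<phi> k) (\<phi> k) = 0 \<or> nip N (\<phi> k) (\<phi> k) = 1)"

text \<open>By Cauchy-Schwarz a vector of norm 0 has zero inner product with everything, so
  projecting on it is harmless.\<close>

lemma nip_unit:
  assumes "nip N \<phi> \<phi> = 0 \<or> nip N \<phi> \<phi> = 1"
  shows "nip N \<phi> \<phi> * nip N \<phi> y = nip N \<phi> y"
proof (cases "nip N \<phi> \<phi> = 0")
  case True
  then have "nnorm N \<phi> = 0" by (simp add: nnorm_def)
  then have "nip N \<phi> y = 0" using nip_cauchy[of N \<phi> y] by simp
  then show ?thesis by simp
qed (use assms in simp)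

lemma sum_indicator_lt:
  fixes k l :: nat
  shows "(\<Sum>r<k. if r = l then (g r :: real) else 0) = (if l < k then g l else 0)"
  by (subst sum.delta) auto

lemma nip_dir_deflate:
  assumes "orthonormal N \<phi>"
  shows "nip N (\<phi> l) (deflate N \<phi> k y) = (if l < k then 0 else nip N (\<phi> l) y)"
proof -
  have "(\<Sum>r<k. nip N (\<phi> r) y * nip N (\<phi> l) (\<phi> r)) = (\<Sum>r<k. if r = l then nip N (\<phi> l) (\<phi> l) * nip N (\<phi> l) y else 0)"
    using assms by (intro sum.cong refl) (auto simp: orthonormal_def)
  also have "\<dots> = (if l < k then nip N (\<phi> l) y else 0)"
    unfolding sum_indicator_lt using nip_unit[of N "\<phi> l" y] assms by (simp add: orthonormal_def)
  finally show ?thesis by (simp add: nip_deflate)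
qed

lemma deflate_dir:
  assumes "orthonormal N \<phi>"
  shows "deflate N \<phi> k (\<phi> k) i = \<phi> k i"
proof -
  have "(\<Sum>r<k. nip N (\<phi> r) (\<phi> k) * \<phi> r i) = (\<Sum>r<k. 0)"
    using assms by (intro sum.cong refl) (auto simp: orthonormal_def)
  then show ?thesis by (simp add: deflate_def)
qed

section \<open>Action of a resampled matrix on a vector\<close>

definition proj :: "nat \<Rightarrow> (nat \<Rightarrow> real) \<Rightarrow> (nat \<Rightarrow> real) \<Rightarrow> nat \<Rightarrow> real" where
  "proj N \<phi> y i = y i - nip N \<phi> y * \<phi> i"

lemma sum_proj_entry:
  assumes "i \<in> {1..N}"
  shows "(\<Sum>k=1..N. proj_entry N \<phi> i k * y k) = proj N \<phi> y i"
proof -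
  have "(\<Sum>k=1..N. proj_entry N \<phi> i k * y k) = (\<Sum>k=1..N. unit_entry N i k * y k) - \<phi> i * (1 / real N * (\<Sum>k=1..N. \<phi> k * y k))"
    unfolding sum_distrib_left sum_subtractf[symmetric]
    by (intro sum.cong refl) (use assms in \<open>auto simp: proj_entry_def unit_entry_def algebra_simps\<close>)
  then show ?thesis using assms unfolding sum_unit by (simp add: proj_def nip_def)
qed

text \<open>The powers of \<open>N\<close> cancel: the two entries \<open>\<phi> / sqrt N\<close> of
  the direction and the division by \<open>sqrt N\<close> are compensated by the Euclidean inner
  products, which are \<open>N\<close> times \<open>nip\<close>.\<close>

lemma matvec_resample_dir:
  assumes i: "i \<in> {1..N}"
  shows "matvec N (\<lambda>i j. resample_dir N \<phi> z S (i, j)) y i / sqrt N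
    = proj N \<phi> (\<lambda>i. matvec N (\<lambda>i j. S (i, j)) (proj N \<phi> y) i / sqrt N) i + proj N \<phi> z i * nip N \<phi> y
      + \<phi> i * nip N (proj N \<phi> z) y + sqrt 2 * nip N \<phi> z * nip N \<phi> y * \<phi> i"
proof -
  let ?P = "proj_entry N \<phi>" and ?u = "dir_entry N \<phi>"
  have N: "real N > 0" using i by auto
  have symP: "?P j r = ?P r j" if "j \<in> {1..N}" "r \<in> {1..N}" for j r
    using that by (auto simp: proj_entry_def)
  have 1: "(\<Sum>j=1..N. sandwich N ?P S (i, j) * y j) = proj N \<phi> (matvec N (\<lambda>i j. S (i, j)) (proj N \<phi> y)) i"
  proof -
    have "(\<Sum>j=1..N. sandwich N ?P S (i, j) * y j) = (\<Sum>j=1..N. \<Sum>p=1..N. \<Sum>r=1..N. ?P i p * (S (p, r) * (?P j r * y j)))"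
    proof (rule sum.cong[OF refl])
      show "sandwich N ?P S (i, j) * y j = (\<Sum>p=1..N. \<Sum>r=1..N. ?P i p * (S (p, r) * (?P j r * y j)))" for j
        by (simp add: sandwich_def sum.cartesian_product case_prod_beta sum_distrib_left mult_ac)
    qed
    also have "\<dots> = (\<Sum>p=1..N. \<Sum>r=1..N. \<Sum>j=1..N. ?P i p * (S (p, r) * (?P r j * y j)))"
    proof -
      have "(\<Sum>j=1..N. \<Sum>p=1..N. \<Sum>r=1..N. ?P i p * (S (p, r) * (?P j r * y j))) = (\<Sum>p=1..N. \<Sum>j=1..N. \<Sum>r=1..N. ?P i p * (S (p, r) * (?P j r * y j)))"
        by (rule sum.swap)
      also have "\<dots> = (\<Sum>p=1..N. \<Sum>r=1..N. \<Sum>j=1..N. ?P i p * (S (p, r) * (?P j r * y j)))"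
        by (intro sum.cong refl sum.swap)
      finally show ?thesis using symP by simp
    qed
    also have "\<dots> = (\<Sum>p=1..N. ?P i p * (\<Sum>r=1..N. S (p, r) * (\<Sum>j=1..N. ?P r j * y j)))"
      by (simp add: sum_distrib_left)
    also have "\<dots> = (\<Sum>p=1..N. ?P i p * matvec N (\<lambda>i j. S (i, j)) (proj N \<phi> y) p)"
      unfolding matvec_def by (intro sum.cong refl arg_cong2[where f="(*)"]) (simp add: sum_proj_entry[simplified])
    also have "\<dots> = proj N \<phi> (matvec N (\<lambda>i j. S (i, j)) (proj N \<phi> y)) i" by (rule sum_proj_entry[OF i])
    finally show ?thesis .
  qed
  have 2: "(\<Sum>k=1..N. border N \<phi> (i, j) k * z k) = proj N \<phi> z i * (\<phi> j / sqrt N) + \<phi> i / sqrt N * proj N \<phi> z j + sqrt 2 * nip N \<phi> z * \<phi> i * \<phi> j / sqrt N"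
    if j: "j \<in> {1..N}" for j
  proof -
    have e1: "(\<Sum>k=1..N. border N \<phi> (i, j) k * z k) = (\<Sum>k=1..N. ?P i k * z k) * ?u j + ?u i * (\<Sum>k=1..N. ?P j k * z k) + sqrt 2 * ?u i * ?u j * (\<Sum>k=1..N. ?u k * z k)"
      unfolding sum_distrib_left sum_distrib_right sum.distrib[symmetric]
      by (intro sum.cong refl) (simp add: border_def algebra_simps)
    have e2: "(\<Sum>k=1..N. ?u k * z k) = sqrt N * nip N \<phi> z"
    proof -
      have "(\<Sum>k=1..N. ?u k * z k) = (\<Sum>k=1..N. \<phi> k * z k / sqrt N)" by (intro sum.cong refl) (simp add: dir_entry_def)
      also have "\<dots> = sqrt N * nip N \<phi> z" using N by (simp add: nip_def sum_divide_distrib[symmetric] real_div_sqrt field_simps flip: real_sqrt_mult)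
      finally show ?thesis .
    qed
    have u: "?u i = \<phi> i / sqrt N" "?u j = \<phi> j / sqrt N" using i j by (auto simp: dir_entry_def)
    have "sqrt 2 * (\<phi> i / s) * (\<phi> j / s) * (s * c) = sqrt 2 * c * \<phi> i * \<phi> j / s" if "s > 0" for s c :: real
      using that by simp
    note e3 = this[OF real_sqrt_gt_zero[OF N], of "nip N \<phi> z"]
    show ?thesis unfolding e1 e2 u sum_proj_entry[OF i] sum_proj_entry[OF j] e3 ..
  qed
  have 3: "(\<Sum>j=1..N. x j * y j) = real N * nip N x y" for x using N by (simp add: nip_def)
  have "matvec N (\<lambda>i j. resample_dir N \<phi> z S (i, j)) y i
     = (\<Sum>j=1..N. sandwich N ?P S (i, j) * y j) + (\<Sum>j=1..N. (\<Sum>k=1..N. border N \<phi> (i, j) k * z k) * y j)"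
    by (simp add: matvec_def resample_dir_def distrib_right sum.distrib)
  also have "(\<Sum>j=1..N. (\<Sum>k=1..N. border N \<phi> (i, j) k * z k) * y j)
     = (\<Sum>j=1..N. proj N \<phi> z i / sqrt N * (\<phi> j * y j) + \<phi> i / sqrt N * (proj N \<phi> z j * y j) + sqrt 2 * nip N \<phi> z * \<phi> i / sqrt N * (\<phi> j * y j))"
    by (intro sum.cong refl) (simp only: 2, simp add: algebra_simps)
  also have "\<dots> = proj N \<phi> z i / sqrt N * (real N * nip N \<phi> y) + \<phi> i / sqrt N * (real N * nip N (proj N \<phi> z) y) + sqrt 2 * nip N \<phi> z * \<phi> i / sqrt N * (real N * nip N \<phi> y)"
    unfolding 3[symmetric] by (simp only: sum.distrib sum_distrib_left)
  finally have "matvec N (\<lambda>i j. resample_dir N \<phi> z S (i, j)) y i / sqrt N =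
     proj N \<phi> (matvec N (\<lambda>i j. S (i, j)) (proj N \<phi> y)) i / sqrt N
     + (real N / (sqrt N * sqrt N)) * (proj N \<phi> z i * nip N \<phi> y + \<phi> i * nip N (proj N \<phi> z) y + sqrt 2 * nip N \<phi> z * \<phi> i * nip N \<phi> y)"
    unfolding 1 by (simp add: add_divide_distrib algebra_simps)
  also have "real N / (sqrt N * sqrt N) = 1" using N by simp
  also have "proj N \<phi> (matvec N (\<lambda>i j. S (i, j)) (proj N \<phi> y)) i / sqrt N = proj N \<phi> (\<lambda>i. matvec N (\<lambda>i j. S (i, j)) (proj N \<phi> y) i / sqrt N) i"
    unfolding proj_def using nip_scale(2)[of N \<phi> "1 / sqrt N"] by (simp add: diff_divide_distrib)
  finally show ?thesis by (simp add: algebra_simps)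
qed

text \<open>The residual matrix \<open>S\<close> acts only on the part of \<open>y\<close>
  orthogonal to the first \<open>k\<close> directions. For \<open>y\<close> in their span the
  product is determined by the rows of \<open>\<zeta>\<close> alone.\<close>

lemma matvec_wrap:
  assumes on: "orthonormal N \<phi>" and i: "i \<in> {1..N}"
  shows "matvec N (\<lambda>i j. wrap N \<phi> \<zeta> k S (i, j)) y i / sqrt N
    = deflate N \<phi> k (\<lambda>i. matvec N (\<lambda>i j. S (i, j)) (deflate N \<phi> k y) i / sqrt N) i + known_field N \<phi> \<zeta> k y i"
  using i
proof (induction k arbitrary: S i)
  case 0
  then show ?case by (simp add: known_field_def)
next
  case (Suc k)
  let ?z = "\<lambda>i. \<zeta> (k, i)" and ?y = "deflate N \<phi> k y"
  let ?S' = "resample_dir N (\<phi> k) ?z S"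
  let ?v = "\<lambda>i. matvec N (\<lambda>i j. S (i, j)) (deflate N \<phi> (Suc k) y) i / sqrt N"
  have py: "proj N (\<phi> k) ?y = deflate N \<phi> (Suc k) y"
    using nip_dir_deflate[OF on, of k k y] by (simp add: proj_def fun_eq_iff deflate_Suc)
  have dp: "deflate N \<phi> k (proj N (\<phi> k) w) i = deflate N \<phi> (Suc k) w i" for w i
  proof -
    have "deflate N \<phi> k (\<lambda>i. w i + (- nip N (\<phi> k) w) * \<phi> k i) i = deflate N \<phi> k w i + (- nip N (\<phi> k) w) * \<phi> k i"
      unfolding deflate_add deflate_scale deflate_dir[OF on] ..
    then show ?thesis by (simp add: proj_def[abs_def] deflate_Suc)
  qed
  have a: "nip N (proj N (\<phi> k) ?z) ?y = nip N ?z (deflate N \<phi> (Suc k) y)"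
  proof -
    have "nip N (proj N (\<phi> k) ?z) ?y = nip N ?z ?y - nip N (\<phi> k) ?z * nip N (\<phi> k) ?y"
      by (simp add: proj_def[abs_def] nip_diff nip_scale)
    also have "\<dots> = nip N ?z (proj N (\<phi> k) ?y)"
      by (simp add: proj_def[abs_def] nip_diff nip_scale nip_commute[of N ?z "\<phi> k"])
    finally show ?thesis unfolding py .
  qed
  define c where "c = nip N (\<phi> k) y"
  define d where "d = nip N ?z (deflate N \<phi> (Suc k) y) + sqrt 2 * nip N (\<phi> k) ?z * c"
  have nc: "nip N (\<phi> k) ?y = c" using nip_dir_deflate[OF on, of k k y] by (simp add: c_def)
  have "matvec N (\<lambda>i j. wrap N \<phi> \<zeta> (Suc k) S (i, j)) y i / sqrt N
     = deflate N \<phi> k (\<lambda>i. matvec N (\<lambda>i j. ?S' (i, j)) ?y i / sqrt N) i + known_field N \<phi> \<zeta> k y i"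
    using Suc.IH[OF Suc.prems, of ?S'] by simp
  also have "deflate N \<phi> k (\<lambda>i. matvec N (\<lambda>i j. ?S' (i, j)) ?y i / sqrt N) i
     = deflate N \<phi> k (\<lambda>i. proj N (\<phi> k) ?v i + (c * proj N (\<phi> k) ?z i + d * \<phi> k i)) i"
  proof (rule deflate_cong_range[OF _ Suc.prems])
    fix i assume i: "i \<in> {1..N}"
    show "matvec N (\<lambda>i j. ?S' (i, j)) ?y i / sqrt N = proj N (\<phi> k) ?v i + (c * proj N (\<phi> k) ?z i + d * \<phi> k i)"
      unfolding matvec_resample_dir[OF i] py a nc d_def by (simp add: algebra_simps)
  qed
  also have "\<dots> = deflate N \<phi> (Suc k) ?v i + (c * deflate N \<phi> (Suc k) ?z i + d * \<phi> k i)"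
    unfolding deflate_add deflate_scale dp deflate_dir[OF on] ..
  finally show ?case by (simp add: known_field_def c_def d_def algebra_simps)
qed

section \<open>The iterates as functions of Gaussian vectors\<close>

lemma nip_measurable:
  assumes "\<And>i. (\<lambda>\<omega>. x \<omega> i) \<in> borel_measurable M" "\<And>i. (\<lambda>\<omega>. y \<omega> i) \<in> borel_measurable M"
  shows "(\<lambda>\<omega>. nip N (x \<omega>) (y \<omega>)) \<in> borel_measurable M"
proof -
  note [measurable] = assms
  show ?thesis unfolding nip_def by measurable
qed

lemma nnorm_measurable:
  assumes "\<And>i. (\<lambda>\<omega>. x \<omega> i) \<in> borel_measurable M"
  shows "(\<lambda>\<omega>. nnorm N (x \<omega>)) \<in> borel_measurable M"
  unfolding nnorm_def by (intro measurable_compose[OF nip_measurable borel_measurable_sqrt] assms)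

lemma deflate_measurable:
  assumes "\<And>j i. (\<lambda>\<omega>. \<phi> \<omega> j i) \<in> borel_measurable M" "\<And>i. (\<lambda>\<omega>. y \<omega> i) \<in> borel_measurable M"
  shows "(\<lambda>\<omega>. deflate N (\<phi> \<omega>) k (y \<omega>) i) \<in> borel_measurable M"
proof -
  note [measurable] = assms nip_measurable[OF assms(1) assms(2)]
  show ?thesis unfolding deflate_def by measurable
qed

lemma tap_iter_measurable:
  assumes "\<And>i j. (\<lambda>\<omega>. A \<omega> i j) \<in> borel_measurable M"
  shows "(\<lambda>\<omega>. tap_iter h \<beta> q N (A \<omega>) k i) \<in> borel_measurable M"
proof (induction k arbitrary: i rule: less_induct)
  case (less k)
  consider "k = 0" | "k = Suc 0" | l where "k = Suc (Suc l)" by (metis not0_implies_Suc)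
  then show ?case
  proof cases
    case 3
    have [measurable]: "(\<lambda>\<omega>. tap_iter h \<beta> q N (A \<omega>) (Suc l) i) \<in> borel_measurable M"
      "(\<lambda>\<omega>. tap_iter h \<beta> q N (A \<omega>) l i) \<in> borel_measurable M" for i using less 3 by auto
    note [measurable] = assms
    have "(\<lambda>x::real. tanh x) \<in> borel_measurable borel"
      by (intro borel_measurable_continuous_onI continuous_intros) (auto simp: cosh_real_nonzero)
    note [measurable] = measurable_compose[OF _ this]
    show ?thesis unfolding 3 tap_iter.simps Th_def matvec_def by measurable
  qed simp_all
qed

lemma tap_iter_cong:
  assumes "\<And>i j. i \<in> {1..N} \<Longrightarrow> j \<in> {1..N} \<Longrightarrow> A i j = B i j" "i \<in> {1..N}"
  shows "tap_iter h \<beta> q N A k i = tap_iter h \<beta> q N B k i"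
  using assms(2)
proof (induction k arbitrary: i rule: less_induct)
  case (less k)
  consider "k = 0" | "k = Suc 0" | l where "k = Suc (Suc l)" by (metis not0_implies_Suc)
  then show ?case
  proof cases
    case 3
    have IH: "tap_iter h \<beta> q N A (Suc l) i = tap_iter h \<beta> q N B (Suc l) i"
      "tap_iter h \<beta> q N A l i = tap_iter h \<beta> q N B l i" if "i \<in> {1..N}" for i using less 3 that by auto
    have "matvec N A (tap_iter h \<beta> q N A (Suc l)) i = matvec N B (tap_iter h \<beta> q N B (Suc l)) i"
      unfolding matvec_def by (intro sum.cong refl) (use IH(1) assms(1) less.prems in auto)
    then show ?thesis using IH(2)[OF less.prems] by (simp add: 3)
  qed simp_all
qed

text \<open>The integrand of \<open>iter_msd\<close> as a functional of the matrix, so that it can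
  be evaluated under different models of the same law.\<close>

definition tap_msd :: "real \<Rightarrow> real \<Rightarrow> real \<Rightarrow> nat \<Rightarrow> nat \<Rightarrow> nat \<Rightarrow> (nat \<Rightarrow> nat \<Rightarrow> real) \<Rightarrow> real" where
  "tap_msd h \<beta> q N k k' A = (nnorm N (\<lambda>i. tap_iter h \<beta> q N A k i - tap_iter h \<beta> q N A k' i))\<^sup>2"

lemma tap_msd_measurable:
  assumes "\<And>i j. (\<lambda>\<omega>. A \<omega> i j) \<in> borel_measurable M"
  shows "(\<lambda>\<omega>. tap_msd h \<beta> q N k k' (A \<omega>)) \<in> borel_measurable M"
proof -
  note [measurable] = tap_iter_measurable[OF assms]
  show ?thesis unfolding tap_msd_def by (intro borel_measurable_power nnorm_measurable) measurable
qed

lemma tap_msd_cong: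
  assumes "\<And>i j. i \<in> {1..N} \<Longrightarrow> j \<in> {1..N} \<Longrightarrow> A i j = B i j"
  shows "tap_msd h \<beta> q N k k' A = tap_msd h \<beta> q N k k' B"
proof -
  have "tap_iter h \<beta> q N A k i = tap_iter h \<beta> q N B k i" if "i \<in> {1..N}" for k i
    by (rule tap_iter_cong[OF _ that]) (rule assms)
  then show ?thesis unfolding tap_msd_def by (intro arg_cong[where f="\<lambda>x. x\<^sup>2"] nnorm_cong) simp
qed

context tap_model
begin

text \<open>The iterates \<open>m\<close> (shifted by one) and the directions \<open>\<phi>\<close> obtained from them by Gram--Schmidt, computed
  from the Gaussian vectors \<open>\<zeta>\<close> alone.\<close>

primrec sim_run :: "nat \<Rightarrow> (nat \<times> nat \<Rightarrow> real) \<Rightarrow> nat \<Rightarrow> (nat \<Rightarrow> nat \<Rightarrow> real) \<times> (nat \<Rightarrow> nat \<Rightarrow> real)" where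
  "sim_run N \<zeta> 0 = (\<lambda>_ _. sqrt q, \<lambda>_ _. 0)"
| "sim_run N \<zeta> (Suc k) = (let m = fst (sim_run N \<zeta> k);
      \<phi> = (snd (sim_run N \<zeta> k))(k := normalize_vec N (deflate N (snd (sim_run N \<zeta> k)) k (m k)))
    in (m(Suc k := \<lambda>i. f (known_field N \<phi> \<zeta> (Suc k) (m k) i - \<beta> * (1 - q) * (if k = 0 then 0 else m (k - 1) i))), \<phi>))"

definition sim_iter :: "nat \<Rightarrow> (nat \<times> nat \<Rightarrow> real) \<Rightarrow> nat \<Rightarrow> nat \<Rightarrow> real" where
  "sim_iter N \<zeta> k = fst (sim_run N \<zeta> k) k"

definition sim_dir :: "nat \<Rightarrow> (nat \<times> nat \<Rightarrow> real) \<Rightarrow> nat \<Rightarrow> nat \<Rightarrow> real" where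
  "sim_dir N \<zeta> k = snd (sim_run N \<zeta> (Suc k)) k"

text \<open>The argument of \<open>f\<close> in the next iterate. The value 0 at
  \<open>k = 0\<close> is the zeroth iterate, which the shifted indexing leaves out.\<close>

definition sim_field :: "nat \<Rightarrow> (nat \<times> nat \<Rightarrow> real) \<Rightarrow> nat \<Rightarrow> nat \<Rightarrow> real" where
  "sim_field N \<zeta> k i = known_field N (sim_dir N \<zeta>) \<zeta> (Suc k) (sim_iter N \<zeta> k) i - \<beta> * (1 - q) * (if k = 0 then 0 else sim_iter N \<zeta> (k - 1) i)"

text \<open>The run carries the whole table of earlier vectors because each step refers to all
  directions; a later stage never overwrites an earlier entry.\<close>

lemma sim_run_fst: "j \<le> k \<Longrightarrow> fst (sim_run N \<zeta> k) j = sim_iter N \<zeta> j"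
  by (induction k) (auto simp: sim_iter_def Let_def le_Suc_eq)

lemma sim_run_snd: "j < k \<Longrightarrow> snd (sim_run N \<zeta> k) j = sim_dir N \<zeta> j"
  by (induction k) (auto simp: sim_dir_def Let_def less_Suc_eq)

lemma sim_iter_0: "sim_iter N \<zeta> 0 = (\<lambda>i. sqrt q)" by (simp add: sim_iter_def)

lemma sim_dir_eq: "sim_dir N \<zeta> k = normalize_vec N (deflate N (sim_dir N \<zeta>) k (sim_iter N \<zeta> k))"
proof -
  have "deflate N (snd (sim_run N \<zeta> k)) k = deflate N (sim_dir N \<zeta>) k" by (rule deflate_cong) (rule sim_run_snd)
  then show ?thesis unfolding sim_dir_def[of N \<zeta> k] by (simp add: Let_def sim_run_fst)
qed

lemma sim_iter_Suc: "sim_iter N \<zeta> (Suc k) i = f (sim_field N \<zeta> k i)"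
proof -
  have "sim_iter N \<zeta> (Suc k) i = f (known_field N (snd (sim_run N \<zeta> (Suc k))) \<zeta> (Suc k) (sim_iter N \<zeta> k) i - \<beta> * (1 - q) * (if k = 0 then 0 else sim_iter N \<zeta> (k - 1) i))"
    unfolding sim_iter_def[of N \<zeta> "Suc k"] by (simp add: Let_def sim_run_fst)
  also have "known_field N (snd (sim_run N \<zeta> (Suc k))) \<zeta> (Suc k) (sim_iter N \<zeta> k) i = known_field N (sim_dir N \<zeta>) \<zeta> (Suc k) (sim_iter N \<zeta> k) i"
    by (rule known_field_cong) (rule sim_run_snd, simp_all)
  finally show ?thesis by (simp add: sim_field_def)
qed

lemma sqrt_q_le_1: "sqrt q \<le> 1"
proof -
  have "q \<le> 1" using gauss_int_bound[of "\<lambda>z. (f (sqrt q * z))\<^sup>2"] f_square q_eq' by simp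
  then show ?thesis by simp
qed

lemma sim_iter_bound: "\<bar>sim_iter N \<zeta> k i\<bar> \<le> 1"
  by (cases k) (use f_bound sqrt_q_le_1 q_pos in \<open>auto simp: sim_iter_Suc sim_iter_0\<close>)

lemma nip_normalize:
  assumes "c = nnorm N y"
  shows "nip N (normalize_vec N y) z = nip N y z / c" "nip N z (normalize_vec N y) = nip N z y / c"
proof -
  have "normalize_vec N y = (\<lambda>i. (1 / c) * y i)" by (auto simp: normalize_vec_def assms)
  then show "nip N (normalize_vec N y) z = nip N y z / c" "nip N z (normalize_vec N y) = nip N z y / c"
    by (simp_all only: nip_scale) simp_all
qed

text \<open>The alternative 0 stands for a vanishing residual, where division by zero turns the
  direction into the zero vector.\<close>

lemma sim_dir_unit: "nip N (sim_dir N \<zeta> k) (sim_dir N \<zeta> k) = 0 \<or> nip N (sim_dir N \<zeta> k) (sim_dir N \<zeta> k) = 1"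
proof -
  have "nip N (normalize_vec N y) (normalize_vec N y) = 0 \<or> nip N (normalize_vec N y) (normalize_vec N y) = 1" for y
    by (subst (1 2) nip_normalize(1)[OF refl], subst (1 2) nip_normalize(2)[OF refl], subst (1 2) nip_self) (auto simp: power2_eq_square)
  then show ?thesis using sim_dir_eq[of N \<zeta> k] by metis
qed

lemma sim_dir_orthogonal: "j < k \<Longrightarrow> nip N (sim_dir N \<zeta> j) (sim_dir N \<zeta> k) = 0"
proof (induction k arbitrary: j rule: less_induct)
  case (less k)
  \<comment> \<open>Directions from \<open>k\<close> on are replaced by zero, which gives an
    orthonormal system before their orthogonality is known.\<close>
  define \<phi> where "\<phi> = (\<lambda>r. if r < k then sim_dir N \<zeta> r else (\<lambda>_. 0))"
  have "nip N (\<phi> a) (\<phi> b) = 0" if "a \<noteq> b" for a b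
  proof (cases "a < k \<and> b < k")
    case True
    then show ?thesis using less.IH[of a b] less.IH[of b a] that
      by (cases a b rule: linorder_cases) (auto simp: \<phi>_def nip_commute)
  qed (auto simp: \<phi>_def nip_def)
  moreover have "nip N (\<phi> a) (\<phi> a) = 0 \<or> nip N (\<phi> a) (\<phi> a) = 1" for a
    using sim_dir_unit[of N \<zeta> a] by (auto simp: \<phi>_def nip_def)
  ultimately have on: "orthonormal N \<phi>" by (auto simp: orthonormal_def)
  have "deflate N (sim_dir N \<zeta>) k = deflate N \<phi> k" by (rule deflate_cong) (simp add: \<phi>_def)
  then have "nip N (sim_dir N \<zeta> j) (deflate N (sim_dir N \<zeta>) k y) = nip N (\<phi> j) (deflate N \<phi> k y)" for y
    using less.prems by (simp add: \<phi>_def)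
  also have "\<dots> y = 0" for y using nip_dir_deflate[OF on] less.prems by simp
  finally show ?case unfolding sim_dir_eq[of N \<zeta> k] nip_normalize[OF refl] by simp
qed

lemma sim_dir_orthonormal: "orthonormal N (sim_dir N \<zeta>)"
  unfolding orthonormal_def using sim_dir_unit sim_dir_orthogonal nip_commute by (metis linorder_neqE_nat)

text \<open>Subtracting earlier directions does not affect the component along direction
  \<open>k\<close>; if the residual vanishes, both sides are 0.\<close>

lemma nip_sim_dir_sim_iter: "nip N (sim_dir N \<zeta> k) (sim_iter N \<zeta> k) = nnorm N (deflate N (sim_dir N \<zeta>) k (sim_iter N \<zeta> k))"
proof -
  have "nip N (sim_dir N \<zeta> k) (sim_iter N \<zeta> k) = nip N (sim_dir N \<zeta> k) (deflate N (sim_dir N \<zeta>) k (sim_iter N \<zeta> k))"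
    using nip_dir_deflate[OF sim_dir_orthonormal, of N \<zeta> k k] by simp
  also have "\<dots> = nnorm N (deflate N (sim_dir N \<zeta>) k (sim_iter N \<zeta> k))"
    by (subst (1) sim_dir_eq) (simp add: nip_normalize[OF refl] nip_self power2_eq_square)
  finally show ?thesis .
qed

lemma nnorm_eq_0: "nnorm N y = 0 \<Longrightarrow> i \<in> {1..N} \<Longrightarrow> y i = 0"
  by (auto simp: nnorm_L2 L2_set_eq_0_iff)

text \<open>On the sites \<open>1..N\<close> the iterate lies in the span of the directions up to
  its own index, since the last of them is its normalised residual.\<close>

lemma deflate_sim_iter_self: "i \<in> {1..N} \<Longrightarrow> deflate N (sim_dir N \<zeta>) (Suc k) (sim_iter N \<zeta> k) i = 0"
proof -
  assume i: "i \<in> {1..N}"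
  let ?y = "deflate N (sim_dir N \<zeta>) k (sim_iter N \<zeta> k)"
  have "sim_dir N \<zeta> k i = ?y i / nnorm N ?y" by (subst sim_dir_eq) (simp add: normalize_vec_def)
  then have "deflate N (sim_dir N \<zeta>) (Suc k) (sim_iter N \<zeta> k) i = ?y i - nnorm N ?y * (?y i / nnorm N ?y)"
    unfolding deflate_Suc nip_sim_dir_sim_iter by simp
  then show ?thesis using nnorm_eq_0[OF _ i, of ?y] by (cases "nnorm N ?y = 0") auto
qed

lemma nip_sim_dir_sim_iter_later: "k < l \<Longrightarrow> nip N (sim_dir N \<zeta> l) (sim_iter N \<zeta> k) = 0"
proof -
  assume "k < l"
  then have "nip N (sim_dir N \<zeta> l) (sim_iter N \<zeta> k) = nip N (sim_dir N \<zeta> l) (deflate N (sim_dir N \<zeta>) (Suc k) (sim_iter N \<zeta> k))"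
    using nip_dir_deflate[OF sim_dir_orthonormal, of N \<zeta> l "Suc k"] by simp
  also have "\<dots> = nip N (sim_dir N \<zeta> l) (\<lambda>_. 0)" by (rule nip_cong) (simp_all add: deflate_sim_iter_self)
  finally show ?thesis by (simp add: nip_def)
qed

lemma deflate_sim_iter: "i \<in> {1..N} \<Longrightarrow> k < l \<Longrightarrow> deflate N (sim_dir N \<zeta>) l (sim_iter N \<zeta> k) i = 0"
proof (induction l)
  case (Suc l)
  then show ?case by (cases "k = l") (auto simp: deflate_sim_iter_self, simp add: deflate_Suc nip_sim_dir_sim_iter_later)
qed simp

lemma sim_iter_expansion: "i \<in> {1..N} \<Longrightarrow> sim_iter N \<zeta> k i = (\<Sum>l\<le>k. nip N (sim_dir N \<zeta> l) (sim_iter N \<zeta> k) * sim_dir N \<zeta> l i)"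
  using deflate_sim_iter_self[of i N \<zeta> k] by (simp add: deflate_def lessThan_Suc_atMost)

lemma nip_deflate_sim_iter: "k < l \<Longrightarrow> nip N z (deflate N (sim_dir N \<zeta>) l (sim_iter N \<zeta> k)) = 0"
proof -
  assume "k < l"
  then have "nip N z (deflate N (sim_dir N \<zeta>) l (sim_iter N \<zeta> k)) = nip N z (\<lambda>_. 0)"
    by (intro nip_cong) (simp_all add: deflate_sim_iter)
  then show ?thesis by (simp add: nip_def)
qed

lemma known_field_sim_iter: "k < K \<Longrightarrow> known_field N (sim_dir N \<zeta>) \<zeta> K (sim_iter N \<zeta> k) i = known_field N (sim_dir N \<zeta>) \<zeta> (Suc k) (sim_iter N \<zeta> k) i"
  unfolding known_field_def
  by (rule sum.mono_neutral_cong_right) (auto simp: nip_sim_dir_sim_iter_later nip_deflate_sim_iter)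

text \<open>A pathwise identity for every \<open>S\<close>: the iterates involved lie in the span of
  the directions already treated, so the residual matrix is applied to the zero vector. Index
  \<open>k\<close> here is iterate \<open>Suc k\<close> of the original recursion.\<close>

lemma tap_iter_wrap:
  assumes "i \<in> {1..N}" "k \<le> K"
  shows "tap_iter h \<beta> q N (\<lambda>i j. wrap N (sim_dir N \<zeta>) \<zeta> K S (i, j) / sqrt N) (Suc k) i = sim_iter N \<zeta> k i"
  using assms
proof (induction k arbitrary: i rule: less_induct)
  case (less k)
  let ?A = "\<lambda>i j. wrap N (sim_dir N \<zeta>) \<zeta> K S (i, j) / sqrt N"
  show ?case
  proof (cases k)
    case 0
    then show ?thesis by (simp add: sim_iter_0)
  next
    case (Suc l)
    have "matvec N ?A (tap_iter h \<beta> q N ?A (Suc l)) i = matvec N ?A (sim_iter N \<zeta> l) i"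
      unfolding matvec_def by (intro sum.cong refl) (use less Suc in auto)
    also have "\<dots> = matvec N (\<lambda>i j. wrap N (sim_dir N \<zeta>) \<zeta> K S (i, j)) (sim_iter N \<zeta> l) i / sqrt N"
      by (simp add: matvec_def sum_divide_distrib)
    also have "\<dots> = deflate N (sim_dir N \<zeta>) K (\<lambda>i. matvec N (\<lambda>i j. S (i, j)) (deflate N (sim_dir N \<zeta>) K (sim_iter N \<zeta> l)) i / sqrt N) i + known_field N (sim_dir N \<zeta>) \<zeta> K (sim_iter N \<zeta> l) i"
      by (rule matvec_wrap[OF sim_dir_orthonormal less.prems(1)])
    also have "deflate N (sim_dir N \<zeta>) K (\<lambda>i. matvec N (\<lambda>i j. S (i, j)) (deflate N (sim_dir N \<zeta>) K (sim_iter N \<zeta> l)) i / sqrt N) i = deflate N (sim_dir N \<zeta>) K (\<lambda>i. 0) i"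
    proof (rule deflate_cong_range[OF _ less.prems(1)])
      fix i
      have "matvec N (\<lambda>i j. S (i, j)) (deflate N (sim_dir N \<zeta>) K (sim_iter N \<zeta> l)) i = 0"
        unfolding matvec_def by (rule sum.neutral) (use less.prems Suc in \<open>auto simp: deflate_sim_iter\<close>)
      then show "matvec N (\<lambda>i j. S (i, j)) (deflate N (sim_dir N \<zeta>) K (sim_iter N \<zeta> l)) i / sqrt N = 0" by simp
    qed
    also have "\<dots> = 0" by (simp add: deflate_def nip_def)
    also have "known_field N (sim_dir N \<zeta>) \<zeta> K (sim_iter N \<zeta> l) i = known_field N (sim_dir N \<zeta>) \<zeta> (Suc l) (sim_iter N \<zeta> l) i"
      by (rule known_field_sim_iter) (use less.prems Suc in auto)
    finally have 1: "matvec N ?A (tap_iter h \<beta> q N ?A (Suc l)) i = known_field N (sim_dir N \<zeta>) \<zeta> (Suc l) (sim_iter N \<zeta> l) i" by simp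
    have 2: "tap_iter h \<beta> q N ?A l i = (if l = 0 then 0 else sim_iter N \<zeta> (l - 1) i)"
    proof (cases l)
      case (Suc l')
      then show ?thesis using less.IH[of l' i] less.prems \<open>k = Suc l\<close> by simp
    qed simp
    show ?thesis unfolding Suc tap_iter.simps 1 2 sim_iter_Suc sim_field_def ..
  qed
qed

lemma sim_run_cong:
  assumes "\<And>l i. l < k \<Longrightarrow> \<zeta> (l, i) = \<zeta>' (l, i)"
  shows "sim_run N \<zeta> k = sim_run N \<zeta>' k"
  using assms
proof (induction k)
  case (Suc k)
  have "sim_run N \<zeta> k = sim_run N \<zeta>' k" by (rule Suc.IH) (use Suc.prems in auto)
  moreover have "known_field N \<phi> \<zeta> (Suc k) y = known_field N \<phi> \<zeta>' (Suc k) y" for \<phi> y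
    by (rule ext, rule known_field_cong) (use Suc.prems in auto)
  ultimately show ?case by (simp only: sim_run.simps)
qed simp

text \<open>Adaptedness: iterate \<open>k\<close> is built from the rows before \<open>k\<close>,
  and direction \<open>k\<close> adds no further row. This is the hypothesis \<open>dep\<close> of
  the resampling induction.\<close>

lemma sim_dir_dep:
  assumes "\<And>l i. l < k \<Longrightarrow> \<zeta> (l, i) = \<zeta>' (l, i)"
  shows "sim_dir N \<zeta> k = sim_dir N \<zeta>' k"
proof -
  have "sim_run N \<zeta> k = sim_run N \<zeta>' k" by (rule sim_run_cong) (rule assms)
  then show ?thesis by (simp add: sim_dir_def Let_def)
qed

lemma known_field_measurable:
  assumes "\<And>j i. (\<lambda>\<omega>. \<phi> \<omega> j i) \<in> borel_measurable M" "\<And>i. (\<lambda>\<omega>. y \<omega> i) \<in> borel_measurable M"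
    "\<And>p. (\<lambda>\<omega>. \<zeta> \<omega> p) \<in> borel_measurable M"
  shows "(\<lambda>\<omega>. known_field N (\<phi> \<omega>) (\<zeta> \<omega>) k (y \<omega>) i) \<in> borel_measurable M"
proof -
  note [measurable] = assms
  have d[measurable]: "(\<lambda>\<omega>. deflate N (\<phi> \<omega>) l (y \<omega>) i) \<in> borel_measurable M" "(\<lambda>\<omega>. deflate N (\<phi> \<omega>) l (\<lambda>i. \<zeta> \<omega> (l', i)) i) \<in> borel_measurable M" for l l' i
    by (rule deflate_measurable; measurable)+
  note [measurable] = nip_measurable[of _ M]
  have [measurable]: "(\<lambda>\<omega>. nip N (\<phi> \<omega> l) (y \<omega>)) \<in> borel_measurable M" "(\<lambda>\<omega>. nip N (\<lambda>i. \<zeta> \<omega> (l, i)) (deflate N (\<phi> \<omega>) l' (y \<omega>))) \<in> borel_measurable M"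
     "(\<lambda>\<omega>. nip N (\<phi> \<omega> l) (\<lambda>i. \<zeta> \<omega> (l, i))) \<in> borel_measurable M" for l l'
    by (rule nip_measurable; measurable)+
  show ?thesis unfolding known_field_def by measurable
qed

lemma sim_run_measurable:
  "(\<lambda>\<zeta>. fst (sim_run N \<zeta> k) j i) \<in> borel_measurable iid_normal \<and> (\<lambda>\<zeta>. snd (sim_run N \<zeta> k) j i) \<in> borel_measurable iid_normal"
proof (induction k arbitrary: j i)
  case (Suc k)
  have m[measurable]: "(\<lambda>\<zeta>. fst (sim_run N \<zeta> k) j i) \<in> borel_measurable iid_normal" and
    p[measurable]: "(\<lambda>\<zeta>. snd (sim_run N \<zeta> k) j i) \<in> borel_measurable iid_normal" for j i using Suc by auto
  define \<phi> where "\<phi> \<zeta> = (snd (sim_run N \<zeta> k))(k := normalize_vec N (deflate N (snd (sim_run N \<zeta> k)) k (fst (sim_run N \<zeta> k) k)))" for \<zeta>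
  have d[measurable]: "(\<lambda>\<zeta>. deflate N (snd (sim_run N \<zeta> k)) k (fst (sim_run N \<zeta> k) k) i) \<in> borel_measurable iid_normal" for i
    by (rule deflate_measurable; measurable)
  have n[measurable]: "(\<lambda>\<zeta>. nnorm N (deflate N (snd (sim_run N \<zeta> k)) k (fst (sim_run N \<zeta> k) k))) \<in> borel_measurable iid_normal"
    by (rule nnorm_measurable; measurable)
  have \<phi>[measurable]: "(\<lambda>\<zeta>. \<phi> \<zeta> j i) \<in> borel_measurable iid_normal" for j i
    unfolding \<phi>_def by (cases "j = k") (simp_all add: normalize_vec_def)
  have l[measurable]: "(\<lambda>\<zeta>. known_field N (\<phi> \<zeta>) \<zeta> (Suc k) (fst (sim_run N \<zeta> k) k) i) \<in> borel_measurable iid_normal" for i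
    by (rule known_field_measurable; measurable)
  have e: "sim_run N \<zeta> (Suc k) = ((fst (sim_run N \<zeta> k))(Suc k := \<lambda>i. f (known_field N (\<phi> \<zeta>) \<zeta> (Suc k) (fst (sim_run N \<zeta> k) k) i - \<beta> * (1 - q) * (if k = 0 then 0 else fst (sim_run N \<zeta> k) (k - 1) i))), \<phi> \<zeta>)" for \<zeta>
    by (simp add: \<phi>_def Let_def)
  have "(\<lambda>\<zeta>. f (known_field N (\<phi> \<zeta>) \<zeta> (Suc k) (fst (sim_run N \<zeta> k) k) i - \<beta> * (1 - q) * (if k = 0 then 0 else fst (sim_run N \<zeta> k) (k - 1) i))) \<in> borel_measurable iid_normal"
    by measurable
  then show ?case unfolding e by (cases "j = Suc k") (simp_all only: fst_conv snd_conv fun_upd_same fun_upd_other m \<phi> simp_thms)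
qed simp

lemma sim_iter_measurable[measurable]: "(\<lambda>\<zeta>. sim_iter N \<zeta> k i) \<in> borel_measurable iid_normal"
  unfolding sim_iter_def using sim_run_measurable by blast

lemma sim_dir_measurable[measurable]: "(\<lambda>\<zeta>. sim_dir N \<zeta> k i) \<in> borel_measurable iid_normal"
  unfolding sim_dir_def using sim_run_measurable by blast

text \<open>After as many resampling steps as the larger index, the functional depends on the rows
  of \<open>\<zeta>\<close> only, and the integral over \<open>W\<close> becomes trivial.\<close>

lemma goe_iterates:
  "(\<integral>\<^sup>+W. ennreal (tap_msd h \<beta> q N (Suc k) (Suc k') (\<lambda>i j. sym_mat N W (i, j) / sqrt N)) \<partial>iid_normal)
   = (\<integral>\<^sup>+\<zeta>. ennreal ((nnorm N (\<lambda>i. sim_iter N \<zeta> k i - sim_iter N \<zeta> k' i))\<^sup>2) \<partial>iid_normal)"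
proof -
  let ?F = "\<lambda>S. ennreal (tap_msd h \<beta> q N (Suc k) (Suc k') (\<lambda>i j. S (i, j) / sqrt N))"
  define K where "K = max k k'"
  have F: "?F \<in> borel_measurable (PiM UNIV (\<lambda>_. borel))"
    by (intro measurable_compose[OF tap_msd_measurable measurable_ennreal]) measurable
  have "(\<integral>\<^sup>+W. ?F (sym_mat N W) \<partial>iid_normal) = (\<integral>\<^sup>+\<zeta>. \<integral>\<^sup>+W. ?F (wrap N (sim_dir N \<zeta>) \<zeta> K (sym_mat N W)) \<partial>iid_normal \<partial>iid_normal)"
    by (rule nn_integral_wrap[symmetric, OF sim_dir_measurable sim_dir_unit sim_dir_dep F])
  also have "\<dots> = (\<integral>\<^sup>+\<zeta>. \<integral>\<^sup>+W. ennreal ((nnorm N (\<lambda>i. sim_iter N \<zeta> k i - sim_iter N \<zeta> k' i))\<^sup>2) \<partial>(iid_normal :: (nat \<times> nat \<Rightarrow> real) measure) \<partial>iid_normal)"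
  proof (intro nn_integral_cong)
    fix \<zeta> W
    have K: "k \<le> K" "k' \<le> K" by (auto simp: K_def)
    show "?F (wrap N (sim_dir N \<zeta>) \<zeta> K (sym_mat N W)) = ennreal ((nnorm N (\<lambda>i. sim_iter N \<zeta> k i - sim_iter N \<zeta> k' i))\<^sup>2)"
      unfolding tap_msd_def
      by (intro arg_cong[where f="\<lambda>x. ennreal (x\<^sup>2)"] nnorm_cong) (simp add: tap_iter_wrap[OF _ K(1)] tap_iter_wrap[OF _ K(2)])
  qed
  also have "\<dots> = (\<integral>\<^sup>+\<zeta>. ennreal ((nnorm N (\<lambda>i. sim_iter N \<zeta> k i - sim_iter N \<zeta> k' i))\<^sup>2) \<partial>iid_normal)"
    by (simp add: iid.emeasure_space_1[simplified])
  finally show ?thesis .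
qed

end

section \<open>State evolution\<close>

abbreviation array_filter :: "(nat \<times> (nat \<times> nat \<Rightarrow> real)) filter" where
  "array_filter \<equiv> prob_filter iid_normal"

abbreviation plim :: "(nat \<Rightarrow> (nat \<times> nat \<Rightarrow> real) \<Rightarrow> real) \<Rightarrow> real \<Rightarrow> bool" where
  "plim X c \<equiv> ((\<lambda>p. X (fst p) (snd p)) \<longlongrightarrow> c) array_filter"

lemma plim_squeeze:
  assumes "plim Y 0" "\<And>N \<zeta>. N \<ge> 1 \<Longrightarrow> \<bar>X N \<zeta>\<bar> \<le> Y N \<zeta>"
  shows "plim X 0"
proof (rule Lim_null_comparison[OF _ assms(1)])
  show "\<forall>\<^sub>F p in array_filter. norm (X (fst p) (snd p)) \<le> Y (fst p) (snd p)"
    using iid.eventually_fst_prob_filter[OF eventually_ge_at_top[of 1]] by eventually_elim (simp add: assms(2))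
qed

lemma plim_cong:
  assumes "plim X c" "\<And>N \<zeta>. N \<ge> 1 \<Longrightarrow> X N \<zeta> = Y N \<zeta>"
  shows "plim Y c"
proof (rule Lim_transform_eventually[OF assms(1)])
  show "\<forall>\<^sub>F p in array_filter. X (fst p) (snd p) = Y (fst p) (snd p)"
    using iid.eventually_fst_prob_filter[OF eventually_ge_at_top[of 1]] by eventually_elim (simp add: assms(2))
qed

lemma std_normal_second_moment: "(LINT x|std_normal_distribution. x\<^sup>2) = 1" "integrable std_normal_distribution (\<lambda>x::real. x\<^sup>2)"
  using std_normal_distribution_even_moments[of 1] by simp_all

lemma linear_second_moment:
  fixes v :: "nat \<Rightarrow> real" and l :: nat
  shows "(\<integral>\<^sup>+\<eta>. ennreal ((\<Sum>i=1..N. v i * \<eta> (l, i))\<^sup>2) \<partial>iid_normal) = ennreal (\<Sum>i=1..N. (v i)\<^sup>2)"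
proof -
  define s where "s = sqrt (\<Sum>i=1..N. (v i)\<^sup>2)"
  have ss: "s * s = (\<Sum>i=1..N. (v i)\<^sup>2)" by (simp add: s_def sum_nonneg)
  have 1: "gaussian_family iid_normal (\<lambda>_::unit. \<lambda>\<eta>. \<Sum>i=1..N. v i * \<eta> (l, i)) (\<lambda>_ _. s * s)"
  proof (rule gaussian_family_cong[OF gaussian_family_linear[OF gaussian_family_reindex[OF gaussian_family_iid_normal, of "\<lambda>i. (l, i)"], of "\<lambda>_. {1..N}" "\<lambda>_. v"]])
    have "(\<Sum>i=1..N. \<Sum>j=1..N. v i * v j * (if (l, i) = (l, j) then 1 else 0)) = (\<Sum>i=1..N. (v i)\<^sup>2)"
      by (rule sum.cong[OF refl]) (simp add: if_distrib[of "(*) _"] power2_eq_square cong: if_cong)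
    then show "(\<Sum>i=1..N. \<Sum>j=1..N. v i * v j * (if (l, i) = (l, j) then 1 else 0)) = s * s" unfolding ss .
  qed auto
  have 2: "gaussian_family std_normal_distribution (\<lambda>_::unit. (*) s) (\<lambda>_ _. s * s)"
    by (rule gaussian_family_std_normal)
  have "(\<integral>\<^sup>+\<eta>. ennreal ((\<Sum>i=1..N. v i * \<eta> (l, i))\<^sup>2) \<partial>iid_normal) = (\<integral>\<^sup>+x. ennreal ((s * x)\<^sup>2) \<partial>std_normal_distribution)"
    using gaussian_family_nn_integral[OF 1 2, of "\<lambda>\<omega>. ennreal ((\<omega> ())\<^sup>2)"] by simp
  also have "\<dots> = ennreal (LINT x|std_normal_distribution. (s * x)\<^sup>2)"
    by (rule nn_integral_eq_integral) (simp_all add: power_mult_distrib std_normal_second_moment)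
  also have "(LINT x|std_normal_distribution. (s * x)\<^sup>2) = (\<Sum>i=1..N. (v i)\<^sup>2)"
    using ss std_normal_second_moment(1) by (simp add: power_mult_distrib power2_eq_square[of s])
  finally show ?thesis .
qed

context tap_model
begin

text \<open>\<open>sim_dir r\<close> only uses the rows before \<open>r\<close>, hence is independent of row \<open>l\<close>.\<close>

lemma plim_nip_sim_dir_row:
  assumes "r \<le> l"
  shows "plim (\<lambda>N \<zeta>. nip N (sim_dir N \<zeta> r) (\<lambda>i. \<zeta> (l, i))) 0"
proof (rule iid.tendsto_prob_filter_L2)
  let ?X = "\<lambda>N \<zeta>. nip N (sim_dir N \<zeta> r) (\<lambda>i. \<zeta> (l, i))"
  show m[measurable]: "?X N \<in> borel_measurable iid_normal" for N
    by (rule nip_measurable) simp_all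
  define A :: "(nat \<times> nat) set" where "A = {(l, i) |i. True}"
  have b: "(\<integral>\<^sup>+\<zeta>. ennreal ((?X N \<zeta> - 0)\<^sup>2) \<partial>iid_normal) \<le> ennreal (1 / real N)" for N
  proof (cases "N = 0")
    case False
    have "(\<integral>\<^sup>+\<zeta>. ennreal ((?X N \<zeta> - 0)\<^sup>2) \<partial>iid_normal)
       = (\<integral>\<^sup>+\<zeta>. \<integral>\<^sup>+\<eta>. ennreal ((?X N (\<lambda>x. if x \<in> A then \<eta> x else \<zeta> x) - 0)\<^sup>2) \<partial>iid_normal \<partial>iid_normal)"
      by (rule nn_integral_resample) simp
    also have "\<dots> \<le> (\<integral>\<^sup>+\<zeta>. ennreal (1 / real N) \<partial>(iid_normal :: (nat \<times> nat \<Rightarrow> real) measure))"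
    proof (rule nn_integral_mono)
      fix \<zeta> :: "nat \<times> nat \<Rightarrow> real"
      have "sim_dir N (\<lambda>x. if x \<in> A then \<eta> x else \<zeta> x) r = sim_dir N \<zeta> r" for \<eta>
        by (rule sim_dir_dep) (use assms in \<open>auto simp: A_def\<close>)
      then have "(\<integral>\<^sup>+\<eta>. ennreal ((?X N (\<lambda>x. if x \<in> A then \<eta> x else \<zeta> x) - 0)\<^sup>2) \<partial>iid_normal)
        = (\<integral>\<^sup>+\<eta>. ennreal ((\<Sum>i=1..N. (sim_dir N \<zeta> r i / real N) * \<eta> (l, i))\<^sup>2) \<partial>iid_normal)"
        by (simp add: nip_def A_def sum_divide_distrib)
      also have "\<dots> = ennreal (\<Sum>i=1..N. (sim_dir N \<zeta> r i / real N)\<^sup>2)" by (rule linear_second_moment)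
      also have "(\<Sum>i=1..N. (sim_dir N \<zeta> r i / real N)\<^sup>2) = nip N (sim_dir N \<zeta> r) (sim_dir N \<zeta> r) / real N"
        by (simp add: nip_def sum_divide_distrib power2_eq_square)
      also have "\<dots> \<le> 1 / real N" using sim_dir_unit[of N \<zeta> r] by (intro divide_right_mono) auto
      finally show "(\<integral>\<^sup>+\<eta>. ennreal ((?X N (\<lambda>x. if x \<in> A then \<eta> x else \<zeta> x) - 0)\<^sup>2) \<partial>iid_normal) \<le> ennreal (1 / real N)"
        by (simp add: ennreal_leI)
    qed
    also have "\<dots> = ennreal (1 / real N)" by (simp add: iid.emeasure_space_1[simplified])
    finally show ?thesis .
  qed (simp add: nip_def)
  show i: "integrable iid_normal (\<lambda>\<zeta>. (?X N \<zeta> - 0)\<^sup>2)" for N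
    by (rule integrableI_bounded) (use order.strict_trans1[OF b] in simp_all)
  show "iid.expectation (\<lambda>\<zeta>. (?X N \<zeta> - 0)\<^sup>2) \<le> 1 / real N" for N
  proof -
    have "ennreal (iid.expectation (\<lambda>\<zeta>. (?X N \<zeta> - 0)\<^sup>2)) \<le> ennreal (1 / real N)"
      using b[of N] nn_integral_eq_integral[OF i[of N]] by simp
    then show ?thesis by simp
  qed
  show "(\<lambda>N. 1 / real N) \<longlonglongrightarrow> 0" by (rule lim_const_over_n)
qed

text \<open>The covariance of two different fields depends on the smaller index only, so each column
  of the Cholesky factor is constant below the diagonal. One number per column suffices, and this is
  the running sum of their squares.\<close>

primrec chol_sum :: "nat \<Rightarrow> real" where
  "chol_sum 0 = 0"
| "chol_sum (Suc l) = chol_sum l + ((rho l - chol_sum l) / sqrt (q - chol_sum l))\<^sup>2"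

definition chol_off :: "nat \<Rightarrow> real" where "chol_off l = (rho l - chol_sum l) / sqrt (q - chol_sum l)"
definition chol_diag :: "nat \<Rightarrow> real" where "chol_diag l = sqrt (q - chol_sum l)"

text \<open>Cholesky factor of the limiting covariance: \<open>q\<close> on the diagonal and \<open>rho (min j k)\<close> off the diagonal.\<close>

definition chol :: "nat \<Rightarrow> nat \<Rightarrow> real" where
  "chol k l = (if l < k then chol_off l else if l = k then chol_diag k else 0)"

lemma chol_sum_eq: "chol_sum k = (\<Sum>l<k. (chol_off l)\<^sup>2)"
  by (induction k) (simp_all add: chol_off_def)

text \<open>With \<open>d = rho k - chol_sum k\<close> at most the pivot
  \<open>q - chol_sum k\<close>, the new square is at most \<open>d\<close>. Hence the pivots stay
  at least \<open>q - rho k\<close>, which is positive.\<close>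

lemma chol_sum_le_rho: "chol_sum k \<le> rho k"
proof (induction k)
  case 0
  show ?case using rho_bounds(1)[of 0] by simp
next
  case (Suc k)
  define d where "d = rho k - chol_sum k"
  have d: "0 \<le> d" "d \<le> q - chol_sum k" "q - chol_sum k > 0" using Suc rho_bounds[of k] by (auto simp: d_def)
  have "(d / sqrt (q - chol_sum k))\<^sup>2 = d * (d / (q - chol_sum k))" using d by (simp add: power_divide power2_eq_square)
  also have "\<dots> \<le> d * 1" using d by (intro mult_left_mono) auto
  finally have "chol_sum (Suc k) \<le> rho k" by (simp add: d_def)
  then show ?case using rho_Suc_less[of k] by linarith
qed

lemma chol_diag_pos: "chol_diag k > 0" and chol_diag_square: "chol_diag k * chol_diag k = q - chol_sum k"
  using chol_sum_le_rho[of k] rho_bounds(2)[of k] by (auto simp: chol_diag_def)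

lemma chol_off_chol_diag: "chol_off k * chol_diag k = rho k - chol_sum k"
  using chol_diag_pos[of k] by (simp add: chol_off_def chol_diag_def)

lemma chol_cov:
  assumes "j \<le> k"
  shows "(\<Sum>l\<le>j. chol j l * chol k l) = (if j = k then q else rho j)"
proof -
  have "(\<Sum>l\<le>j. chol j l * chol k l) = (\<Sum>l<j. (chol_off l)\<^sup>2) + chol j j * chol k j"
    unfolding lessThan_Suc_atMost[symmetric] sum.lessThan_Suc
    using assms by (intro arg_cong2[where f="(+)"] sum.cong) (auto simp: chol_def power2_eq_square)
  also have "\<dots> = chol_sum j + chol_diag j * (if j = k then chol_diag j else chol_off j)"
    using assms by (auto simp: chol_def chol_sum_eq)
  also have "\<dots> = (if j = k then q else rho j)" using chol_diag_square[of j] chol_off_chol_diag[of j] by (cases "j = k") (auto simp: mult.commute)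
  finally show ?thesis .
qed

section \<open>The limiting Gaussian fields and their averages\<close>

definition limit_gauss :: "nat \<Rightarrow> (nat \<Rightarrow> real) \<Rightarrow> real" where
  "limit_gauss k c = (\<Sum>l\<le>k. chol k l * c l)"

lemma limit_gauss_measurable[measurable]: "limit_gauss k \<in> borel_measurable (PiM UNIV (\<lambda>_. borel))" "limit_gauss k \<in> borel_measurable iid_normal"
  unfolding limit_gauss_def[abs_def] by measurable

text \<open>Boolean indices bring a pair of fields into the form required by
  \<open>gaussian_pair\<close>; \<open>j = k\<close> gives two copies of one field.\<close>

lemma limit_gauss_family:
  assumes "j \<le> k"
  shows "gaussian_family iid_normal (\<lambda>b. limit_gauss (if b then j else k)) (\<lambda>b c. if b = c then q else if j = k then q else rho j)"
proof (rule gaussian_family_cong[OF gaussian_family_linear[OF gaussian_family_iid_normal, of "\<lambda>b. {..if b then j else k}" "\<lambda>b. chol (if b then j else k)"]])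
  have s: "(\<Sum>i\<le>m. \<Sum>i'\<le>n. chol m i * chol n i' * (if i = i' then 1 else 0)) = (\<Sum>i\<le>min m n. chol m i * chol n i)" for m n
  proof -
    have "(\<Sum>i\<le>m. \<Sum>i'\<le>n. chol m i * chol n i' * (if i = i' then 1 else 0)) = (\<Sum>i\<le>m. if i \<le> n then chol m i * chol n i else 0)"
      by (rule sum.cong[OF refl]) (simp add: if_distrib[of "(*) _"] cong: if_cong)
    also have "\<dots> = (\<Sum>i\<le>min m n. chol m i * chol n i)"
      by (rule sum.mono_neutral_cong_right) auto
    finally show ?thesis .
  qed
  show "(\<Sum>i\<le>if b then j else k. \<Sum>i'\<le>if c then j else k. chol (if b then j else k) i * chol (if c then j else k) i' * (if i = i' then 1 else 0))
     = (if b = c then q else if j = k then q else rho j)" for b c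
    unfolding s using chol_cov[OF assms] chol_cov[of j j] chol_cov[of k k] assms
    by (cases b; cases c) (simp_all add: min_absorb1 min_absorb2 mult.commute)
qed (auto simp: limit_gauss_def)

text \<open>Here the recursion closes: covariance \<open>rho j\<close> of the fields becomes overlap
  \<open>psi (rho j)\<close> of the next iterates.\<close>

lemma expect_pair: "j < k \<Longrightarrow> (LINT c|iid_normal. f (limit_gauss j c) * f (limit_gauss k c)) = rho (Suc j)"
  using gaussian_pair[OF limit_gauss_family[of j k], of "rho j"] rho_bounds[of j] by simp

lemma expect_square: "(LINT c|iid_normal. f (limit_gauss k c) * f (limit_gauss k c)) = q"
  using gaussian_single[OF limit_gauss_family[of k k], of True "\<lambda>x. f x * f x"] q_eq' by (simp add: power2_eq_square)

lemma expect_single: "(LINT c|iid_normal. sqrt q * f (limit_gauss k c)) = rho 0"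
  using gaussian_single[OF limit_gauss_family[of k k], of True "\<lambda>x. sqrt q * f x"] by simp

text \<open>The correlation between a row and an iterate built from that row. It is the effect of
  using the same matrix again that the Onsager term has to remove.\<close>

lemma expect_stein:
  assumes "l \<le> k"
  shows "(LINT c|iid_normal. c l * f (limit_gauss k c)) = chol k l * (\<beta> * (1 - q))"
proof -
  define X where "X b c = (\<Sum>i\<in>(if b then {l} else {..k}). (if b then 1 else chol k i) * c i)" for b and c :: "nat \<Rightarrow> real"
  define C where "C b b' = (\<Sum>i\<in>(if b then {l} else {..k}). \<Sum>i'\<in>(if b' then {l} else {..k}). (if b then 1 else chol k i) * (if b' then 1 else chol k i') * (if i = i' then 1 else 0::real))" for b b'
  have X: "gaussian_family iid_normal X C"
    unfolding X_def[abs_def] C_def[abs_def]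
    by (rule gaussian_family_linear[OF gaussian_family_iid_normal]) auto
  have "C True True = 1" by (simp add: C_def)
  moreover have "C False False = q"
  proof -
    have "C False False = (\<Sum>i\<le>k. chol k i * chol k i)" unfolding C_def
      by (simp add: if_distrib[of "(*) _"] cong: if_cong)
    then show ?thesis using chol_cov[of k k] by simp
  qed
  moreover have "C True False = chol k l" "C False True = chol k l"
    using assms by (simp_all add: C_def if_distrib[of "(*) _"] cong: if_cong)
  moreover have "(chol k l)\<^sup>2 \<le> q"
  proof -
    have "chol k l * chol k l \<le> (\<Sum>i\<le>k. chol k i * chol k i)" by (rule member_le_sum) (use assms in auto)
    then show ?thesis using chol_cov[of k k] by (simp add: power2_eq_square)
  qed
  ultimately have "(LINT c|iid_normal. X True c * f (X False c)) = chol k l * (\<beta> * (1 - q))"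
    by (intro gaussian_stein[OF X]) auto
  then show ?thesis by (simp add: X_def limit_gauss_def)
qed

definition limit_field :: "(nat \<times> nat \<Rightarrow> real) \<Rightarrow> nat \<Rightarrow> nat \<Rightarrow> real" where
  "limit_field \<zeta> k i = limit_gauss k (\<lambda>l. \<zeta> (l, i))"

lemma lln_bounded:
  assumes F[measurable]: "F \<in> borel_measurable (PiM UNIV (\<lambda>_. borel))" and B: "\<And>c. \<bar>F c\<bar> \<le> 1"
  shows "plim (\<lambda>N \<zeta>. (1 / real N) * (\<Sum>i=1..N. F (\<lambda>l. \<zeta> (l, i)))) (LINT c|iid_normal. F c)"
proof (rule weak_lln_columns[OF F])
  have [measurable]: "F \<in> borel_measurable iid_normal" using F measurable_cong_sets[OF sets_iid_normal refl] by blast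
  show "integrable iid_normal F" by (rule iid.integrable_const_bound[where B=1]) (use B in auto)
  show "integrable iid_normal (\<lambda>c. (F c)\<^sup>2)"
    by (rule iid.integrable_const_bound[where B=1]) (use B in \<open>auto simp: abs_square_le_1\<close>)
qed

lemma lln_pair: "plim (\<lambda>N \<zeta>. nip N (\<lambda>i. f (limit_field \<zeta> j i)) (\<lambda>i. f (limit_field \<zeta> k i))) (LINT c|iid_normal. f (limit_gauss j c) * f (limit_gauss k c))"
proof -
  have b: "\<bar>f (limit_gauss j c) * f (limit_gauss k c)\<bar> \<le> 1" for c
    unfolding abs_mult by (rule mult_le_one) (auto simp: f_bound)
  have m: "(\<lambda>c. f (limit_gauss j c) * f (limit_gauss k c)) \<in> borel_measurable (PiM UNIV (\<lambda>_. borel))" by measurable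
  show ?thesis using lln_bounded[OF m b] unfolding nip_def limit_field_def .
qed

lemma lln_single: "plim (\<lambda>N \<zeta>. nip N (\<lambda>i. sqrt q) (\<lambda>i. f (limit_field \<zeta> k i))) (rho 0)"
proof -
  have b: "\<bar>sqrt q * f (limit_gauss k c)\<bar> \<le> 1" for c
    unfolding abs_mult by (rule mult_le_one) (use sqrt_q_le_1 q_pos in \<open>auto simp: f_bound\<close>)
  have m: "(\<lambda>c. sqrt q * f (limit_gauss k c)) \<in> borel_measurable (PiM UNIV (\<lambda>_. borel))" by measurable
  show ?thesis using lln_bounded[OF m b] unfolding nip_def limit_field_def expect_single .
qed

lemma coordinate_moments:
  "integrable iid_normal (\<lambda>c :: nat \<Rightarrow> real. (c l)^2)" "(LINT c|iid_normal. (c l)^2) = 1"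
  "integrable iid_normal (\<lambda>c :: nat \<Rightarrow> real. (c l)^4)" "integrable iid_normal (\<lambda>c :: nat \<Rightarrow> real. c l)"
proof -
  have 1: "gaussian_family iid_normal (\<lambda>_::unit. \<lambda>c :: nat \<Rightarrow> real. c l) (\<lambda>_ _. 1)"
    using gaussian_family_reindex[OF gaussian_family_iid_normal, of "\<lambda>_::unit. l"] by simp
  have 2: "gaussian_family std_normal_distribution (\<lambda>_::unit. \<lambda>x. x) (\<lambda>_ _. 1)"
    using gaussian_family_std_normal[of "\<lambda>_::unit. 1"] by simp
  note g = gaussian_family_integral[OF 1 2]
  show "integrable iid_normal (\<lambda>c :: nat \<Rightarrow> real. (c l)^2)" "(LINT c|iid_normal. (c l)^2) = 1"
    using g[of "\<lambda>\<omega>. (\<omega> ())^2"] std_normal_second_moment by simp_all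
  show "integrable iid_normal (\<lambda>c :: nat \<Rightarrow> real. (c l)^4)"
    using g(2)[of "\<lambda>\<omega>. (\<omega> ())^4"] integrable_std_normal_distribution_moment[of 4] by simp
  show "integrable iid_normal (\<lambda>c :: nat \<Rightarrow> real. c l)"
  proof -
    have m: "(\<lambda>\<omega>::unit \<Rightarrow> real. \<omega> ()) \<in> borel_measurable (PiM UNIV (\<lambda>_. borel))" by simp
    show ?thesis by (rule g(2)[OF m, THEN iffD2]) (rule integrable_std_normal_id)
  qed
qed

lemma lln_row_norm: "plim (\<lambda>N \<zeta>. nnorm N (\<lambda>i. \<zeta> (l, i))) 1"
proof -
  have "plim (\<lambda>N \<zeta>. (1 / real N) * (\<Sum>i=1..N. (\<zeta> (l, i))\<^sup>2)) 1"
    using weak_lln_columns[of "\<lambda>c. (c l)^2"] coordinate_moments[of l] by (simp flip: power_mult)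
  from tendsto_real_sqrt[OF this] show ?thesis by (simp add: nnorm_def nip_def power2_eq_square)
qed

lemma lln_row:
  assumes "l \<le> k" shows "plim (\<lambda>N \<zeta>. nip N (\<lambda>i. \<zeta> (l, i)) (\<lambda>i. f (limit_field \<zeta> k i))) (chol k l * (\<beta> * (1 - q)))"
proof -
  have m[measurable]: "(\<lambda>c. c l * f (limit_gauss k c)) \<in> borel_measurable (PiM UNIV (\<lambda>_. borel))" by measurable
  have m'[measurable]: "(\<lambda>c. c l * f (limit_gauss k c)) \<in> borel_measurable iid_normal" by measurable
  have 1: "integrable iid_normal (\<lambda>c. c l * f (limit_gauss k c))"
    by (rule Bochner_Integration.integrable_bound[OF coordinate_moments(4)[of l]])
      (auto simp: abs_mult intro!: mult_left_le f_bound)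
  have "(c l * f (limit_gauss k c))\<^sup>2 \<le> (c l)\<^sup>2" for c
    using f_square[of "limit_gauss k c"] by (simp add: power_mult_distrib mult_left_le)
  then have 2: "integrable iid_normal (\<lambda>c. (c l * f (limit_gauss k c))\<^sup>2)"
    by (intro Bochner_Integration.integrable_bound[OF coordinate_moments(1)[of l]]) auto
  show ?thesis using weak_lln_columns[OF m 1 2] expect_stein[OF assms] unfolding nip_def limit_field_def by simp
qed

end

section \<open>Induction for fields, overlaps and directions\<close>

lemma nnorm_sum: "finite R \<Longrightarrow> nnorm N (\<lambda>i. \<Sum>r\<in>R. x r i) \<le> (\<Sum>r\<in>R. nnorm N (x r))"
proof (induction R rule: finite_induct)
  case empty
  then show ?case by (simp add: nnorm_def nip_def)
next
  case (insert r R)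
  then show ?case using nnorm_triangle[of N "x r" "\<lambda>i. \<Sum>r\<in>R. x r i"] by simp
qed

lemma plim_nip_close:
  assumes x: "plim (\<lambda>N \<zeta>. nnorm N (\<lambda>i. x N \<zeta> i - x' N \<zeta> i)) 0" and y: "plim (\<lambda>N \<zeta>. nnorm N (\<lambda>i. y N \<zeta> i - y' N \<zeta> i)) 0"
    and b: "\<And>N \<zeta>. nnorm N (x' N \<zeta>) \<le> 1" "\<And>N \<zeta>. nnorm N (y N \<zeta>) \<le> 1"
    and lim: "plim (\<lambda>N \<zeta>. nip N (x' N \<zeta>) (y' N \<zeta>)) c"
  shows "plim (\<lambda>N \<zeta>. nip N (x N \<zeta>) (y N \<zeta>)) c"
proof -
  have "plim (\<lambda>N \<zeta>. nip N (x N \<zeta>) (y N \<zeta>) - nip N (x' N \<zeta>) (y' N \<zeta>)) 0"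
  proof (rule plim_squeeze)
    show "plim (\<lambda>N \<zeta>. nnorm N (\<lambda>i. x N \<zeta> i - x' N \<zeta> i) + nnorm N (\<lambda>i. y N \<zeta> i - y' N \<zeta> i)) 0"
      using tendsto_add[OF x y] by simp
    fix N :: nat and \<zeta>
    let ?a = "nip N (\<lambda>i. x N \<zeta> i - x' N \<zeta> i) (y N \<zeta>)" and ?b = "nip N (x' N \<zeta>) (\<lambda>i. y N \<zeta> i - y' N \<zeta> i)"
    have "\<bar>?a\<bar> \<le> nnorm N (\<lambda>i. x N \<zeta> i - x' N \<zeta> i) * 1"
      by (rule order_trans[OF nip_cauchy]) (intro mult_left_mono b nnorm_nonneg)
    moreover have "\<bar>?b\<bar> \<le> 1 * nnorm N (\<lambda>i. y N \<zeta> i - y' N \<zeta> i)"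
      by (rule order_trans[OF nip_cauchy]) (intro mult_right_mono b nnorm_nonneg)
    moreover have "nip N (x N \<zeta>) (y N \<zeta>) - nip N (x' N \<zeta>) (y' N \<zeta>) = ?a + ?b" by (simp add: nip_diff)
    ultimately show "\<bar>nip N (x N \<zeta>) (y N \<zeta>) - nip N (x' N \<zeta>) (y' N \<zeta>)\<bar> \<le> nnorm N (\<lambda>i. x N \<zeta> i - x' N \<zeta> i) + nnorm N (\<lambda>i. y N \<zeta> i - y' N \<zeta> i)"
      by linarith
  qed
  from tendsto_add[OF this lim] show ?thesis by simp
qed

context tap_model
begin

lemma nnorm_sim_dir: "nnorm N (sim_dir N \<zeta> k) \<le> 1"
  using sim_dir_unit[of N \<zeta> k] by (auto simp: nnorm_def)

lemma nnorm_sim_iter: "nnorm N (sim_iter N \<zeta> k) \<le> 1"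
  by (rule nnorm_le_1) (rule sim_iter_bound)

lemma nnorm_f: "nnorm N (\<lambda>i. f (x i)) \<le> 1"
  by (rule nnorm_le_1) (rule f_bound)

text \<open>Together with \<open>dirs_ok\<close> the induction statement: the field is close in
  normalised norm to its Gaussian limit, and the Gram-Schmidt coefficients of the iterate converge
  to a row of the Cholesky factor.\<close>

definition field_ok :: "nat \<Rightarrow> bool" where
  "field_ok k \<longleftrightarrow> plim (\<lambda>N \<zeta>. nnorm N (\<lambda>i. sim_field N \<zeta> k i - limit_field \<zeta> k i)) 0"

definition dirs_ok :: "nat \<Rightarrow> bool" where
  "dirs_ok k \<longleftrightarrow> (\<forall>l\<le>k. plim (\<lambda>N \<zeta>. nip N (sim_dir N \<zeta> l) (sim_iter N \<zeta> k)) (chol k l))"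

lemma sim_iter_close:
  assumes "field_ok k"
  shows "plim (\<lambda>N \<zeta>. nnorm N (\<lambda>i. sim_iter N \<zeta> (Suc k) i - f (limit_field \<zeta> k i))) 0"
proof (rule plim_squeeze)
  show "plim (\<lambda>N \<zeta>. \<beta> * nnorm N (\<lambda>i. sim_field N \<zeta> k i - limit_field \<zeta> k i)) 0"
    using tendsto_mult[OF tendsto_const[of \<beta>] assms[unfolded field_ok_def]] by simp
  fix N :: nat and \<zeta>
  have "nnorm N (\<lambda>i. sim_iter N \<zeta> (Suc k) i - f (limit_field \<zeta> k i)) \<le> nnorm N (\<lambda>i. \<beta> * (sim_field N \<zeta> k i - limit_field \<zeta> k i))"
    unfolding sim_iter_Suc using f_lipschitz beta_pos by (intro nnorm_mono) (simp add: abs_mult)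
  also have "\<dots> = \<beta> * nnorm N (\<lambda>i. sim_field N \<zeta> k i - limit_field \<zeta> k i)" using beta_pos by (simp add: nnorm_scale)
  finally show "\<bar>nnorm N (\<lambda>i. sim_iter N \<zeta> (Suc k) i - f (limit_field \<zeta> k i))\<bar> \<le> \<beta> * nnorm N (\<lambda>i. sim_field N \<zeta> k i - limit_field \<zeta> k i)" by simp
qed

lemma overlap_self:
  assumes "field_ok k"
  shows "plim (\<lambda>N \<zeta>. nip N (sim_iter N \<zeta> (Suc k)) (sim_iter N \<zeta> (Suc k))) q"
  using plim_nip_close[OF sim_iter_close[OF assms] sim_iter_close[OF assms] nnorm_f nnorm_sim_iter lln_pair] expect_square[of k] by simp

lemma overlap_self_0: "plim (\<lambda>N \<zeta>. nip N (sim_iter N \<zeta> 0) (sim_iter N \<zeta> 0)) q"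
  by (rule plim_cong[OF tendsto_const]) (use q_pos in \<open>simp add: sim_iter_0 nip_def\<close>)

lemma overlap:
  assumes "\<And>j. j \<le> k \<Longrightarrow> field_ok j" "i \<le> k"
  shows "plim (\<lambda>N \<zeta>. nip N (sim_iter N \<zeta> i) (sim_iter N \<zeta> (Suc k))) (rho i)"
proof (cases i)
  case 0
  have s: "nnorm N (\<lambda>i. sqrt q) \<le> 1" for N by (rule nnorm_le_1) (use sqrt_q_le_1 q_pos in simp)
  have "plim (\<lambda>N \<zeta>. nnorm N (\<lambda>i. sqrt q - sqrt q)) 0" by (simp add: nnorm_def nip_def)
  then show ?thesis unfolding 0 sim_iter_0
    by (rule plim_nip_close[OF _ sim_iter_close[OF assms(1)[OF order_refl]] s nnorm_sim_iter lln_single])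
next
  case (Suc j)
  then have "j < k" using assms by simp
  then show ?thesis unfolding Suc
    using plim_nip_close[OF sim_iter_close[OF assms(1)[of j]] sim_iter_close[OF assms(1)[OF order_refl]] nnorm_f nnorm_sim_iter lln_pair] expect_pair[of j k]
    by simp
qed

text \<open>The finite-dimensional counterpart of the Cholesky recursion, with overlaps in place of
  covariances; the denominator converges to a pivot.\<close>

lemma nip_sim_dir_recursion:
  "nip N (sim_dir N \<zeta> l) z = (nip N (sim_iter N \<zeta> l) z - (\<Sum>r<l. nip N (sim_dir N \<zeta> r) (sim_iter N \<zeta> l) * nip N (sim_dir N \<zeta> r) z)) / nip N (sim_dir N \<zeta> l) (sim_iter N \<zeta> l)"
proof -
  have "nip N (sim_dir N \<zeta> l) z = nip N (deflate N (sim_dir N \<zeta>) l (sim_iter N \<zeta> l)) z / nip N (sim_dir N \<zeta> l) (sim_iter N \<zeta> l)"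
    unfolding nip_sim_dir_sim_iter by (subst sim_dir_eq) (rule nip_normalize(1)[OF refl])
  also have "nip N (deflate N (sim_dir N \<zeta>) l (sim_iter N \<zeta> l)) z = nip N (sim_iter N \<zeta> l) z - (\<Sum>r<l. nip N (sim_dir N \<zeta> r) (sim_iter N \<zeta> l) * nip N (sim_dir N \<zeta> r) z)"
    by (subst nip_commute) (simp only: nip_deflate nip_commute[of N z])
  finally show ?thesis .
qed

lemma nip_sim_dir_self:
  "nip N (sim_dir N \<zeta> k) (sim_iter N \<zeta> k) = sqrt (nip N (sim_iter N \<zeta> k) (sim_iter N \<zeta> k) - (\<Sum>r<k. (nip N (sim_dir N \<zeta> r) (sim_iter N \<zeta> k))\<^sup>2))"
proof -
  let ?d = "deflate N (sim_dir N \<zeta>) k" and ?m = "sim_iter N \<zeta> k"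
  have "nip N (?d ?m) (?d ?m) = nip N (?d ?m) ?m - (\<Sum>r<k. nip N (sim_dir N \<zeta> r) ?m * nip N (?d ?m) (sim_dir N \<zeta> r))" by (rule nip_deflate)
  also have "(\<Sum>r<k. nip N (sim_dir N \<zeta> r) ?m * nip N (?d ?m) (sim_dir N \<zeta> r)) = 0"
    by (rule sum.neutral) (use nip_dir_deflate[OF sim_dir_orthonormal] in \<open>simp add: nip_commute[of N "?d ?m"]\<close>)
  also have "nip N (?d ?m) ?m = nip N ?m (?d ?m)" by (rule nip_commute)
  also have "\<dots> = nip N ?m ?m - (\<Sum>r<k. (nip N (sim_dir N \<zeta> r) ?m)\<^sup>2)"
    unfolding nip_deflate power2_eq_square by (simp only: nip_commute[of N ?m "sim_dir N \<zeta> _"])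
  finally show ?thesis unfolding nip_sim_dir_sim_iter nnorm_def by simp
qed

lemma dirs_ok_0: "dirs_ok 0"
proof -
  have "plim (\<lambda>N \<zeta>. nip N (sim_dir N \<zeta> 0) (sim_iter N \<zeta> 0)) (sqrt q)"
    using tendsto_real_sqrt[OF overlap_self_0] by (simp add: nip_sim_dir_self)
  then show ?thesis by (simp add: dirs_ok_def chol_def chol_diag_def)
qed

text \<open>The recursion passes to the limit term by term because the limiting pivots
  \<open>chol_diag\<close> are positive. The last coefficient follows from Pythagoras.\<close>

lemma dirs_ok_Suc:
  assumes "\<And>j. j \<le> k \<Longrightarrow> field_ok j" "\<And>j. j \<le> k \<Longrightarrow> dirs_ok j"
  shows "dirs_ok (Suc k)"
proof -
  have 1: "plim (\<lambda>N \<zeta>. nip N (sim_dir N \<zeta> l) (sim_iter N \<zeta> (Suc k))) (chol_off l)" if "l \<le> k" for l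
    using that
  proof (induction l rule: less_induct)
    case (less l)
    have d: "plim (\<lambda>N \<zeta>. nip N (sim_dir N \<zeta> r) (sim_iter N \<zeta> l)) (chol l r)" if "r \<le> l" for r
      using assms(2)[OF less.prems] that by (auto simp: dirs_ok_def)
    have "plim (\<lambda>N \<zeta>. (nip N (sim_iter N \<zeta> l) (sim_iter N \<zeta> (Suc k)) - (\<Sum>r<l. nip N (sim_dir N \<zeta> r) (sim_iter N \<zeta> l) * nip N (sim_dir N \<zeta> r) (sim_iter N \<zeta> (Suc k)))) / nip N (sim_dir N \<zeta> l) (sim_iter N \<zeta> l))
       ((rho l - (\<Sum>r<l. chol l r * chol_off r)) / chol l l)"
      by (intro tendsto_divide tendsto_diff tendsto_sum tendsto_mult d overlap[OF assms(1) less.prems] less.IH)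
         (use less.prems chol_diag_pos[of l] in \<open>auto simp: chol_def\<close>)
    moreover have "(\<Sum>r<l. chol l r * chol_off r) = chol_sum l"
      unfolding chol_sum_eq power2_eq_square by (intro sum.cong refl) (simp add: chol_def)
    then have "(rho l - (\<Sum>r<l. chol l r * chol_off r)) / chol l l = chol_off l"
      by (simp add: chol_def chol_off_def chol_diag_def)
    ultimately show ?case by (subst nip_sim_dir_recursion) simp
  qed
  have "plim (\<lambda>N \<zeta>. sqrt (nip N (sim_iter N \<zeta> (Suc k)) (sim_iter N \<zeta> (Suc k)) - (\<Sum>r<Suc k. (nip N (sim_dir N \<zeta> r) (sim_iter N \<zeta> (Suc k)))\<^sup>2)))
      (sqrt (q - (\<Sum>r<Suc k. (chol_off r)\<^sup>2)))"
    by (intro tendsto_real_sqrt tendsto_diff tendsto_sum tendsto_power overlap_self[OF assms(1)[OF order_refl]] 1) simp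
  then have 2: "plim (\<lambda>N \<zeta>. nip N (sim_dir N \<zeta> (Suc k)) (sim_iter N \<zeta> (Suc k))) (chol_diag (Suc k))"
    unfolding nip_sim_dir_self[symmetric] chol_sum_eq[symmetric] chol_diag_def .
  show ?thesis unfolding dirs_ok_def
  proof (intro allI impI)
    fix l assume "l \<le> Suc k"
    then show "plim (\<lambda>N \<zeta>. nip N (sim_dir N \<zeta> l) (sim_iter N \<zeta> (Suc k))) (chol (Suc k) l)"
      using 1[of l] 2 by (cases "l = Suc k") (auto simp: chol_def)
  qed
qed

text \<open>The expression is the coefficient of direction \<open>l\<close> in the field, apart from
  the terms from deflating row \<open>l\<close>. For \<open>l < k\<close> the iterate is close to
  \<open>f\<close> of the limit field \<open>k - 1\<close>, so its product with row \<open>l\<close>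
  tends to \<open>chol (k - 1) l * (\<beta> * (1 - q))\<close>, and the Onsager term has the same
  limit. For \<open>l = k\<close> the deflated iterate is zero. The term with \<open>sqrt 2\<close>
  vanishes by independence of direction and row.\<close>

lemma onsager_cancels:
  assumes dirs: "\<And>j. j \<le> k \<Longrightarrow> dirs_ok j" and fields: "\<And>j. j < k \<Longrightarrow> field_ok j" and l: "l \<le> k"
  shows "plim (\<lambda>N \<zeta>. nip N (\<lambda>i. \<zeta> (l, i)) (deflate N (sim_dir N \<zeta>) (Suc l) (sim_iter N \<zeta> k))
      + sqrt 2 * nip N (sim_dir N \<zeta> l) (\<lambda>i. \<zeta> (l, i)) * nip N (sim_dir N \<zeta> l) (sim_iter N \<zeta> k)
      - \<beta> * (1 - q) * (if l < k then nip N (sim_dir N \<zeta> l) (sim_iter N \<zeta> (k - 1)) else 0)) 0"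
proof -
  have c: "plim (\<lambda>N \<zeta>. nip N (sim_dir N \<zeta> r) (sim_iter N \<zeta> k)) (chol k r)" if "r \<le> k" for r
    using dirs[OF order_refl] that by (simp add: dirs_ok_def)
  have A: "plim (\<lambda>N \<zeta>. nip N (\<lambda>i. \<zeta> (l, i)) (deflate N (sim_dir N \<zeta>) (Suc l) (sim_iter N \<zeta> k))
      - \<beta> * (1 - q) * (if l < k then nip N (sim_dir N \<zeta> l) (sim_iter N \<zeta> (k - 1)) else 0)) 0"
  proof (cases "l = k")
    case True
    then show ?thesis by (simp add: nip_deflate_sim_iter)
  next
    case False
    then obtain k' where k': "k = Suc k'" "l \<le> k'" using l by (cases k) auto
    have close: "plim (\<lambda>N \<zeta>. nip N (\<lambda>i. \<zeta> (l, i)) (\<lambda>i. sim_iter N \<zeta> k i - f (limit_field \<zeta> k' i))) 0"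
    proof (rule plim_squeeze[OF _ nip_cauchy])
      show "plim (\<lambda>N \<zeta>. nnorm N (\<lambda>i. \<zeta> (l, i)) * nnorm N (\<lambda>i. sim_iter N \<zeta> k i - f (limit_field \<zeta> k' i))) 0"
        using tendsto_mult[OF lln_row_norm[of l] sim_iter_close[OF fields[of k']]] k' by simp
    qed
    have 1: "plim (\<lambda>N \<zeta>. nip N (\<lambda>i. \<zeta> (l, i)) (sim_iter N \<zeta> k)) (chol k' l * (\<beta> * (1 - q)))"
      using tendsto_add[OF close lln_row[OF k'(2)]] by (simp add: nip_diff)
    \<comment> \<open>The deflation is invisible in the limit, as row \<open>l\<close> is
      independent of the directions up to \<open>l\<close>.\<close>
    have 2: "plim (\<lambda>N \<zeta>. \<Sum>r<Suc l. nip N (sim_dir N \<zeta> r) (sim_iter N \<zeta> k) * nip N (\<lambda>i. \<zeta> (l, i)) (sim_dir N \<zeta> r)) (\<Sum>r<Suc l. chol k r * 0)"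
    proof (intro tendsto_sum tendsto_mult c)
      fix r assume "r \<in> {..<Suc l}"
      then show "r \<le> k" "plim (\<lambda>N \<zeta>. nip N (\<lambda>i. \<zeta> (l, i)) (sim_dir N \<zeta> r)) 0"
        using plim_nip_sim_dir_row[of r l] l by (auto simp: nip_commute)
    qed
    have 3: "plim (\<lambda>N \<zeta>. nip N (sim_dir N \<zeta> l) (sim_iter N \<zeta> k')) (chol k' l)"
      using dirs[of k'] k' by (simp add: dirs_ok_def)
    have "plim (\<lambda>N \<zeta>. (nip N (\<lambda>i. \<zeta> (l, i)) (sim_iter N \<zeta> k) - (\<Sum>r<Suc l. nip N (sim_dir N \<zeta> r) (sim_iter N \<zeta> k) * nip N (\<lambda>i. \<zeta> (l, i)) (sim_dir N \<zeta> r)))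
        - \<beta> * (1 - q) * nip N (sim_dir N \<zeta> l) (sim_iter N \<zeta> k')) ((chol k' l * (\<beta> * (1 - q)) - (\<Sum>r<Suc l. chol k r * 0)) - \<beta> * (1 - q) * chol k' l)"
      by (intro tendsto_diff tendsto_mult tendsto_const 1 2 3)
    then show ?thesis using k' unfolding nip_deflate by simp
  qed
  have B: "plim (\<lambda>N \<zeta>. sqrt 2 * nip N (sim_dir N \<zeta> l) (\<lambda>i. \<zeta> (l, i)) * nip N (sim_dir N \<zeta> l) (sim_iter N \<zeta> k)) (sqrt 2 * 0 * chol k l)"
    by (intro tendsto_mult tendsto_const plim_nip_sim_dir_row c l order_refl)
  show ?thesis using tendsto_add[OF A B] by (simp add: algebra_simps)
qed

lemma field_ok_step:
  assumes dirs: "\<And>j. j \<le> k \<Longrightarrow> dirs_ok j" and fields: "\<And>j. j < k \<Longrightarrow> field_ok j"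
  shows "field_ok k"
proof -
  define c where "c N \<zeta> l = nip N (sim_dir N \<zeta> l) (sim_iter N \<zeta> k)" for N \<zeta> l
  define s where "s N \<zeta> r l = nip N (sim_dir N \<zeta> r) (\<lambda>i. \<zeta> (l, i))" for N and \<zeta> :: "nat \<times> nat \<Rightarrow> real" and r l :: nat
  define e where "e N \<zeta> l = nip N (\<lambda>i. \<zeta> (l, i)) (deflate N (sim_dir N \<zeta>) (Suc l) (sim_iter N \<zeta> k)) + sqrt 2 * s N \<zeta> l l * c N \<zeta> l
      - \<beta> * (1 - q) * (if l < k then nip N (sim_dir N \<zeta> l) (sim_iter N \<zeta> (k - 1)) else 0)" for N \<zeta> l
  \<comment> \<open>The error from row \<open>l\<close>: the coefficient of the row itself, the
    components removed by deflating the row, and the cancelling coefficient \<open>e\<close> of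
    direction \<open>l\<close>. Each has a vanishing factor in front of a vector of bounded
    norm.\<close>
  define T where "T N \<zeta> l i = (c N \<zeta> l - chol k l) * \<zeta> (l, i) + ((\<Sum>r<Suc l. (- (c N \<zeta> l * s N \<zeta> r l)) * sim_dir N \<zeta> r i) + e N \<zeta> l * sim_dir N \<zeta> l i)" for N \<zeta> l i
  have diff: "sim_field N \<zeta> k i - limit_field \<zeta> k i = (\<Sum>l\<le>k. T N \<zeta> l i)" if i: "i \<in> {1..N}" for N \<zeta> i
  proof -
    \<comment> \<open>The previous iterate is expanded in the directions, so that the Onsager term
      can be matched direction by direction.\<close>
    have prev: "(if k = 0 then 0 else sim_iter N \<zeta> (k - 1) i) = (\<Sum>l\<le>k. (if l < k then nip N (sim_dir N \<zeta> l) (sim_iter N \<zeta> (k - 1)) else 0) * sim_dir N \<zeta> l i)"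
    proof (cases k)
      case (Suc k')
      have "(\<Sum>l\<le>k. (if l < k then nip N (sim_dir N \<zeta> l) (sim_iter N \<zeta> (k - 1)) else 0) * sim_dir N \<zeta> l i) = (\<Sum>l\<le>k'. nip N (sim_dir N \<zeta> l) (sim_iter N \<zeta> k') * sim_dir N \<zeta> l i)"
        unfolding Suc by (simp add: sum.atMost_Suc)
      then show ?thesis using sim_iter_expansion[OF i, of \<zeta> k'] Suc by simp
    qed simp
    have "sim_field N \<zeta> k i - limit_field \<zeta> k i = (\<Sum>l\<le>k. c N \<zeta> l * deflate N (sim_dir N \<zeta>) (Suc l) (\<lambda>i. \<zeta> (l, i)) i
        + sim_dir N \<zeta> l i * (nip N (\<lambda>i. \<zeta> (l, i)) (deflate N (sim_dir N \<zeta>) (Suc l) (sim_iter N \<zeta> k)) + sqrt 2 * s N \<zeta> l l * c N \<zeta> l)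
        - \<beta> * (1 - q) * ((if l < k then nip N (sim_dir N \<zeta> l) (sim_iter N \<zeta> (k - 1)) else 0) * sim_dir N \<zeta> l i) - chol k l * \<zeta> (l, i))"
      unfolding sim_field_def prev known_field_def limit_field_def limit_gauss_def lessThan_Suc_atMost c_def s_def
      by (simp only: sum_subtractf sum_distrib_left)
    also have "\<dots> = (\<Sum>l\<le>k. T N \<zeta> l i)"
    proof (rule sum.cong[OF refl])
      fix l
      have d: "c N \<zeta> l * deflate N (sim_dir N \<zeta>) (Suc l) (\<lambda>i. \<zeta> (l, i)) i = c N \<zeta> l * \<zeta> (l, i) + (\<Sum>r<Suc l. (- (c N \<zeta> l * s N \<zeta> r l)) * sim_dir N \<zeta> r i)"
        unfolding deflate_def s_def by (simp only: right_diff_distrib sum_distrib_left minus_mult_left[symmetric] sum_negf mult.assoc)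
      show "c N \<zeta> l * deflate N (sim_dir N \<zeta>) (Suc l) (\<lambda>i. \<zeta> (l, i)) i
        + sim_dir N \<zeta> l i * (nip N (\<lambda>i. \<zeta> (l, i)) (deflate N (sim_dir N \<zeta>) (Suc l) (sim_iter N \<zeta> k)) + sqrt 2 * s N \<zeta> l l * c N \<zeta> l)
        - \<beta> * (1 - q) * ((if l < k then nip N (sim_dir N \<zeta> l) (sim_iter N \<zeta> (k - 1)) else 0) * sim_dir N \<zeta> l i) - chol k l * \<zeta> (l, i) = T N \<zeta> l i"
        unfolding d T_def e_def by (simp only: ring_distribs) (simp only: mult_ac add_ac diff_conv_add_uminus minus_add_distrib)
    qed
    finally show ?thesis .
  qed
  have bound: "nnorm N (\<lambda>i. sim_field N \<zeta> k i - limit_field \<zeta> k i)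
      \<le> (\<Sum>l\<le>k. \<bar>c N \<zeta> l - chol k l\<bar> * nnorm N (\<lambda>i. \<zeta> (l, i)) + ((\<Sum>r<Suc l. \<bar>c N \<zeta> l * s N \<zeta> r l\<bar>) + \<bar>e N \<zeta> l\<bar>))" for N \<zeta>
  proof -
    have sc: "nnorm N (\<lambda>i. a * sim_dir N \<zeta> r i) \<le> \<bar>a\<bar>" for a r
      unfolding nnorm_scale using nnorm_sim_dir[of N \<zeta> r] by (simp add: mult_left_le)
    have "nnorm N (\<lambda>i. sim_field N \<zeta> k i - limit_field \<zeta> k i) = nnorm N (\<lambda>i. \<Sum>l\<le>k. T N \<zeta> l i)"
      by (rule nnorm_cong) (rule diff)
    also have "\<dots> \<le> (\<Sum>l\<le>k. nnorm N (T N \<zeta> l))" by (rule nnorm_sum) simp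
    also have "\<dots> \<le> (\<Sum>l\<le>k. \<bar>c N \<zeta> l - chol k l\<bar> * nnorm N (\<lambda>i. \<zeta> (l, i)) + ((\<Sum>r<Suc l. \<bar>c N \<zeta> l * s N \<zeta> r l\<bar>) + \<bar>e N \<zeta> l\<bar>))"
    proof (rule sum_mono)
      fix l
      have "nnorm N (T N \<zeta> l) \<le> nnorm N (\<lambda>i. (c N \<zeta> l - chol k l) * \<zeta> (l, i))
          + nnorm N (\<lambda>i. (\<Sum>r<Suc l. (- (c N \<zeta> l * s N \<zeta> r l)) * sim_dir N \<zeta> r i) + e N \<zeta> l * sim_dir N \<zeta> l i)"
        unfolding T_def by (rule nnorm_triangle)
      also have "nnorm N (\<lambda>i. (\<Sum>r<Suc l. (- (c N \<zeta> l * s N \<zeta> r l)) * sim_dir N \<zeta> r i) + e N \<zeta> l * sim_dir N \<zeta> l i)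
         \<le> nnorm N (\<lambda>i. \<Sum>r<Suc l. (- (c N \<zeta> l * s N \<zeta> r l)) * sim_dir N \<zeta> r i) + nnorm N (\<lambda>i. e N \<zeta> l * sim_dir N \<zeta> l i)"
        by (rule nnorm_triangle)
      also have "nnorm N (\<lambda>i. \<Sum>r<Suc l. (- (c N \<zeta> l * s N \<zeta> r l)) * sim_dir N \<zeta> r i) \<le> (\<Sum>r<Suc l. nnorm N (\<lambda>i. (- (c N \<zeta> l * s N \<zeta> r l)) * sim_dir N \<zeta> r i))"
        by (rule nnorm_sum) simp
      also have "\<dots> \<le> (\<Sum>r<Suc l. \<bar>c N \<zeta> l * s N \<zeta> r l\<bar>)"
        by (rule sum_mono) (rule order_trans[OF sc], simp)
      also have "nnorm N (\<lambda>i. e N \<zeta> l * sim_dir N \<zeta> l i) \<le> \<bar>e N \<zeta> l\<bar>" by (rule sc)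
      finally show "nnorm N (T N \<zeta> l) \<le> \<bar>c N \<zeta> l - chol k l\<bar> * nnorm N (\<lambda>i. \<zeta> (l, i)) + ((\<Sum>r<Suc l. \<bar>c N \<zeta> l * s N \<zeta> r l\<bar>) + \<bar>e N \<zeta> l\<bar>)"
        unfolding nnorm_scale by simp
    qed
    finally show ?thesis .
  qed
  have lim: "plim (\<lambda>N \<zeta>. \<Sum>l\<le>k. \<bar>c N \<zeta> l - chol k l\<bar> * nnorm N (\<lambda>i. \<zeta> (l, i)) + ((\<Sum>r<Suc l. \<bar>c N \<zeta> l * s N \<zeta> r l\<bar>) + \<bar>e N \<zeta> l\<bar>))
     (\<Sum>l\<le>k. \<bar>chol k l - chol k l\<bar> * 1 + ((\<Sum>r<Suc l. \<bar>chol k l * 0\<bar>) + \<bar>0\<bar>))"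
  proof (rule tendsto_sum)
    fix l assume "l \<in> {..k}"
    then have l: "l \<le> k" by simp
    have cl: "plim (\<lambda>N \<zeta>. c N \<zeta> l) (chol k l)"
      using dirs[OF order_refl] l by (simp add: dirs_ok_def c_def)
    have sl: "plim (\<lambda>N \<zeta>. s N \<zeta> r l) 0" if "r \<in> {..<Suc l}" for r
      unfolding s_def by (rule plim_nip_sim_dir_row) (use that in simp)
    have el: "plim (\<lambda>N \<zeta>. e N \<zeta> l) 0"
      unfolding e_def s_def c_def by (rule onsager_cancels[OF dirs fields l])
    show "plim (\<lambda>N \<zeta>. \<bar>c N \<zeta> l - chol k l\<bar> * nnorm N (\<lambda>i. \<zeta> (l, i)) + ((\<Sum>r<Suc l. \<bar>c N \<zeta> l * s N \<zeta> r l\<bar>) + \<bar>e N \<zeta> l\<bar>))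
      (\<bar>chol k l - chol k l\<bar> * 1 + ((\<Sum>r<Suc l. \<bar>chol k l * 0\<bar>) + \<bar>0\<bar>))"
      by (intro tendsto_add tendsto_mult tendsto_sum tendsto_rabs tendsto_diff tendsto_const cl sl el lln_row_norm)
  qed
  show ?thesis unfolding field_ok_def
    by (rule plim_squeeze[OF lim[simplified]]) (use bound in simp)
qed

text \<open>Within one step the coefficients come before the field: they use fields of smaller index
  only, while the field of index \<open>k\<close> uses the coefficients of iterate
  \<open>k\<close>.\<close>

lemma state_evolution: "field_ok k" "dirs_ok k"
proof (atomize(full), induction k rule: less_induct)
  case (less k)
  then have IH: "field_ok j" "dirs_ok j" if "j < k" for j using that by auto
  have dirs: "dirs_ok k"
  proof (cases k)
    case 0
    then show ?thesis using dirs_ok_0 by simp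
  next
    case (Suc k')
    then show ?thesis using dirs_ok_Suc[of k'] IH by simp
  qed
  have "field_ok k"
  proof (rule field_ok_step)
    show "dirs_ok j" if "j \<le> k" for j using that dirs IH(2) by (cases "j = k") auto
  qed (rule IH)
  then show ?case using dirs by simp
qed

lemma overlap_limit: "j < k \<Longrightarrow> plim (\<lambda>N \<zeta>. nip N (sim_iter N \<zeta> j) (sim_iter N \<zeta> k)) (rho j)"
  using overlap[OF state_evolution(1), of j "k - 1"] by (cases k) auto

lemma overlap_self_limit: "plim (\<lambda>N \<zeta>. nip N (sim_iter N \<zeta> k) (sim_iter N \<zeta> k)) q"
  using overlap_self[OF state_evolution(1)] overlap_self_0 by (cases k) auto

lemma sim_iter_msd_limit:
  assumes "j < k"
  shows "(\<lambda>N. LINT \<zeta>|iid_normal. (nnorm N (\<lambda>i. sim_iter N \<zeta> j i - sim_iter N \<zeta> k i))\<^sup>2) \<longlonglongrightarrow> 2 * (q - rho j)"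
proof (rule iid.bounded_convergence_in_prob[where B=4])
  show "(\<lambda>\<zeta>. (nnorm N (\<lambda>i. sim_iter N \<zeta> j i - sim_iter N \<zeta> k i))\<^sup>2) \<in> borel_measurable iid_normal" for N
    by (intro borel_measurable_power nnorm_measurable) measurable
  show "\<bar>(nnorm N (\<lambda>i. sim_iter N \<zeta> j i - sim_iter N \<zeta> k i))\<^sup>2\<bar> \<le> 4" for N \<zeta>
  proof -
    have "nnorm N (\<lambda>i. sim_iter N \<zeta> j i - sim_iter N \<zeta> k i) \<le> 2"
      using nnorm_diff_triangle[of N "sim_iter N \<zeta> j" "sim_iter N \<zeta> k"] nnorm_sim_iter[of N \<zeta> j] nnorm_sim_iter[of N \<zeta> k] by linarith
    then have "(nnorm N (\<lambda>i. sim_iter N \<zeta> j i - sim_iter N \<zeta> k i))\<^sup>2 \<le> 2\<^sup>2" by (rule power_mono) simp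
    then show ?thesis by simp
  qed
  have "plim (\<lambda>N \<zeta>. nip N (sim_iter N \<zeta> j) (sim_iter N \<zeta> j) + nip N (sim_iter N \<zeta> k) (sim_iter N \<zeta> k) - 2 * nip N (sim_iter N \<zeta> j) (sim_iter N \<zeta> k)) (q + q - 2 * rho j)"
    by (intro tendsto_diff tendsto_add tendsto_mult tendsto_const overlap_limit[OF assms] overlap_self_limit)
  moreover have "(nnorm N (\<lambda>i. sim_iter N \<zeta> j i - sim_iter N \<zeta> k i))\<^sup>2 = nip N (sim_iter N \<zeta> j) (sim_iter N \<zeta> j) + nip N (sim_iter N \<zeta> k) (sim_iter N \<zeta> k) - 2 * nip N (sim_iter N \<zeta> j) (sim_iter N \<zeta> k)" for N \<zeta>
    unfolding nip_self[symmetric] nip_diff by (simp add: nip_commute)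
  ultimately show "plim (\<lambda>N \<zeta>. (nnorm N (\<lambda>i. sim_iter N \<zeta> j i - sim_iter N \<zeta> k i))\<^sup>2) (2 * (q - rho j))"
    by (simp only: right_diff_distrib mult_2)
qed

end

section \<open>The vanishing diagonal\<close>

text \<open>Already divided by \<open>sqrt N\<close>, unlike \<open>sym_mat\<close>; a model of the
  zero-diagonal matrix on the space of the GOE.\<close>

definition off_diag :: "nat \<Rightarrow> (nat \<times> nat \<Rightarrow> real) \<Rightarrow> nat \<times> nat \<Rightarrow> real" where
  "off_diag N W a = (if fst a = snd a then 0 else sym_mat N W a / sqrt (real N))"

text \<open>The bilinear form is tested with \<open>?x\<close>, the image of \<open>v\<close>
  itself, and one factor of its norm is cancelled. Symmetrisation contributes two forms over
  \<open>sqrt 2\<close>, hence the constant \<open>sqrt 2 * K\<close>.\<close>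

lemma matvec_sym_bound:
  assumes W: "\<forall>x y. bform N x y W \<le> K * sqrt N * N * (nnorm N x * nnorm N y)" and N: "N \<ge> 1" and K: "K > 0"
  shows "nnorm N (matvec N (\<lambda>i j. sym_mat N W (i, j) / sqrt N) v) \<le> sqrt 2 * K * nnorm N v"
proof -
  let ?x = "matvec N (\<lambda>i j. sym_mat N W (i, j) / sqrt N) v"
  have "(\<Sum>i=1..N. ?x i * ?x i) = (\<Sum>i=1..N. \<Sum>j=1..N. ?x i * v j * (W (i, j) + W (j, i)) / (sqrt 2 * sqrt N))"
    unfolding matvec_def[of N _ v] sum_distrib_left by (intro sum.cong refl) (simp add: sym_mat_def)
  also have "\<dots> = (\<Sum>i=1..N. \<Sum>j=1..N. ?x i * v j * (W (i, j) + W (j, i))) / (sqrt 2 * sqrt N)"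
    by (simp add: sum_divide_distrib)
  also have "(\<Sum>i=1..N. \<Sum>j=1..N. ?x i * v j * (W (i, j) + W (j, i))) = (\<Sum>i=1..N. \<Sum>j=1..N. ?x i * v j * W (i, j)) + (\<Sum>i=1..N. \<Sum>j=1..N. ?x i * v j * W (j, i))"
    by (simp only: distrib_left sum.distrib)
  also have "(\<Sum>i=1..N. \<Sum>j=1..N. ?x i * v j * W (i, j)) = bform N ?x v W" by (simp add: bform_def)
  also have "(\<Sum>i=1..N. \<Sum>j=1..N. ?x i * v j * W (j, i)) = bform N v ?x W"
    unfolding bform_def by (subst sum.swap) (simp only: mult.commute mult.left_commute)
  finally have e: "(\<Sum>i=1..N. ?x i * ?x i) = (bform N ?x v W + bform N v ?x W) / (sqrt 2 * sqrt N)" .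
  have "bform N ?x v W + bform N v ?x W \<le> 2 * (K * sqrt N * N * (nnorm N ?x * nnorm N v))"
    using W[rule_format, of ?x v] W[rule_format, of v ?x] by (simp add: mult.commute mult.left_commute)
  then have "(\<Sum>i=1..N. ?x i * ?x i) \<le> 2 * (K * sqrt N * N * (nnorm N ?x * nnorm N v)) / (sqrt 2 * sqrt N)"
    unfolding e by (rule divide_right_mono) simp
  also have "\<dots> = (2 / sqrt 2) * K * N * (nnorm N ?x * nnorm N v)" using N by simp
  also have "2 / sqrt 2 = sqrt 2" by (rule real_div_sqrt) simp
  finally have "(\<Sum>i=1..N. ?x i * ?x i) / N \<le> (sqrt 2 * K * N * (nnorm N ?x * nnorm N v)) / N"
    by (rule divide_right_mono) simp
  then have "nip N ?x ?x \<le> sqrt 2 * K * (nnorm N ?x * nnorm N v)" using N by (simp add: nip_def)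
  then have le: "nnorm N ?x * nnorm N ?x \<le> (sqrt 2 * K * nnorm N v) * nnorm N ?x"
    unfolding nip_self by (simp add: power2_eq_square mult_ac)
  show ?thesis
  proof (cases "nnorm N ?x = 0")
    case True
    then show ?thesis using K by simp
  next
    case False
    then have "nnorm N ?x > 0" using nnorm_nonneg[of N ?x] by (simp only: less_le) simp
    then show ?thesis using le by (rule mult_right_le_imp_le[rotated])
  qed
qed

text \<open>The scaled diagonal entries have variance \<open>2 / N\<close>, and the squared norm
  averages over the \<open>N\<close> sites.\<close>

lemma diagonal_small: "plim (\<lambda>N W. nnorm N (\<lambda>i. sym_mat N W (i, i) / sqrt N)) 0"
proof (rule iid.tendsto_prob_filter_L2)
  let ?X = "\<lambda>N W. nnorm N (\<lambda>i. sym_mat N W (i, i) / sqrt N)"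
  have ii: "integrable iid_normal (\<lambda>W :: nat \<times> nat \<Rightarrow> real. (W a)\<^sup>2)" "(LINT W|iid_normal. (W a)\<^sup>2) = 1" for a :: "nat \<times> nat"
  proof -
    have 1: "gaussian_family iid_normal (\<lambda>_::unit. \<lambda>W :: nat \<times> nat \<Rightarrow> real. W a) (\<lambda>_ _. 1)"
      using gaussian_family_reindex[OF gaussian_family_iid_normal, of "\<lambda>_::unit. a"] by simp
    have 2: "gaussian_family std_normal_distribution (\<lambda>_::unit. \<lambda>x. x) (\<lambda>_ _. 1)"
      using gaussian_family_std_normal[of "\<lambda>_::unit. 1"] by simp
    have m: "(\<lambda>\<omega>::unit \<Rightarrow> real. (\<omega> ())\<^sup>2) \<in> borel_measurable (PiM UNIV (\<lambda>_. borel))" by measurable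
    show "integrable iid_normal (\<lambda>W :: nat \<times> nat \<Rightarrow> real. (W a)\<^sup>2)"
      by (rule gaussian_family_integral(2)[OF 1 2 m, THEN iffD2]) (rule std_normal_second_moment)
    show "(LINT W|iid_normal. (W a)\<^sup>2) = 1"
      by (rule trans[OF gaussian_family_integral(1)[OF 1 2 m] std_normal_second_moment(1)])
  qed
  have sq: "(?X N W - 0)\<^sup>2 = (2 / (real N)\<^sup>2) * (\<Sum>i=1..N. (W (i, i))\<^sup>2)" for N W
  proof -
    have "(?X N W - 0)\<^sup>2 = nip N (\<lambda>i. sym_mat N W (i, i) / sqrt N) (\<lambda>i. sym_mat N W (i, i) / sqrt N)" by (simp add: nip_self)
    also have "\<dots> = 1 / real N * (\<Sum>i=1..N. 2 * (W (i, i))\<^sup>2 / real N)"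
      unfolding nip_def
    proof (intro arg_cong2[where f="(*)"] refl sum.cong)
      fix i assume i: "i \<in> {1..N}"
      then have "sym_mat N W (i, i) / sqrt N = (2 / sqrt 2) * W (i, i) / sqrt N" by (simp add: sym_mat_def)
      also have "2 / sqrt 2 = sqrt 2" by (rule real_div_sqrt) simp
      finally have e: "sym_mat N W (i, i) / sqrt N = sqrt 2 * W (i, i) / sqrt N" .
      show "sym_mat N W (i, i) / sqrt N * (sym_mat N W (i, i) / sqrt N) = 2 * (W (i, i))\<^sup>2 / real N"
        unfolding e by (simp add: power2_eq_square)
    qed
    also have "\<dots> = (2 / (real N)\<^sup>2) * (\<Sum>i=1..N. (W (i, i))\<^sup>2)" by (simp add: sum_distrib_left power2_eq_square)
    finally show ?thesis .
  qed
  show "?X N \<in> borel_measurable iid_normal" for N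
    using measurable_matrix_entry[OF measurable_sym_mat] by (intro nnorm_measurable) measurable
  show "integrable iid_normal (\<lambda>W. (?X N W - 0)\<^sup>2)" for N unfolding sq by (intro integrable_mult_right Bochner_Integration.integrable_sum ii)
  show "iid.expectation (\<lambda>W. (?X N W - 0)\<^sup>2) \<le> 2 / real N" if "N \<ge> 1" for N
  proof -
    have "iid.expectation (\<lambda>W. \<Sum>i=1..N. (W (i, i))\<^sup>2) = real N"
      by (subst Bochner_Integration.integral_sum) (simp_all add: ii)
    then have "iid.expectation (\<lambda>W. (?X N W - 0)\<^sup>2) = (2 / (real N)\<^sup>2) * real N" unfolding sq by simp
    then show ?thesis by (simp add: power2_eq_square)
  qed
  show "(\<lambda>N. 2 / real N) \<longlonglongrightarrow> 0" by (rule lim_const_over_n)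
qed

section \<open>The law of the zero-diagonal matrix\<close>

lemma gaussian_family_off_diag:
  "gaussian_family iid_normal (\<lambda>a W. off_diag N W a)
      (\<lambda>a b. if fst a = snd a \<or> fst b = snd b then 0
         else (unit_entry N (fst a) (fst b) * unit_entry N (snd a) (snd b) + unit_entry N (fst a) (snd b) * unit_entry N (snd a) (fst b)) / real N)"
  by (rule gaussian_family_cong[OF gaussian_family_linear[OF gaussian_family_sym_mat, of "\<lambda>a. {a}" "\<lambda>a _. if fst a = snd a then 0 else 1 / sqrt (real N)"]])
     (auto simp: off_diag_def)

lemma iexp_normal:
  assumes M: "prob_space M" and d: "distributed M lborel X (normal_density 0 (1 / sqrt (real N)))" and N: "N \<ge> 1"
  shows "(CLINT \<omega>|M. iexp (t * X \<omega>)) = complex_of_real (exp (- (t\<^sup>2 / real N) / 2))"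
proof -
  interpret prob_space M by fact
  have s: "0 < 1 / sqrt (real N)" using N by simp
  have d': "distributed M lborel (\<lambda>\<omega>. (X \<omega> - 0) / (1 / sqrt (real N))) std_normal_density"
    using normal_standard_normal_convert[OF s, of X 0] d by simp
  have m: "(\<lambda>\<omega>. (X \<omega> - 0) / (1 / sqrt (real N))) \<in> measurable M lborel" using distributed_measurable[OF d'] .
  have "(CLINT \<omega>|M. iexp (t * X \<omega>)) = (CLINT \<omega>|M. iexp ((t / sqrt N) * ((X \<omega> - 0) / (1 / sqrt (real N)))))"
    using N by simp
  also have "\<dots> = (CLINT x|distr M lborel (\<lambda>\<omega>. (X \<omega> - 0) / (1 / sqrt (real N))). iexp ((t / sqrt N) * x))"
    by (rule integral_distr[symmetric, OF m]) simp
  also have "\<dots> = (CLINT x|std_normal_distribution. iexp ((t / sqrt N) * x))"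
    by (simp only: distributed_distr_eq_density[OF d'])
  also have "\<dots> = complex_of_real (exp (- (t / sqrt N)\<^sup>2 / 2))" by (rule std_normal_iexp)
  finally show ?thesis using N by (simp add: power_divide)
qed

text \<open>Independence is given for the strict upper triangle only; padding with zeros extends it
  to a family over all positions, from which the symmetric matrix is a linear image.\<close>

lemma gaussian_family_sk_upper:
  fixes g :: "nat \<Rightarrow> nat \<Rightarrow> 'a \<Rightarrow> real"
  assumes sk: "sk_matrix M N g" and N: "N \<ge> 1"
  defines "E \<equiv> {(i, j). 1 \<le> i \<and> i < j \<and> j \<le> N}"
  shows "gaussian_family M (\<lambda>a \<omega>. if a \<in> E then g (fst a) (snd a) \<omega> else 0) (\<lambda>a b. if a = b \<and> a \<in> E then 1 / real N else 0)"
  unfolding gaussian_family_def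
proof (intro conjI allI impI)
  show M: "prob_space M" using sk by (simp add: sk_matrix_def)
  interpret prob_space M by fact
  have d: "distributed M lborel (g (fst a) (snd a)) (normal_density 0 (1 / sqrt (real N)))" if "a \<in> E" for a
    using sk that by (auto simp: sk_matrix_def E_def)
  have m: "g (fst a) (snd a) \<in> borel_measurable M" if "a \<in> E" for a
    using distributed_measurable[OF d[OF that]] by simp
  then show "(\<lambda>\<omega>. if a \<in> E then g (fst a) (snd a) \<omega> else 0) \<in> borel_measurable M" for a by (cases "a \<in> E") auto
  have ind: "indep_vars (\<lambda>_. borel) (\<lambda>a. g (fst a) (snd a)) E"
    using sk by (simp add: sk_matrix_def E_def case_prod_beta')
  fix J :: "(nat \<times> nat) set" and t assume J: "finite J"
  define K where "K = J \<inter> E"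
  have K: "finite K" "K \<subseteq> E" using J by (auto simp: K_def)
  have ind': "indep_vars (\<lambda>_. borel) (\<lambda>a \<omega>. iexp (t a * g (fst a) (snd a) \<omega>)) K"
    by (rule indep_vars_compose2[OF indep_vars_subset[OF ind K(2)], of "\<lambda>a x. iexp (t a * x)"]) simp
  have s: "(\<Sum>a\<in>J. t a * (if a \<in> E then g (fst a) (snd a) \<omega> else 0)) = (\<Sum>a\<in>K. t a * g (fst a) (snd a) \<omega>)" for \<omega>
    unfolding K_def using J by (intro sum.mono_neutral_cong_right) auto
  have v: "(\<Sum>a\<in>J. \<Sum>b\<in>J. t a * t b * (if a = b \<and> a \<in> E then 1 / real N else 0)) = (\<Sum>a\<in>K. (t a)\<^sup>2 / real N)"
  proof -
    have "(\<Sum>a\<in>J. \<Sum>b\<in>J. t a * t b * (if a = b \<and> a \<in> E then 1 / real N else 0)) = (\<Sum>a\<in>J. if a \<in> E then (t a)\<^sup>2 / real N else 0)"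
    proof (rule sum.cong[OF refl])
      fix a assume a: "a \<in> J"
      have "(\<Sum>b\<in>J. t a * t b * (if a = b \<and> a \<in> E then 1 / real N else 0)) = (\<Sum>b\<in>J. if b = a then (if a \<in> E then (t a)\<^sup>2 / real N else 0) else 0)"
        by (rule sum.cong) (auto simp: power2_eq_square)
      then show "(\<Sum>b\<in>J. t a * t b * (if a = b \<and> a \<in> E then 1 / real N else 0)) = (if a \<in> E then (t a)\<^sup>2 / real N else 0)"
        using J a by simp
    qed
    also have "\<dots> = (\<Sum>a\<in>K. (t a)\<^sup>2 / real N)" unfolding K_def using J by (intro sum.mono_neutral_cong_right) auto
    finally show ?thesis .
  qed
  have "(CLINT \<omega>|M. iexp (\<Sum>a\<in>J. t a * (if a \<in> E then g (fst a) (snd a) \<omega> else 0))) = (CLINT \<omega>|M. (\<Prod>a\<in>K. iexp (t a * g (fst a) (snd a) \<omega>)))"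
    unfolding s using K by (simp add: exp_sum sum_distrib_left)
  also have "\<dots> = (\<Prod>a\<in>K. CLINT \<omega>|M. iexp (t a * g (fst a) (snd a) \<omega>))"
  proof (rule indep_vars_lebesgue_integral[OF K(1) ind'])
    fix a assume "a \<in> K"
    then have [measurable]: "g (fst a) (snd a) \<in> borel_measurable M" using m K by auto
    show "integrable M (\<lambda>\<omega>. iexp (t a * g (fst a) (snd a) \<omega>))" by (rule integrable_const_bound[where B=1]) auto
  qed
  also have "\<dots> = (\<Prod>a\<in>K. complex_of_real (exp (- ((t a)\<^sup>2 / real N) / 2)))"
    by (intro prod.cong refl iexp_normal[OF M d N]) (use K in auto)
  also have "\<dots> = complex_of_real (exp (- (\<Sum>a\<in>K. (t a)\<^sup>2 / real N) / 2))"
  proof -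
    have "(\<Prod>a\<in>K. exp (- ((t a)\<^sup>2 / real N) / 2)) = exp (\<Sum>a\<in>K. - ((t a)\<^sup>2 / real N) / 2)" by (rule exp_sum[OF K(1), symmetric])
    also have "(\<Sum>a\<in>K. - ((t a)\<^sup>2 / real N) / 2) = - (\<Sum>a\<in>K. (t a)\<^sup>2 / real N) / 2"
      by (simp only: sum_divide_distrib[symmetric] sum_negf)
    finally show ?thesis by (simp only: of_real_prod[symmetric])
  qed
  finally show "(CLINT \<omega>|M. iexp (\<Sum>a\<in>J. t a * (if a \<in> E then g (fst a) (snd a) \<omega> else 0)))
     = complex_of_real (exp (- (\<Sum>a\<in>J. \<Sum>b\<in>J. t a * t b * (if a = b \<and> a \<in> E then 1 / real N else 0)) / 2))"
    unfolding v .
qed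

lemma gaussian_family_sk:
  fixes g :: "nat \<Rightarrow> nat \<Rightarrow> 'a \<Rightarrow> real"
  assumes sk: "sk_matrix M N g" and N: "N \<ge> 1"
  shows "gaussian_family M (\<lambda>a \<omega>. if fst a \<in> {1..N} \<and> snd a \<in> {1..N} then g (fst a) (snd a) \<omega> else 0)
      (\<lambda>a b. if fst a = snd a \<or> fst b = snd b then 0
         else (unit_entry N (fst a) (fst b) * unit_entry N (snd a) (snd b) + unit_entry N (fst a) (snd b) * unit_entry N (snd a) (fst b)) / real N)"
proof -
  define E where "E = {(i, j). 1 \<le> i \<and> i < j \<and> j \<le> N}"
  \<comment> \<open>Of a position and its transpose at most one lies in the strict upper triangle,
    so the sum over both picks the right entry.\<close>
  define I where "I a = (if fst a = snd a then {} else {a, (snd a, fst a)})" for a :: "nat \<times> nat"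
  have sym: "g i j \<omega> = g j i \<omega>" if "i \<in> {1..N}" "j \<in> {1..N}" "\<omega> \<in> space M" for i j \<omega>
    using sk that by (simp add: sk_matrix_def)
  have diag: "g i i \<omega> = 0" if "i \<in> {1..N}" "\<omega> \<in> space M" for i \<omega>
    using sk that by (simp add: sk_matrix_def)
  show ?thesis
  proof (rule gaussian_family_cong[OF gaussian_family_linear[OF gaussian_family_sk_upper[OF sk N], of I "\<lambda>_ _. 1"]])
    show "finite (I a)" for a by (simp add: I_def)
    show "(\<Sum>i\<in>I a. 1 * (if i \<in> {(i, j). 1 \<le> i \<and> i < j \<and> j \<le> N} then g (fst i) (snd i) \<omega> else 0))
       = (if fst a \<in> {1..N} \<and> snd a \<in> {1..N} then g (fst a) (snd a) \<omega> else 0)" if "\<omega> \<in> space M" for a \<omega>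
      by (cases "fst a" "snd a" rule: linorder_cases; cases a)
         (use that sym diag in \<open>auto simp: I_def\<close>)
    show "(\<Sum>i\<in>I a. \<Sum>j\<in>I b. 1 * 1 * (if i = j \<and> i \<in> {(i, j). 1 \<le> i \<and> i < j \<and> j \<le> N} then 1 / real N else 0))
       = (if fst a = snd a \<or> fst b = snd b then 0
         else (unit_entry N (fst a) (fst b) * unit_entry N (snd a) (snd b) + unit_entry N (fst a) (snd b) * unit_entry N (snd a) (fst b)) / real N)" for a b
    proof (cases "fst a = snd a \<or> fst b = snd b")
      case True
      then show ?thesis by (auto simp: I_def)
    next
      case False
      obtain i j k l where ab: "a = (i, j)" "b = (k, l)" by (cases a, cases b) auto
      show ?thesis using False unfolding ab
        by (cases "i < j"; cases "k < l") (auto simp: I_def unit_entry_def)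
    qed
  qed
qed

text \<open>The given matrices live on probability spaces that may change with \<open>N\<close>;
  since only their law matters, one array space can replace them all.\<close>

lemma iter_msd_off_diag:
  assumes sk: "sk_matrix M N g" and N: "N \<ge> 1"
  shows "iter_msd h \<beta> q M N g k k' = (LINT W|iid_normal. tap_msd h \<beta> q N k k' (\<lambda>i j. off_diag N W (i, j)))"
proof -
  have m: "(\<lambda>S. tap_msd h \<beta> q N k k' (\<lambda>i j. S (i, j))) \<in> borel_measurable (PiM UNIV (\<lambda>_. borel))"
    by (rule tap_msd_measurable) simp
  have "iter_msd h \<beta> q M N g k k' = (LINT \<omega>|M. tap_msd h \<beta> q N k k' (\<lambda>i j. (\<lambda>a. if fst a \<in> {1..N} \<and> snd a \<in> {1..N} then g (fst a) (snd a) \<omega> else 0) (i, j)))"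
    unfolding iter_msd_def tap_msd_def[symmetric]
    by (intro Bochner_Integration.integral_cong refl tap_msd_cong) simp
  also have "\<dots> = (LINT W|iid_normal. tap_msd h \<beta> q N k k' (\<lambda>i j. off_diag N W (i, j)))"
    by (rule gaussian_family_integral(1)[OF gaussian_family_sk[OF sk N] gaussian_family_off_diag m])
  finally show ?thesis .
qed

section \<open>Iterates with and without the diagonal\<close>

context tap_model
begin

lemma tap_iter_bound: "\<bar>tap_iter h \<beta> q N A k i\<bar> \<le> 1"
proof -
  consider "k = 0" | "k = Suc 0" | l where "k = Suc (Suc l)" by (metis not0_implies_Suc)
  then show ?thesis using f_bound sqrt_q_le_1 q_pos by cases auto
qed

lemma nnorm_tap_iter: "nnorm N (tap_iter h \<beta> q N A k) \<le> 1"
  by (rule nnorm_le_1) (rule tap_iter_bound)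

abbreviation full_iter :: "nat \<Rightarrow> (nat \<times> nat \<Rightarrow> real) \<Rightarrow> nat \<Rightarrow> nat \<Rightarrow> real" where
  "full_iter N W \<equiv> tap_iter h \<beta> q N (\<lambda>i j. sym_mat N W (i, j) / sqrt (real N))"

abbreviation off_iter :: "nat \<Rightarrow> (nat \<times> nat \<Rightarrow> real) \<Rightarrow> nat \<Rightarrow> nat \<Rightarrow> real" where
  "off_iter N W \<equiv> tap_iter h \<beta> q N (\<lambda>i j. off_diag N W (i, j))"

text \<open>Induction with the Lipschitz bound of \<open>f\<close>. The matrices differ by a
  diagonal \<open>D\<close>, and \<open>D\<close> applied to an iterate has norm at most that of
  \<open>D\<close> because iterates are bounded by 1. The earlier differences are carried along with
  constants that do not grow in \<open>N\<close>, by the operator norm bound.\<close>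

lemma diagonal_negligible: "plim (\<lambda>N W. nnorm N (\<lambda>i. off_iter N W k i - full_iter N W k i)) 0"
proof (induction k rule: less_induct)
  case (less k)
  consider "k = 0" | "k = Suc 0" | l where "k = Suc (Suc l)" by (metis not0_implies_Suc)
  then show ?case
  proof cases
    case 3
    obtain K where K: "K > 0" "eventually (\<lambda>p. \<forall>x y. bform (fst p) x y (snd p)
      \<le> K * sqrt (real (fst p)) * real (fst p) * (nnorm (fst p) x * nnorm (fst p) y)) array_filter"
      by (rule operator_norm_bound)
    let ?d = "\<lambda>N W k. nnorm N (\<lambda>i. off_iter N W k i - full_iter N W k i)"
    let ?D = "\<lambda>N W. nnorm N (\<lambda>i. sym_mat N W (i, i) / sqrt N)"
    let ?b = "\<lambda>N W. \<beta> * (sqrt 2 * K * ?d N W (Suc l) + ?D N W + \<bar>\<beta> * (1 - q)\<bar> * ?d N W l)"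
    have "plim ?b (\<beta> * (sqrt 2 * K * 0 + 0 + \<bar>\<beta> * (1 - q)\<bar> * 0))"
      by (intro tendsto_intros diagonal_small less) (simp_all add: 3)
    then have lim: "plim ?b 0" by simp
    have step: "?d N W k \<le> ?b N W"
      if N: "N \<ge> 1" and W: "\<forall>x y. bform N x y W \<le> K * sqrt N * N * (nnorm N x * nnorm N y)" for N W
    proof -
      define A B where "A = (\<lambda>i j. off_diag N W (i, j))" and "B = (\<lambda>i j. sym_mat N W (i, j) / sqrt N)"
      define u v where "u = tap_iter h \<beta> q N A" and "v = tap_iter h \<beta> q N B"
      define D where "D i = sym_mat N W (i, i) / sqrt N" for i
      have AB: "matvec N A y i = matvec N B y i - D i * y i" if i: "i \<in> {1..N}" for y i
      proof -
        have "matvec N A y i = (\<Sum>j=1..N. B i j * y j - (if j = i then D i * y i else 0))"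
          unfolding matvec_def by (intro sum.cong refl) (auto simp: A_def B_def D_def off_diag_def)
        also have "\<dots> = matvec N B y i - D i * y i" using i by (simp add: sum_subtractf matvec_def)
        finally show ?thesis .
      qed
      have lin: "matvec N B (u (Suc l)) i - matvec N B (v (Suc l)) i = matvec N B (\<lambda>i. u (Suc l) i - v (Suc l) i) i" for i
        by (simp add: matvec_def sum_subtractf right_diff_distrib)
      have "nnorm N (\<lambda>i. u k i - v k i) \<le> nnorm N (\<lambda>i. \<beta> * (matvec N B (\<lambda>i. u (Suc l) i - v (Suc l) i) i + ((- 1) * (D i * u (Suc l) i) + (- (\<beta> * (1 - q))) * (u l i - v l i))))"
      proof (rule nnorm_mono)
        fix i assume i: "i \<in> {1..N}"
        have "\<bar>u k i - v k i\<bar> \<le> \<beta> * \<bar>(matvec N A (u (Suc l)) i - \<beta> * (1 - q) * u l i) - (matvec N B (v (Suc l)) i - \<beta> * (1 - q) * v l i)\<bar>"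
          unfolding u_def v_def 3 tap_iter.simps by (rule f_lipschitz)
        also have "(matvec N A (u (Suc l)) i - \<beta> * (1 - q) * u l i) - (matvec N B (v (Suc l)) i - \<beta> * (1 - q) * v l i)
            = matvec N B (\<lambda>i. u (Suc l) i - v (Suc l) i) i + ((- 1) * (D i * u (Suc l) i) + (- (\<beta> * (1 - q))) * (u l i - v l i))"
          unfolding AB[OF i] lin[symmetric] by (simp add: algebra_simps)
        also have "\<beta> * \<bar>\<dots>\<bar> = \<bar>\<beta> * \<dots>\<bar>" using beta_pos by (simp add: abs_mult)
        finally show "\<bar>u k i - v k i\<bar> \<le> \<bar>\<beta> * (matvec N B (\<lambda>i. u (Suc l) i - v (Suc l) i) i + ((- 1) * (D i * u (Suc l) i) + (- (\<beta> * (1 - q))) * (u l i - v l i)))\<bar>" .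
      qed
      also have "\<dots> = \<beta> * nnorm N (\<lambda>i. matvec N B (\<lambda>i. u (Suc l) i - v (Suc l) i) i + ((- 1) * (D i * u (Suc l) i) + (- (\<beta> * (1 - q))) * (u l i - v l i)))"
        unfolding nnorm_scale using beta_pos by simp
      also have "\<dots> \<le> \<beta> * (nnorm N (matvec N B (\<lambda>i. u (Suc l) i - v (Suc l) i)) + (nnorm N (\<lambda>i. (- 1) * (D i * u (Suc l) i)) + nnorm N (\<lambda>i. (- (\<beta> * (1 - q))) * (u l i - v l i))))"
        using beta_pos by (intro mult_left_mono order_trans[OF nnorm_triangle] add_left_mono nnorm_triangle) simp
      also have "\<dots> \<le> \<beta> * (sqrt 2 * K * nnorm N (\<lambda>i. u (Suc l) i - v (Suc l) i) + (nnorm N D + \<bar>\<beta> * (1 - q)\<bar> * nnorm N (\<lambda>i. u l i - v l i)))"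
      proof (intro mult_left_mono add_mono)
        show "nnorm N (matvec N B (\<lambda>i. u (Suc l) i - v (Suc l) i)) \<le> sqrt 2 * K * nnorm N (\<lambda>i. u (Suc l) i - v (Suc l) i)"
          unfolding B_def by (rule matvec_sym_bound[OF W N K(1)])
        show "nnorm N (\<lambda>i. (- 1) * (D i * u (Suc l) i)) \<le> nnorm N D"
          by (rule nnorm_mono) (use tap_iter_bound in \<open>simp add: abs_mult u_def mult_left_le\<close>)
        show "nnorm N (\<lambda>i. (- (\<beta> * (1 - q))) * (u l i - v l i)) \<le> \<bar>\<beta> * (1 - q)\<bar> * nnorm N (\<lambda>i. u l i - v l i)"
          unfolding nnorm_scale by simp
      qed (use beta_pos in simp)
      finally show ?thesis unfolding u_def v_def A_def B_def D_def by (simp add: add.assoc)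
    qed
    show ?thesis
    proof (rule Lim_null_comparison[OF _ lim])
      show "\<forall>\<^sub>F p in array_filter. norm (?d (fst p) (snd p) k) \<le> ?b (fst p) (snd p)"
        using K(2) iid.eventually_fst_prob_filter[OF eventually_ge_at_top[of 1]]
        by eventually_elim (use step in simp)
    qed
  qed (simp_all add: nnorm_def nip_def)
qed

lemma tap_msd_diff:
  "\<bar>tap_msd h \<beta> q N k k' A - tap_msd h \<beta> q N k k' B\<bar>
    \<le> 4 * (nnorm N (\<lambda>i. tap_iter h \<beta> q N A k i - tap_iter h \<beta> q N B k i) + nnorm N (\<lambda>i. tap_iter h \<beta> q N A k' i - tap_iter h \<beta> q N B k' i))"
proof -
  let ?a = "\<lambda>i. tap_iter h \<beta> q N A k i - tap_iter h \<beta> q N A k' i" and ?b = "\<lambda>i. tap_iter h \<beta> q N B k i - tap_iter h \<beta> q N B k' i"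
  let ?p = "\<lambda>i. tap_iter h \<beta> q N A k i - tap_iter h \<beta> q N B k i" and ?q = "\<lambda>i. tap_iter h \<beta> q N A k' i - tap_iter h \<beta> q N B k' i"
  have 2: "nnorm N (\<lambda>i. tap_iter h \<beta> q N A k i - tap_iter h \<beta> q N A k' i) \<le> 2" for A
    using nnorm_diff_triangle[of N "tap_iter h \<beta> q N A k" "tap_iter h \<beta> q N A k'"] nnorm_tap_iter[of N A k] nnorm_tap_iter[of N A k'] by linarith
  have d: "nnorm N x - nnorm N y \<le> nnorm N (\<lambda>i. x i - y i)" for x y
    using nnorm_triangle[of N "\<lambda>i. x i - y i" y] by simp
  have sw: "nnorm N (\<lambda>i. ?b i - ?a i) = nnorm N (\<lambda>i. ?a i - ?b i)"
    using nnorm_scale[of N "-1" "\<lambda>i. ?a i - ?b i"] by simp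
  have 1: "\<bar>nnorm N ?a - nnorm N ?b\<bar> \<le> nnorm N (\<lambda>i. ?a i - ?b i)"
    using d[of ?a ?b] d[of ?b ?a] unfolding sw by linarith
  have e: "(\<lambda>i. ?a i - ?b i) = (\<lambda>i. ?p i - ?q i)" by auto
  have 3: "nnorm N (\<lambda>i. ?a i - ?b i) \<le> nnorm N ?p + nnorm N ?q"
    unfolding e by (rule nnorm_diff_triangle)
  have "\<bar>tap_msd h \<beta> q N k k' A - tap_msd h \<beta> q N k k' B\<bar> = \<bar>(nnorm N ?a - nnorm N ?b) * (nnorm N ?a + nnorm N ?b)\<bar>"
    by (simp add: tap_msd_def power2_eq_square algebra_simps)
  also have "\<dots> = \<bar>nnorm N ?a - nnorm N ?b\<bar> * (nnorm N ?a + nnorm N ?b)" by (simp add: abs_mult)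
  also have "\<dots> \<le> (nnorm N ?p + nnorm N ?q) * 4"
    using 1 2[of A] 2[of B] 3 by (intro mult_mono) auto
  finally show ?thesis by simp
qed

lemma tap_msd_bound: "0 \<le> tap_msd h \<beta> q N k k' A" "tap_msd h \<beta> q N k k' A \<le> 4"
proof -
  have "nnorm N (\<lambda>i. tap_iter h \<beta> q N A k i - tap_iter h \<beta> q N A k' i) \<le> 2"
    using nnorm_diff_triangle[of N "tap_iter h \<beta> q N A k" "tap_iter h \<beta> q N A k'"] nnorm_tap_iter[of N A k] nnorm_tap_iter[of N A k'] by linarith
  then have "tap_msd h \<beta> q N k k' A \<le> 2\<^sup>2" unfolding tap_msd_def by (rule power_mono) simp
  then show "tap_msd h \<beta> q N k k' A \<le> 4" by simp
qed (simp add: tap_msd_def)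

lemma full_msd_limit:
  assumes "j < k"
  shows "(\<lambda>N. LINT W|iid_normal. tap_msd h \<beta> q N (Suc j) (Suc k) (\<lambda>i j. sym_mat N W (i, j) / sqrt (real N))) \<longlonglongrightarrow> 2 * (q - rho j)"
proof -
  have "(LINT W|iid_normal. tap_msd h \<beta> q N (Suc j) (Suc k) (\<lambda>i j. sym_mat N W (i, j) / sqrt (real N)))
     = (LINT \<zeta>|iid_normal. (nnorm N (\<lambda>i. sim_iter N \<zeta> j i - sim_iter N \<zeta> k i))\<^sup>2)" for N
  proof -
    have m1: "(\<lambda>W. tap_msd h \<beta> q N (Suc j) (Suc k) (\<lambda>i j. sym_mat N W (i, j) / sqrt (real N))) \<in> borel_measurable iid_normal"
      using measurable_matrix_entry[OF measurable_sym_mat] by (intro tap_msd_measurable) measurable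
    have m2: "(\<lambda>\<zeta>. (nnorm N (\<lambda>i. sim_iter N \<zeta> j i - sim_iter N \<zeta> k i))\<^sup>2) \<in> borel_measurable iid_normal"
      by (intro borel_measurable_power nnorm_measurable) measurable
    show ?thesis
      by (subst (1 2) integral_eq_nn_integral) (use m1 m2 tap_msd_bound(1) goe_iterates[of N j k] in simp_all)
  qed
  then show ?thesis using sim_iter_msd_limit[OF assms] by simp
qed

lemma off_msd_limit:
  assumes "j < k"
  shows "(\<lambda>N. LINT W|iid_normal. tap_msd h \<beta> q N (Suc j) (Suc k) (\<lambda>i j. off_diag N W (i, j))) \<longlonglongrightarrow> 2 * (q - rho j)"
proof -
  let ?F = "\<lambda>N W. tap_msd h \<beta> q N (Suc j) (Suc k) (\<lambda>i j. sym_mat N W (i, j) / sqrt (real N))"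
  let ?O = "\<lambda>N W. tap_msd h \<beta> q N (Suc j) (Suc k) (\<lambda>i j. off_diag N W (i, j))"
  have mF[measurable]: "?F N \<in> borel_measurable iid_normal" for N
    using measurable_matrix_entry[OF measurable_sym_mat] by (intro tap_msd_measurable) measurable
  have mO[measurable]: "?O N \<in> borel_measurable iid_normal" for N
    by (intro tap_msd_measurable gaussian_familyD(2)[OF gaussian_family_off_diag])
  have iF: "integrable iid_normal (?F N)" for N
    by (rule iid.integrable_const_bound[where B=4]) (use tap_msd_bound in auto)
  have iO: "integrable iid_normal (?O N)" for N
    by (rule iid.integrable_const_bound[where B=4]) (use tap_msd_bound in auto)
  have "(\<lambda>N. LINT W|iid_normal. ?O N W - ?F N W) \<longlonglongrightarrow> 0"
  proof (rule iid.bounded_convergence_in_prob[where B=8])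
    show "\<bar>?O N W - ?F N W\<bar> \<le> 8" for N W
      using tap_msd_bound[of N "Suc j" "Suc k" "\<lambda>i j. off_diag N W (i, j)"] tap_msd_bound[of N "Suc j" "Suc k" "\<lambda>i j. sym_mat N W (i, j) / sqrt (real N)"]
      by linarith
    show "plim (\<lambda>N W. ?O N W - ?F N W) 0"
    proof (rule plim_squeeze[OF _ tap_msd_diff])
      show "plim (\<lambda>N W. 4 * (nnorm N (\<lambda>i. off_iter N W (Suc j) i - full_iter N W (Suc j) i) + nnorm N (\<lambda>i. off_iter N W (Suc k) i - full_iter N W (Suc k) i))) 0"
        using tendsto_mult[OF tendsto_const[of 4] tendsto_add[OF diagonal_negligible[of "Suc j"] diagonal_negligible[of "Suc k"]]] by simp
    qed
  qed measurable
  then have "(\<lambda>N. (LINT W|iid_normal. ?O N W) - (LINT W|iid_normal. ?F N W)) \<longlonglongrightarrow> 0" using iO iF by simp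
  from tendsto_add[OF this full_msd_limit[OF assms]] show ?thesis by simp
qed

section \<open>Limits for the given matrices\<close>

lemma iter_msd_limit:
  assumes sk: "\<forall>N\<ge>1. sk_matrix (M N) N (g N)" and "j < k"
  shows "(\<lambda>N. iter_msd h \<beta> q (M N) N (g N) (Suc j) (Suc k)) \<longlonglongrightarrow> 2 * (q - rho j)"
proof (rule Lim_transform_eventually[OF off_msd_limit[OF \<open>j < k\<close>]])
  show "\<forall>\<^sub>F N in sequentially. (LINT W|iid_normal. tap_msd h \<beta> q N (Suc j) (Suc k) (\<lambda>i j. off_diag N W (i, j))) = iter_msd h \<beta> q (M N) N (g N) (Suc j) (Suc k)"
    using eventually_ge_at_top[of 1] by eventually_elim (use sk iter_msd_off_diag in force)
qed

lemma iter_msd_commute: "iter_msd h \<beta> q M N g k k' = iter_msd h \<beta> q M N g k' k"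
proof -
  have "nnorm N (\<lambda>i. x i - y i) = nnorm N (\<lambda>i. y i - x i)" for x y
    using nnorm_scale[of N "-1" "\<lambda>i. x i - y i"] by simp
  then show ?thesis unfolding iter_msd_def by (intro Bochner_Integration.integral_cong refl) metis
qed

lemma limsup_iter_msd:
  assumes sk: "\<forall>N\<ge>1. sk_matrix (M N) N (g N)"
  shows "limsup (\<lambda>N. ereal (iter_msd h \<beta> q (M N) N (g N) (Suc j) (Suc k))) = ereal (if j = k then 0 else 2 * (q - rho (min j k)))"
proof (rule lim_imp_Limsup)
  have "(\<lambda>N. iter_msd h \<beta> q (M N) N (g N) (Suc j) (Suc k)) \<longlonglongrightarrow> (if j = k then 0 else 2 * (q - rho (min j k)))"
  proof (cases j k rule: linorder_cases)
    case less
    then show ?thesis using iter_msd_limit[OF sk less] by simp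
  next
    case equal
    then show ?thesis by (simp add: iter_msd_def nnorm_def nip_def)
  next
    case greater
    then show ?thesis using iter_msd_limit[OF sk greater] by (simp add: iter_msd_commute[of _ _ _ "Suc j"])
  qed
  then show "(\<lambda>N. ereal (iter_msd h \<beta> q (M N) N (g N) (Suc j) (Suc k))) \<longlonglongrightarrow> ereal (if j = k then 0 else 2 * (q - rho (min j k)))"
    by (rule tendsto_ereal)
qed simp

text \<open>The pair of the first and the zeroth iterate lies outside the shifted indexing and is
  computed directly.\<close>

lemma limsup_iter_msd_0:
  assumes sk: "\<forall>N\<ge>1. sk_matrix (M N) N (g N)"
  shows "limsup (\<lambda>N. ereal (iter_msd h \<beta> q (M N) N (g N) (Suc 0) 0)) = ereal q"
proof (rule lim_imp_Limsup)
  have q: "iter_msd h \<beta> q (M N) N (g N) (Suc 0) 0 = q" if "N \<ge> 1" for N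
  proof -
    interpret prob_space "M N" using sk that by (simp add: sk_matrix_def)
    show ?thesis using that q_pos by (simp add: iter_msd_def nnorm_def nip_def prob_space)
  qed
  have "\<forall>\<^sub>F N in sequentially. ereal (iter_msd h \<beta> q (M N) N (g N) (Suc 0) 0) = ereal q"
    by (rule eventually_mono[OF eventually_ge_at_top[of 1]]) (simp add: q)
  then show "(\<lambda>N. ereal (iter_msd h \<beta> q (M N) N (g N) (Suc 0) 0)) \<longlonglongrightarrow> ereal q" by (rule tendsto_eventually)
qed simp

lemma iter_msd_cauchy:
  assumes sk: "\<forall>N\<ge>1. sk_matrix (M N) N (g N)"
  shows "((\<lambda>(k, k'). limsup (\<lambda>N. ereal (iter_msd h \<beta> q (M N) N (g N) k k'))) \<longlongrightarrow> 0) (sequentially \<times>\<^sub>F sequentially)"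
proof -
  define L where "L j k = (if j = k then 0 else 2 * (q - rho (min j k)))" for j k
  \<comment> \<open>The shift by one undoes the indexing of \<open>rho\<close>; truncated
    subtraction at 0 is invisible to the filter.\<close>
  have "((\<lambda>p. L (fst p - 1) (snd p - 1)) \<longlongrightarrow> 0) (sequentially \<times>\<^sub>F sequentially)"
  proof (rule tendstoI)
    fix e :: real assume e: "e > 0"
    have "\<forall>\<^sub>F k in sequentially. dist (rho k) q < e / 2" using tendstoD[OF rho_tendsto, of "e / 2"] e by simp
    then obtain K where K: "\<And>k. k \<ge> K \<Longrightarrow> dist (rho k) q < e / 2" unfolding eventually_sequentially by blast
    have "dist (L (m - 1) (n - 1)) 0 < e" if "m \<ge> Suc K" "n \<ge> Suc K" for m n
    proof -
      have "K \<le> min (m - 1) (n - 1)" using that by auto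
      from K[OF this] show ?thesis using e rho_bounds(2)[of "min (m - 1) (n - 1)"] by (auto simp: L_def dist_real_def abs_if)
    qed
    then show "\<forall>\<^sub>F p in sequentially \<times>\<^sub>F sequentially. dist (L (fst p - 1) (snd p - 1)) 0 < e"
      unfolding eventually_prod_sequentially by (intro exI[of _ "Suc K"]) simp
  qed
  then have "((\<lambda>p. ereal (L (fst p - 1) (snd p - 1))) \<longlongrightarrow> ereal 0) (sequentially \<times>\<^sub>F sequentially)"
    by (rule tendsto_ereal)
  moreover have "\<forall>\<^sub>F p in sequentially \<times>\<^sub>F sequentially. ereal (L (fst p - 1) (snd p - 1)) = (case p of (k, k') \<Rightarrow> limsup (\<lambda>N. ereal (iter_msd h \<beta> q (M N) N (g N) k k')))"
    unfolding eventually_prod_sequentially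
  proof (intro exI[of _ 1] allI impI)
    fix m n :: nat assume "1 \<le> m" "1 \<le> n"
    then show "ereal (L (fst (n, m) - 1) (snd (n, m) - 1)) = (case (n, m) of (k, k') \<Rightarrow> limsup (\<lambda>N. ereal (iter_msd h \<beta> q (M N) N (g N) k k')))"
      using limsup_iter_msd[OF sk, of "n - 1" "m - 1"] by (simp add: L_def)
  qed
  ultimately show ?thesis unfolding zero_ereal_def by (rule Lim_transform_eventually)
qed

lemma iter_msd_geometric:
  assumes strict: "alpha < 1"
  obtains r C where "0 < r" "r < 1" "C > 0"
    "\<And>(M :: nat \<Rightarrow> 'a measure) g k. \<forall>N\<ge>1. sk_matrix (M N) N (g N) \<Longrightarrow>
       limsup (\<lambda>N. ereal (iter_msd h \<beta> q (M N) N (g N) (k + 1) k)) \<le> ereal (C * r ^ k)"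
proof -
  \<comment> \<open>The maximum keeps \<open>r\<close> bounded away from 0, so that dividing by it
    is safe.\<close>
  define r where "r = max alpha (1 / 2)"
  \<comment> \<open>The division by \<open>r\<close> pays for the index shift, since step
    \<open>k\<close> is governed by \<open>rho (k - 1)\<close>; it also gives
    \<open>q \<le> C\<close> for the case \<open>k = 0\<close>.\<close>
  define C where "C = 2 * q / r"
  have r: "0 < r" "r < 1" "alpha \<le> r" using strict by (auto simp: r_def)
  have C: "C > 0" using q_pos r by (simp add: C_def)
  have a0: "0 \<le> alpha" unfolding alpha_eq by simp
  have "limsup (\<lambda>N. ereal (iter_msd h \<beta> q (M N) N (g N) (k + 1) k)) \<le> ereal (C * r ^ k)"
    if sk: "\<forall>N\<ge>1. sk_matrix (M N) N (g N)" for M :: "nat \<Rightarrow> 'a measure" and g k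
  proof (cases k)
    case 0
    have "q \<le> C" using q_pos r by (simp add: C_def field_simps)
    then show ?thesis using limsup_iter_msd_0[OF sk] 0 by simp
  next
    case (Suc j)
    have "2 * (q - rho j) \<le> 2 * (q * alpha ^ j)" using rho_gap[of j] by simp
    also have "\<dots> \<le> 2 * (q * r ^ j)" using q_pos a0 r by (intro mult_left_mono power_mono) auto
    also have "\<dots> = C * r ^ k" using r by (simp add: C_def Suc)
    finally show ?thesis using limsup_iter_msd[OF sk, of "Suc j" j] Suc by simp
  qed
  then show ?thesis using that r C by blast
qed

end

theorem theorem2p1:
  fixes h \<beta> q :: real
  assumes h_pos: "h > 0" and beta_pos: "\<beta> > 0"
    and q_pos: "q > 0"
    and q_eq: "q = (\<integral>z. (tanh (h + \<beta> * sqrt q * z))\<^sup>2 \<partial>std_normal_distribution)"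
    and AT: "\<beta>\<^sup>2 * (\<integral>z. 1 / cosh (h + \<beta> * sqrt q * z) ^ 4 \<partial>std_normal_distribution) \<le> 1"
  shows
    "(\<forall>(M :: nat \<Rightarrow> 'a measure) g. (\<forall>N\<ge>1. sk_matrix (M N) N (g N)) \<longrightarrow>
        ((\<lambda>(k, k'). limsup (\<lambda>N. ereal (iter_msd h \<beta> q (M N) N (g N) k k'))) \<longlongrightarrow> 0)
          (sequentially \<times>\<^sub>F sequentially))
     \<and>
     (\<beta>\<^sup>2 * (\<integral>z. 1 / cosh (h + \<beta> * sqrt q * z) ^ 4 \<partial>std_normal_distribution) < 1 \<longrightarrow>
        (\<exists>r C. 0 < r \<and> r < 1 \<and> C > 0 \<and>
          (\<forall>(M :: nat \<Rightarrow> 'a measure) g. (\<forall>N\<ge>1. sk_matrix (M N) N (g N)) \<longrightarrow>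
            (\<forall>k. limsup (\<lambda>N. ereal (iter_msd h \<beta> q (M N) N (g N) (k + 1) k))
                   \<le> ereal (C * r ^ k)))))"
proof -
  interpret tap_model h \<beta> q by unfold_locales (fact assms)+
  show ?thesis
  proof (intro conjI allI impI)
    fix M :: "nat \<Rightarrow> 'a measure" and g assume "\<forall>N\<ge>1. sk_matrix (M N) N (g N)"
    then show "((\<lambda>(k, k'). limsup (\<lambda>N. ereal (iter_msd h \<beta> q (M N) N (g N) k k'))) \<longlongrightarrow> 0) (sequentially \<times>\<^sub>F sequentially)"
      by (rule iter_msd_cauchy)
  next
    assume "\<beta>\<^sup>2 * (\<integral>z. 1 / cosh (h + \<beta> * sqrt q * z) ^ 4 \<partial>std_normal_distribution) < 1"
    then have "alpha < 1" by (simp add: alpha_def)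
    then show "\<exists>r C. 0 < r \<and> r < 1 \<and> C > 0 \<and>
          (\<forall>(M :: nat \<Rightarrow> 'a measure) g. (\<forall>N\<ge>1. sk_matrix (M N) N (g N)) \<longrightarrow>
            (\<forall>k. limsup (\<lambda>N. ereal (iter_msd h \<beta> q (M N) N (g N) (k + 1) k)) \<le> ereal (C * r ^ k)))"
      by (rule iter_msd_geometric[where 'a='a]) blast
  qed
qed

end
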